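(* Let $n\ge1$, let $\theta$ be a real skew-symmetric $n\times n$ matrix, let $1\le p\le\infty$ and $d\ge 1$, and let $x$ be a holomorphic polynomial in the quantum torus $\mathbb{T}_\theta$. \begin{enumerate} \item If $x\in\mathcal{P}^{\ge d}$, then $\|P^\theta_t(x)\|_p\le e^{-td}\|x\|_p$ for all $t\ge0$, and $\|L_\theta(x)\|_p\ge d\|x\|_p$. \item If $x\in\mathcal{P}^{\le d}$, then $\|L_\theta(x)\|_p\le d\|x\|_p$, and $\|P^\theta_t(x)\|_p\ge e^{-td}\|x\|_p$ for all $t\ge0$. \end{enumerate}
   Context: $\mathcal{A}_\theta$ is the universal $C^*$-algebra generated by unitaries $U_1,\dots,U_n$ with $U_jU_k=e^{2\pi i\theta_{jk}}U_kU_j$. For $\alpha\in\mathbb{Z}^n$, $U^\alpha=U_1^{\alpha_1}\cdots U_n^{\alpha_n}$; polynomials are finite sums $\sum_\alpha x_\alpha U^\alpha$, $x_\alpha\in\mathbb{C}$. The functional $\tau_\theta(\sum_\alpha x_\alpha U^\alpha)=x_0$ extends to a faithful tracial state, and $\mathbb{T}_\theta$ is the von Neumann algebra obtained by the GNS construction of $(\mathcal{A}_\theta,\tau_\theta)$. Norms: $\|x\|_p=\tau_\theta((x^*x)^{p/2})^{1/p}$ for $1\le p<\infty$, operator norm for $p=\infty$. With $|\alpha|=\sum_j|\alpha_j|$, $P^\theta_t(\sum_\alpha x_\alpha U^\alpha)=\sum_\alpha e^{-t|\alpha|}x_\alpha U^\alpha$ and $L_\theta(\sum_\alpha x_\alpha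 U^\alpha)=\sum_\alpha|\alpha|x_\alpha U^\alpha$, so $P^\theta_t=e^{-tL_\theta}$. $\mathcal{P}^{\le d}$ (resp. $\mathcal{P}^{\ge d}$) is the complex span of $\{U^\alpha:|\alpha|\le d\}$ (resp. $\{U^\alpha:|\alpha|\ge d\}$). A polynomial is holomorphic if it has the form $\sum_{\alpha\in\mathbb{N}^n}x_\alpha U^\alpha$ (finite sum, all $\alpha_j\ge0$). *)

theory Defs
  imports "HOL-Analysis.Analysis"
begin

text \<open>Concrete model of the quantum torus in dimension n with parameter matrix theta.
  Multi-indices alpha in Z^n are functions nat => int vanishing at indices >= n.
  A polynomial sum_alpha x_alpha U^alpha is represented by its coefficient function.\<close>

type_synonym mindex = "nat \<Rightarrow> int"
type_synonym qpoly = "mindex \<Rightarrow> complex"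

definition qt_supp :: "qpoly \<Rightarrow> mindex set" where
  "qt_supp f = {\<alpha>. f \<alpha> \<noteq> 0}"

definition qt_poly :: "nat \<Rightarrow> qpoly \<Rightarrow> bool" where
  "qt_poly n f \<longleftrightarrow> finite (qt_supp f) \<and> (\<forall>\<alpha>\<in>qt_supp f. \<forall>i\<ge>n. \<alpha> i = 0)"

definition qt_holomorphic :: "qpoly \<Rightarrow> bool" where
  "qt_holomorphic f \<longleftrightarrow> (\<forall>\<alpha>\<in>qt_supp f. \<forall>i. 0 \<le> \<alpha> i)"

definition mi_abs :: "nat \<Rightarrow> mindex \<Rightarrow> nat" where
  "mi_abs n \<alpha> = (\<Sum>i<n. nat \<bar>\<alpha> i\<bar>)"

text \<open>U^alpha U^beta = qt_tw theta n alpha beta * U^(alpha+beta), obtained from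
  U_k U_j = e^(2 pi i theta_kj) U_j U_k.\<close>
definition qt_tw :: "(nat \<Rightarrow> nat \<Rightarrow> real) \<Rightarrow> nat \<Rightarrow> mindex \<Rightarrow> mindex \<Rightarrow> complex" where
  "qt_tw \<theta> n \<alpha> \<beta> = cis (2 * pi * (\<Sum>k<n. \<Sum>j<k. \<theta> k j * of_int (\<alpha> k) * of_int (\<beta> j)))"

definition qt_mult :: "(nat \<Rightarrow> nat \<Rightarrow> real) \<Rightarrow> nat \<Rightarrow> qpoly \<Rightarrow> qpoly \<Rightarrow> qpoly" where
  "qt_mult \<theta> n f g = (\<lambda>\<gamma>. \<Sum>\<alpha>\<in>qt_supp f. f \<alpha> * g (\<lambda>i. \<gamma> i - \<alpha> i) * qt_tw \<theta> n \<alpha> (\<lambda>i. \<gamma> i - \<alpha> i))"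

text \<open>Adjoint: (U^alpha)^* = (U^alpha)^(-1) = conj(c(-alpha,alpha)) U^(-alpha).\<close>
definition qt_star :: "(nat \<Rightarrow> nat \<Rightarrow> real) \<Rightarrow> nat \<Rightarrow> qpoly \<Rightarrow> qpoly" where
  "qt_star \<theta> n f = (\<lambda>\<beta>. cnj (f (\<lambda>i. - \<beta> i) * qt_tw \<theta> n \<beta> (\<lambda>i. - \<beta> i)))"

definition qt_one :: qpoly where
  "qt_one = (\<lambda>\<alpha>. if \<alpha> = (\<lambda>_. 0) then 1 else 0)"

definition qt_pow :: "(nat \<Rightarrow> nat \<Rightarrow> real) \<Rightarrow> nat \<Rightarrow> qpoly \<Rightarrow> nat \<Rightarrow> qpoly" where
  "qt_pow \<theta> n f k = ((qt_mult \<theta> n f) ^^ k) qt_one"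

definition qt_tau :: "qpoly \<Rightarrow> complex" where
  "qt_tau f = f (\<lambda>_. 0)"

text \<open>GNS (L^2) norm: sqrt(tau(xi^* xi)) = l2 norm of coefficients.\<close>
definition qt_l2 :: "qpoly \<Rightarrow> real" where
  "qt_l2 f = sqrt (\<Sum>\<alpha>\<in>qt_supp f. (cmod (f \<alpha>))\<^sup>2)"

text \<open>Operator norm in the GNS representation (computed on the dense subspace of polynomials).\<close>
definition qt_norm_inf :: "(nat \<Rightarrow> nat \<Rightarrow> real) \<Rightarrow> nat \<Rightarrow> qpoly \<Rightarrow> real" where
  "qt_norm_inf \<theta> n f = Sup {qt_l2 (qt_mult \<theta> n f \<xi>) | \<xi>. qt_poly n \<xi> \<and> qt_l2 \<xi> \<le> 1}"

text \<open>Spectral distribution of x^* x w.r.t. tau: the (unique) Borel probability measure on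
  [0, ||x||_inf^2] whose moments are tau((x^* x)^k).  Then tau((x^*x)^(p/2)) = int s^(p/2) d mu.\<close>
definition qt_spec :: "(nat \<Rightarrow> nat \<Rightarrow> real) \<Rightarrow> nat \<Rightarrow> qpoly \<Rightarrow> real measure" where
  "qt_spec \<theta> n f = (THE \<mu>. sets \<mu> = sets borel \<and> emeasure \<mu> (space \<mu>) = 1 \<and>
      (AE s in \<mu>. 0 \<le> s \<and> s \<le> (qt_norm_inf \<theta> n f)\<^sup>2) \<and>
      (\<forall>k::nat. integrable \<mu> (\<lambda>s. s ^ k) \<and>
         complex_of_real (\<integral>s. s ^ k \<partial>\<mu>) =
           qt_tau (qt_pow \<theta> n (qt_mult \<theta> n (qt_star \<theta> n f) f) k)))"

definition qt_norm :: "(nat \<Rightarrow> nat \<Rightarrow> real) \<Rightarrow> nat \<Rightarrow> ereal \<Rightarrow> qpoly \<Rightarrow> real" where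
  "qt_norm \<theta> n p f = (if p = \<infinity> then qt_norm_inf \<theta> n f
     else (\<integral>s. s powr (real_of_ereal p / 2) \<partial>(qt_spec \<theta> n f)) powr (1 / real_of_ereal p))"

definition qt_P :: "nat \<Rightarrow> real \<Rightarrow> qpoly \<Rightarrow> qpoly" where
  "qt_P n t f = (\<lambda>\<alpha>. complex_of_real (exp (- t * real (mi_abs n \<alpha>))) * f \<alpha>)"

definition qt_L :: "nat \<Rightarrow> qpoly \<Rightarrow> qpoly" where
  "qt_L n f = (\<lambda>\<alpha>. of_nat (mi_abs n \<alpha>) * f \<alpha>)"

definition qt_deg_ge :: "nat \<Rightarrow> nat \<Rightarrow> qpoly \<Rightarrow> bool" where
  "qt_deg_ge n d f \<longleftrightarrow> (\<forall>\<alpha>\<in>qt_supp f. d \<le> mi_abs n \<alpha>)"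

definition qt_deg_le :: "nat \<Rightarrow> nat \<Rightarrow> qpoly \<Rightarrow> bool" where
  "qt_deg_le n d f \<longleftrightarrow> (\<forall>\<alpha>\<in>qt_supp f. mi_abs n \<alpha> \<le> d)"

end

theory Submission
  imports Defs "HOL-Probability.Probability"
begin

text \<open>On holomorphic polynomials \<open>\<bar>\<alpha>\<bar> = \<alpha>\<^sub>1 + \<dots> + \<alpha>\<^sub>n\<close>, so multiplication of the coefficients by
  \<open>cis (s \<bar>\<alpha>\<bar>)\<close> is a trace preserving automorphism and hence an isometry for every p-norm. In each of the four
  inequalities the left-hand element is, up to the scalar factor, obtained from the right-hand one by a multiplier
  \<open>c \<bar>\<bar>\<alpha>\<bar> - d\<bar>\<close> with \<open>c\<close> convex, decreasing, nonnegative and \<open>c 0 = 1\<close>: \<open>exp (- t j)\<close>, \<open>d / (d + j)\<close> or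
  \<open>(1 - j / d)\<^sub>+\<close>. By Polya's criterion such a multiplier is a convex combination of those
  isometries, times unimodular constants.

  It remains to see that convex combinations of elements with the same moments do not increase the p-norm, which for
  \<open>p < \<infinity>\<close> follows from Jensen's trace inequality for the convex function \<open>\<bar>s\<bar> powr p\<close> of the self-adjoint matrix
  with zero diagonal and off-diagonal entries \<open>x\<^sup>*\<close>, \<open>x\<close>. The spectral distributions
  exist by Hausdorff's solution of the moment problem (Bernstein weights and Helly selection).\<close>

section \<open>Polynomials of operators\<close>

text \<open>The centre of the multiplier is forced. A positive definite sequence is largest at 0,
  and in all four cases the factor applied to the coefficients (exp (- t |\<alpha>|), 1 /
  |\<alpha>|, |\<alpha>|, exp (t |\<alpha>|)) is largest at degree d. Each degree condition puts the
  support on one side of d, so the values on the other side are free and can be chosen by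
  reflection. The lower bounds are upper bounds for the inverse multipliers, applied to
  \<open>qt_L n x\<close> and \<open>qt_P n t x\<close>. Since only finitely many degrees occur,
  finite averages over roots of unity can replace integrals over the circle.

  The obstacle for finite p is that \<open>qt_norm\<close> refers to a measure given by a definite
  description: nothing can be said about it before the moment problem is solved, in existence and in
  uniqueness. Minkowski's inequality is avoided altogether, because the averaged elements share one
  spectral distribution; an inequality between integrals then survives taking the 1/p-th
  power.\<close>

definition peval :: "real poly \<Rightarrow> ('v::real_vector \<Rightarrow> 'v) \<Rightarrow> 'v \<Rightarrow> 'v" where
  "peval p T v = (\<Sum>i\<le>degree p. coeff p i *\<^sub>R (T ^^ i) v)"

lemma peval_altdef:
  assumes "degree p \<le> n"
  shows "peval p T v = (\<Sum>i\<le>n. coeff p i *\<^sub>R (T ^^ i) v)"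
  unfolding peval_def using assms
  by (intro sum.mono_neutral_left) (auto simp: coeff_eq_0)

lemma peval_0 [simp]: "peval 0 T v = 0"
  by (simp add: peval_def)

lemma peval_pCons:
  assumes "linear T"
  shows "peval (pCons a p) T v = a *\<^sub>R v + T (peval p T v)"
proof -
  interpret linear T by fact
  have "peval (pCons a p) T v = (\<Sum>i\<le>Suc (degree p). coeff (pCons a p) i *\<^sub>R (T ^^ i) v)"
    by (intro peval_altdef degree_pCons_le)
  also have "\<dots> = a *\<^sub>R v + (\<Sum>i\<le>degree p. coeff p i *\<^sub>R T ((T ^^ i) v))"
    by (simp only: sum.atMost_Suc_shift) simp
  also have "(\<Sum>i\<le>degree p. coeff p i *\<^sub>R T ((T ^^ i) v)) = T (peval p T v)"
    by (simp add: peval_def sum scale)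
  finally show ?thesis .
qed

lemma peval_add: "peval (p + q) T v = peval p T v + peval q T v"
proof -
  define n where "n = max (degree p) (degree q)"
  have "degree (p + q) \<le> n" "degree p \<le> n" "degree q \<le> n"
    by (auto simp: n_def degree_add_le_max)
  then show ?thesis
    by (simp add: peval_altdef scaleR_add_left sum.distrib)
qed

lemma peval_smult: "peval (smult c p) T v = c *\<^sub>R peval p T v"
proof -
  have "degree (smult c p) \<le> degree p" by simp
  then show ?thesis
    by (simp add: peval_altdef[of "smult c p" "degree p"] peval_def[of p] scaleR_sum_right)
qed

lemma peval_minus: "peval (- p) T v = - peval p T v"
  using peval_smult[of "-1" p T v] by simp

lemma peval_diff: "peval (p - q) T v = peval p T v - peval q T v"
  using peval_add[of p "-q" T v] by (simp add: peval_minus)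

lemma peval_sum: "peval (sum f A) T v = (\<Sum>a\<in>A. peval (f a) T v)"
  by (induction A rule: infinite_finite_induct) (simp_all add: peval_add)

lemma peval_monom: "peval (monom c k) T v = c *\<^sub>R (T ^^ k) v"
proof -
  have "(if k = i then c else 0) *\<^sub>R (T ^^ i) v = (if k = i then c *\<^sub>R (T ^^ k) v else 0)" for i
    by simp
  then show ?thesis
    by (simp add: peval_altdef[OF degree_monom_le])
qed

context
  fixes T :: "'v::real_vector \<Rightarrow> 'v"
  assumes lin: "linear T"
begin

lemma peval_1 [simp]: "peval 1 T v = v"
  by (simp add: one_pCons peval_pCons[OF lin] linear_0[OF lin])

lemma linear_peval: "linear (peval p T)"
proof (induction p)
  case 0
  then show ?case
    by (simp add: linear_iff)
next
  case (pCons a p)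
  then show ?case
    by (auto simp: linear_iff peval_pCons[OF lin] linear_add[OF lin] linear_scale[OF lin] scaleR_add_right
        mult.commute)
qed

lemma peval_mult: "peval (p * q) T v = peval p T (peval q T v)"
proof (induction p)
  case (pCons a p)
  then show ?case
    by (simp add: peval_add peval_smult peval_pCons[OF lin])
qed simp

lemma peval_commute:
  assumes "linear S" "\<And>v. S (T v) = T (S v)"
  shows "S (peval p T v) = peval p T (S v)"
  by (induction p) (simp_all add: peval_pCons[OF lin] linear_0[OF assms(1)] linear_add[OF assms(1)]
      linear_scale[OF assms(1)] assms(2))

lemma peval_peval_commute:
  assumes "linear S" "\<And>v. S (T v) = T (S v)"
  shows "peval q S (peval p T v) = peval p T (peval q S v)"
  by (induction q) (simp_all add: peval_pCons[OF assms(1)] linear_0[OF linear_peval]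
     linear_add[OF linear_peval] linear_scale[OF linear_peval] peval_commute[OF assms])

lemma peval_pcompose: "peval (pcompose p q) T v = peval p (peval q T) v"
proof (induction p)
  case (pCons a p)
  then show ?case
    by (simp add: pcompose_pCons peval_add peval_mult peval_pCons[OF linear_peval]
        peval_pCons[OF lin] linear_0[OF lin])
qed simp

lemma peval_linear: "peval [:a, c:] T v = a *\<^sub>R v + c *\<^sub>R T v"
  by (simp add: peval_pCons[OF lin] linear_0[OF lin] linear_scale[OF lin])

end

lemma peval_symmetric:
  fixes T :: "'v::real_inner \<Rightarrow> 'v"
  assumes "linear T" "\<And>v w. T v \<bullet> w = v \<bullet> T w"
  shows "peval p T v \<bullet> w = v \<bullet> peval p T w"
proof (induction p arbitrary: v w)
  case (pCons a p)
  have "T (peval p T v) \<bullet> w = v \<bullet> T (peval p T w)"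
    using pCons(2)[of v "T w"] peval_commute[OF assms(1) assms(1), where p=p and v=w] by (simp add: assms(2))
  then show ?case
    by (simp add: peval_pCons[OF assms(1)] inner_add_left inner_add_right)
qed simp

text \<open>Completeness of the space is never needed: spectral measures come from polynomial moments alone.\<close>

locale unit_op =
  fixes T :: "'v::real_inner \<Rightarrow> 'v"
  assumes lin: "linear T"
    and sym: "T v \<bullet> w = v \<bullet> T w"
    and nonneg: "0 \<le> T v \<bullet> v"
    and le_one: "T v \<bullet> v \<le> v \<bullet> v"
begin

text \<open>Squares can be stripped off: one factor \<open>z\<close> moves across the inner product,
  so positivity of the form of \<open>p\<close> at all vectors passes to
  \<open>z * z * p\<close>.\<close>

lemma peval_square: "peval (z * z * p) T v \<bullet> v = peval p T (peval z T v) \<bullet> peval z T v"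
proof -
  have "peval (z * z * p) T v = peval z T (peval p T (peval z T v))"
    by (simp add: peval_mult[OF lin] peval_peval_commute[OF lin lin])
  then show ?thesis
    by (simp add: peval_symmetric[OF lin sym])
qed

text \<open>Stripping squares leaves exponents 0 or 1. X and 1 - X are covered by the locale
  assumptions, so only their product needs an argument, and no square root of an operator is
  taken.\<close>

lemma peval_basis_nonneg: "0 \<le> peval ([:0, 1:] ^ a * [:1, -1:] ^ b) T v \<bullet> v"
proof -
  define X :: "real poly" where "X = [:0, 1:]"
  define Y :: "real poly" where "Y = [:1, -1:]"
  define z where "z = X ^ (a div 2) * Y ^ (b div 2)"
  \<comment> \<open>Multiplying by X + Y = 1 turns the product into two terms of the form square
    times positive.\<close>
  have XY: "X * Y = X * X * Y + Y * Y * X"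
    by (simp add: X_def Y_def)
  have "X ^ a = X ^ (a div 2) * X ^ (a div 2) * X ^ (a mod 2)" "Y ^ b = Y ^ (b div 2) * Y ^ (b div 2) * Y ^ (b mod 2)"
    by (simp_all flip: power_add, simp_all add: mult_2[symmetric])
  then have eq: "X ^ a * Y ^ b = z * z * (X ^ (a mod 2) * Y ^ (b mod 2))"
    unfolding z_def by (simp add: mult_ac)
  have pX: "peval X T v = T v" and pY: "peval Y T v = v - T v" for v
    by (simp_all add: X_def Y_def peval_pCons[OF lin] linear_0[OF lin] linear_neg[OF lin])
  have X: "0 \<le> peval X T v \<bullet> v" and Y: "0 \<le> peval Y T v \<bullet> v" for v
    using nonneg[of v] le_one[of v] by (auto simp: pX pY inner_diff_left)
  have "0 \<le> peval (X * X * Y) T v \<bullet> v + peval (Y * Y * X) T v \<bullet> v" for v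
    unfolding peval_square by (intro add_nonneg_nonneg X Y)
  then have XYn: "0 \<le> peval (X * Y) T v \<bullet> v" for v
    by (subst XY) (simp add: peval_add inner_add_left)
  have "0 \<le> peval (X ^ (a mod 2) * Y ^ (b mod 2)) T v \<bullet> v" for v
    using X[of v] Y[of v] XYn[of v] peval_1[OF lin, of v]
    by (cases "even a"; cases "even b") (auto simp: odd_iff_mod_2_eq_one even_iff_mod_2_eq_zero)
  then show ?thesis
    by (simp only: X_def[symmetric] Y_def[symmetric] eq peval_square)
qed

end

section \<open>Bernstein weights and their factorial moments\<close>

definition bernstein_poly :: "nat \<Rightarrow> nat \<Rightarrow> real poly" where
  "bernstein_poly n k = smult (real (n choose k)) ([:0, 1:] ^ k * [:1, -1:] ^ (n - k))"

lemma poly_bernstein_poly [simp]: "poly (bernstein_poly n k) x = Bernstein n k x"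
  by (simp add: bernstein_poly_def Bernstein_def)

lemma (in unit_op) peval_bernstein_nonneg: "0 \<le> peval (bernstein_poly n k) T v \<bullet> v"
  unfolding bernstein_poly_def peval_smult using peval_basis_nonneg[of k "n - k" v] by simp

text \<open>The factorial moments of the binomial distribution. Binomial coefficients in place of
  powers of j make the identity exact for every n, not only in the limit.\<close>

lemma sum_choose_Bernstein:
  assumes "k \<le> n"
  shows "(\<Sum>j\<le>n. real (j choose k) * Bernstein n j x) = real (n choose k) * x ^ k"
proof -
  have "(\<Sum>j\<le>n. real (j choose k) * Bernstein n j x)
      = (\<Sum>j\<in>{k..n}. real (j choose k) * Bernstein n j x)"
    by (intro sum.mono_neutral_right) auto
  also have "\<dots> = (\<Sum>i\<le>n - k. real ((k + i) choose k) * Bernstein n (k + i) x)"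
    using assms by (intro sum.reindex_bij_witness[of _ "\<lambda>i. k + i" "\<lambda>j. j - k"]) auto
  also have "\<dots> = (\<Sum>i\<le>n - k. real (n choose k) * x ^ k * Bernstein (n - k) i x)"
  proof (intro sum.cong refl)
    fix i assume "i \<in> {..n - k}"
    then have i: "k + i \<le> n" using assms by auto
    have "(n choose (k + i)) * ((k + i) choose k) = (n choose k) * ((n - k) choose i)"
      using choose_mult[of k "k + i" n] i by simp
    then have "real ((k + i) choose k) * real (n choose (k + i)) = real (n choose k) * real ((n - k) choose i)"
      by (metis mult.commute of_nat_mult)
    then show "real ((k + i) choose k) * Bernstein n (k + i) x
         = real (n choose k) * x ^ k * Bernstein (n - k) i x"
      by (simp add: Bernstein_def power_add mult_ac) 
  qed
  also have "\<dots> = real (n choose k) * x ^ k"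
    by (simp flip: sum_distrib_left)
  finally show ?thesis .
qed

text \<open>Passes from factorial to ordinary moments. Both terms are products of k factors in
  [0, 1]; the factors (j - i) / (n - i) and j / n differ by at most k / n, and the difference of the
  products is at most the sum of these errors.\<close>

lemma choose_ratio_approx:
  assumes "k \<le> n" "j \<le> n" "0 < n"
  shows "\<bar>real (j choose k) / real (n choose k) - (real j / real n) ^ k\<bar> \<le> real (k * k) / real n"
proof -
  have eq: "real (j choose k) / real (n choose k) = (\<Prod>i\<in>{0..<k}. real (j - i) / real (n - i))"
  proof (cases "k \<le> j")
    case True
    then show ?thesis
      using assms by (simp add: binomial_altdef_of_nat flip: prod_dividef) 
  next
    case False
    \<comment> \<open>For j < k the factor with i = j vanishes, and so does the binomial
      coefficient.\<close>
    then have "(\<Prod>i\<in>{0..<k}. real (j - i) / real (n - i)) = 0"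
      by (intro prod_zero) (auto intro: bexI[of _ j])
    then show ?thesis
      unfolding \<open>(\<Prod>i\<in>{0..<k}. real (j - i) / real (n - i)) = 0\<close> using False by (simp add: binomial_eq_0)
  qed
  have "norm ((\<Prod>i\<in>{0..<k}. real (j - i) / real (n - i)) - (\<Prod>i\<in>{0..<k}. real j / real n))
     \<le> (\<Sum>i\<in>{0..<k}. norm (real (j - i) / real (n - i) - real j / real n))"
    using assms by (intro norm_prod_diff) (auto simp: divide_le_eq_1)
  also have "\<dots> \<le> (\<Sum>i\<in>{0..<k}. real k / real n)"
  proof (intro sum_mono)
    fix i assume i: "i \<in> {0..<k}"
    show "norm (real (j - i) / real (n - i) - real j / real n) \<le> real k / real n"
    proof (cases "i \<le> j")
      case True
      have ni: "real n - real i > 0" using i assms by auto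
      have n0: "real n > 0" using assms by simp
      have "real j / real n - real (j - i) / real (n - i) = real i * (real n - real j) / (real n * (real n - real i))"
        using True i assms ni n0 by (simp add: of_nat_diff field_simps)
      moreover have "\<dots> \<le> real i * (real n - real i) / (real n * (real n - real i))"
        using True ni n0 by (intro divide_right_mono mult_left_mono) auto
      moreover have "\<dots> = real i / real n"
        using ni by simp
      moreover have "0 \<le> real i * (real n - real j) / (real n * (real n - real i))"
        using ni n0 assms by simp
      moreover have "real i / real n \<le> real k / real n"
        using i by (simp add: divide_right_mono)
      ultimately show ?thesis by simp
    next
      case False
      \<comment> \<open>Here \<open>j - i\<close> is truncated to 0, and j < i < k bounds the
        remaining j / n.\<close>
      then show ?thesis using i by (simp add: divide_right_mono)
    qed
  qed
  finally show ?thesis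
    by (simp add: eq)
qed

section \<open>Spectral measures\<close>

text \<open>The weights are nonnegative with sum 1, a distribution on the points j / n. Their
  normalised factorial moments are exactly those of T at v, so the ordinary moments are off by O(1 /
  n).\<close>

lemma (in unit_op) bernstein_moment_tendsto:
  assumes v: "norm v = 1"
  shows "(\<lambda>n. \<Sum>j\<le>n. poly q (real j / real n) * (peval (bernstein_poly n j) T v \<bullet> v))
           \<longlonglongrightarrow> peval q T v \<bullet> v"
proof -
  define w where "w n j = peval (bernstein_poly n j) T v \<bullet> v" for n j
  have w0: "0 \<le> w n j" for n j
    by (simp add: w_def peval_bernstein_nonneg)
  have choose_mom: "(\<Sum>j\<le>n. real (j choose k) * w n j) = real (n choose k) * ((T ^^ k) v \<bullet> v)" if "k \<le> n" for n k
  proof -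
    \<comment> \<open>An identity valid at all real x is an identity of polynomials, hence may be
      evaluated at T.\<close>
    have "(\<Sum>j\<le>n. smult (real (j choose k)) (bernstein_poly n j)) = smult (real (n choose k)) (monom 1 k)"
      using sum_choose_Bernstein[OF that]
      by (intro poly_eq_poly_eq_iff[THEN iffD1] ext) (simp add: poly_sum poly_monom)
    then have "peval (\<Sum>j\<le>n. smult (real (j choose k)) (bernstein_poly n j)) T v \<bullet> v
       = peval (smult (real (n choose k)) (monom 1 k)) T v \<bullet> v"
      by simp
    then show ?thesis
      by (simp add: peval_sum peval_smult peval_monom inner_sum_left w_def)
  qed
  have w1: "(\<Sum>j\<le>n. w n j) = 1" for n
    using choose_mom[of 0 n] v by (simp add: dot_square_norm)
  have monom: "(\<lambda>n. \<Sum>j\<le>n. (real j / real n) ^ k * w n j) \<longlonglongrightarrow> (T ^^ k) v \<bullet> v" for k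
  proof -
    have "(\<lambda>n. (\<Sum>j\<le>n. (real j / real n) ^ k * w n j) - (T ^^ k) v \<bullet> v) \<longlonglongrightarrow> 0"
    proof (rule Lim_null_comparison)
      show "\<forall>\<^sub>F n in sequentially. norm ((\<Sum>j\<le>n. (real j / real n) ^ k * w n j) - (T ^^ k) v \<bullet> v) \<le> real (k * k) / real n"
        using eventually_ge_at_top[of "max 1 k"]
      proof eventually_elim
        case (elim n)
        then have n: "k \<le> n" "0 < n" by auto
        have "(T ^^ k) v \<bullet> v = (\<Sum>j\<le>n. real (j choose k) / real (n choose k) * w n j)"
          using choose_mom[OF n(1)] n by (simp add: field_simps flip: sum_divide_distrib)
        then have "norm ((\<Sum>j\<le>n. (real j / real n) ^ k * w n j) - (T ^^ k) v \<bullet> v)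
           = \<bar>\<Sum>j\<le>n. ((real j / real n) ^ k - real (j choose k) / real (n choose k)) * w n j\<bar>"
          by (simp add: sum_subtractf left_diff_distrib)
        also have "\<dots> \<le> (\<Sum>j\<le>n. \<bar>((real j / real n) ^ k - real (j choose k) / real (n choose k)) * w n j\<bar>)"
          by (rule sum_abs)
        also have "\<dots> \<le> (\<Sum>j\<le>n. real (k * k) / real n * w n j)"
        proof (intro sum_mono)
          fix j assume "j \<in> {..n}"
          then have "\<bar>(real j / real n) ^ k - real (j choose k) / real (n choose k)\<bar> \<le> real (k * k) / real n"
            using choose_ratio_approx[of k n j] n by (simp add: abs_minus_commute)
          then show "\<bar>((real j / real n) ^ k - real (j choose k) / real (n choose k)) * w n j\<bar> \<le> real (k * k) / real n * w n j"
            unfolding abs_mult abs_of_nonneg[OF w0] by (intro mult_right_mono w0)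
        qed
        also have "\<dots> = real (k * k) / real n"
          by (simp only: w1 mult_1_right flip: sum_distrib_left)
        finally show ?case .
      qed
      show "(\<lambda>n. real (k * k) / real n) \<longlonglongrightarrow> 0"
        by real_asymp
    qed
    then show ?thesis
      by (simp add: LIM_zero_iff)
  qed
  have "(\<lambda>n. \<Sum>i\<le>degree q. coeff q i * (\<Sum>j\<le>n. (real j / real n) ^ i * w n j))
        \<longlonglongrightarrow> (\<Sum>i\<le>degree q. coeff q i * ((T ^^ i) v \<bullet> v))"
    by (intro tendsto_intros monom)
  also have "(\<lambda>n. \<Sum>i\<le>degree q. coeff q i * (\<Sum>j\<le>n. (real j / real n) ^ i * w n j))
      = (\<lambda>n. \<Sum>j\<le>n. poly q (real j / real n) * w n j)"
    by (subst poly_altdef, rule ext, subst sum_distrib_right, subst sum.swap)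
      (simp add: sum_distrib_left mult_ac)
  also have "(\<Sum>i\<le>degree q. coeff q i * ((T ^^ i) v \<bullet> v)) = peval q T v \<bullet> v"
    by (simp add: peval_def inner_sum_left)
  finally show ?thesis
    by (simp add: w_def)
qed

text \<open>Records scalar polynomial moments at a single vector instead of a projection-valued
  measure; by Weierstrass these determine the integrals of all continuous functions.\<close>

definition spectral_measure :: "('v::real_inner \<Rightarrow> 'v) \<Rightarrow> 'v \<Rightarrow> real measure \<Rightarrow> bool" where
  "spectral_measure T v \<mu> \<longleftrightarrow> real_distribution \<mu> \<and> (AE s in \<mu>. s \<in> {0..1}) \<and>
     (\<forall>q. (\<integral>s. poly q s \<partial>\<mu>) = peval q T v \<bullet> v)"

lemma spectral_measureD:
  assumes "spectral_measure T v \<mu>"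
  shows "real_distribution \<mu>" "AE s in \<mu>. s \<in> {0..1}" "(\<integral>s. poly q s \<partial>\<mu>) = peval q T v \<bullet> v"
  using assms by (auto simp: spectral_measure_def)

lemma (in real_distribution) integrable_cont_ae_bounded:
  fixes f :: "real \<Rightarrow> real"
  assumes "continuous_on UNIV f" "AE s in M. s \<in> {a..b}"
  shows "integrable M f"
proof -
  have "bounded (f ` {a..b})"
    using assms(1) by (intro compact_imp_bounded compact_continuous_image) (auto intro: continuous_on_subset)
  then obtain B where B: "\<And>s. s \<in> {a..b} \<Longrightarrow> norm (f s) \<le> B"
    by (meson bounded_iff imageI)
  show ?thesis
  proof (rule integrable_const_bound)
    show "AE s in M. norm (f s) \<le> B"
      using assms(2) by eventually_elim (rule B)
    show "f \<in> borel_measurable M"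
      using borel_measurable_continuous_onI[OF assms(1)] by simp
  qed
qed

text \<open>The moments along a weakly convergent subsequence are known from
  \<open>bernstein_moment_tendsto\<close>. Two points need care: polynomials are unbounded, whereas
  weak convergence tests bounded functions, and the limit must still live on [0, 1].\<close>

lemma (in unit_op) ex_spectral_measure:
  assumes v: "norm v = 1"
  shows "\<exists>\<mu>. spectral_measure T v \<mu>"
proof -
  define w where "w n j = peval (bernstein_poly n j) T v \<bullet> v" for n j
  have w0: "0 \<le> w n j" for n j
    by (simp add: w_def peval_bernstein_nonneg)
  have w1: "(\<Sum>j\<le>n. w n j) = 1" for n
  proof -
    have "(\<Sum>j\<le>n. bernstein_poly n j) = 1"
      by (intro poly_eq_poly_eq_iff[THEN iffD1] ext) (simp add: poly_sum)
    then have "peval (\<Sum>j\<le>n. bernstein_poly n j) T v \<bullet> v = 1"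
      using v by (simp add: peval_1[OF lin] dot_square_norm)
    then show ?thesis
      by (simp add: w_def peval_sum inner_sum_left)
  qed
  define \<nu> where "\<nu> n = point_measure {..n} (\<lambda>j. ennreal (w n j))" for n
  \<comment> \<open>For n = 0 the only atom is at 0 / 0 = 0, so all atoms lie in [0, 1] for every
    n.\<close>
  define \<mu> where "\<mu> n = distr (\<nu> n) borel (\<lambda>j. real j / real n)" for n
  have sets_\<nu>: "sets (\<nu> n) = Pow {..n}" "space (\<nu> n) = {..n}" for n
    by (simp_all add: \<nu>_def sets_point_measure space_point_measure)
  have meas: "(\<lambda>j. real j / real n) \<in> borel_measurable (\<nu> n)" for n
    by (auto simp: measurable_def sets_\<nu>)
  have int: "(\<integral>s. f s \<partial>\<mu> n) = (\<Sum>j\<le>n. f (real j / real n) * w n j)" if "f \<in> borel_measurable borel" for f :: "real \<Rightarrow> real" and n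
  proof -
    have "(\<integral>s. f s \<partial>\<mu> n) = (\<integral>j. f (real j / real n) \<partial>\<nu> n)"
      unfolding \<mu>_def by (rule integral_distr[OF meas that])
    also have "\<dots> = (\<Sum>j\<le>n. f (real j / real n) * w n j)"
      unfolding \<nu>_def by (subst lebesgue_integral_point_measure_finite) (auto simp: w0 mult_ac)
    finally show ?thesis .
  qed
  have dist: "real_distribution (\<mu> n)" for n
  proof -
    have "emeasure (\<nu> n) (space (\<nu> n)) = 1"
      unfolding sets_\<nu>(2) using w1[of n]
      by (simp add: \<nu>_def emeasure_point_measure_finite w0 sum_ennreal)
    then have "prob_space (\<nu> n)" by (rule prob_spaceI)
    then have "prob_space (\<mu> n)"
      unfolding \<mu>_def by (rule prob_space.prob_space_distr[OF _ meas])
    then show ?thesis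
      by (simp add: real_distribution_def real_distribution_axioms_def \<mu>_def)
  qed
  have "tight \<mu>"
    unfolding tight_def
  proof (intro conjI allI impI dist)
    fix \<epsilon> :: real assume "0 < \<epsilon>"
    \<comment> \<open>Tightness asks for a half-open interval; the left end -1 keeps an atom at 0
      inside.\<close>
    have "1 - \<epsilon> < measure (\<mu> n) {-1<..1}" for n
    proof -
      interpret real_distribution "\<mu> n" by (rule dist)
      have "measure (\<mu> n) {-1<..1} = (\<integral>s. indicator {-1<..1} s \<partial>\<mu> n)"
        by simp
      also have "\<dots> = (\<Sum>j\<le>n. indicator {-1<..1} (real j / real n) * w n j)"
        by (rule int) simp
      also have "\<dots> = (\<Sum>j\<le>n. w n j)"
      proof (intro sum.cong refl)
        fix j assume "j \<in> {..n}"
        then have "real j / real n \<in> {-1<..1}"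
          by (auto simp: divide_le_eq_1 intro: less_le_trans[of _ 0])
        then show "indicator {-1<..1} (real j / real n) * w n j = w n j"
          by simp
      qed
      finally show ?thesis using \<open>0 < \<epsilon>\<close> by (simp add: w1)
    qed
    then show "\<exists>a b. a < b \<and> (\<forall>n. 1 - \<epsilon> < measure (\<mu> n) {a<..b})"
      by (intro exI[of _ "-1"] exI[of _ 1]) auto
  qed
  then obtain r M where r: "strict_mono r" and M: "real_distribution M" and conv: "weak_conv_m (\<mu> \<circ> id \<circ> r) M"
    using tight_imp_convergent_subsubsequence[of \<mu> id] by (auto simp: strict_mono_id)
  interpret M: real_distribution M by fact
  have dist': "real_distribution ((\<mu> \<circ> id \<circ> r) n)" for n
    by (simp add: dist)
  \<comment> \<open>Composition with this retraction onto [0, 1] makes continuous test functions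
    bounded without changing them at the atoms.\<close>
  define clamp where "clamp s = max 0 (min 1 s)" for s :: real
  have clamp: "clamp s \<in> {0..1}" and clamp_id: "s \<in> {0..1} \<Longrightarrow> clamp s = s" for s
    by (auto simp: clamp_def)
  have contc: "continuous_on UNIV clamp"
    unfolding clamp_def by (intro continuous_intros)
  have lim: "(\<lambda>n. \<Sum>j\<le>r n. f (real j / real (r n)) * w (r n) j) \<longlonglongrightarrow> (\<integral>s. f (clamp s) \<partial>M)"
    if f: "continuous_on UNIV f" for f :: "real \<Rightarrow> real"
  proof -
    have "bounded (f ` {0..1})"
      using f by (intro compact_imp_bounded compact_continuous_image) (auto intro: continuous_on_subset)
    then obtain B where B: "\<And>s. s \<in> {0..1} \<Longrightarrow> norm (f s) \<le> B"
      by (meson bounded_iff imageI)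
    have fc: "continuous_on UNIV (\<lambda>s. f (clamp s))"
      using continuous_on_compose2[OF f contc] by simp
    have "(\<lambda>n. \<integral>s. f (clamp s) \<partial>(\<mu> \<circ> id \<circ> r) n) \<longlonglongrightarrow> (\<integral>s. f (clamp s) \<partial>M)"
    proof (rule weak_conv_imp_integral_bdd_continuous_conv[OF dist' M conv])
      show "isCont (\<lambda>s. f (clamp s)) x" for x
        using fc by (simp add: continuous_on_eq_continuous_at)
      show "norm (f (clamp x)) \<le> B" for x
        by (intro B clamp)
    qed
    also have "(\<lambda>n. \<integral>s. f (clamp s) \<partial>(\<mu> \<circ> id \<circ> r) n) = (\<lambda>n. \<Sum>j\<le>r n. f (real j / real (r n)) * w (r n) j)"
    proof
      fix n
      have "(\<integral>s. f (clamp s) \<partial>\<mu> (r n)) = (\<Sum>j\<le>r n. f (clamp (real j / real (r n))) * w (r n) j)"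
        by (intro int borel_measurable_continuous_onI fc)
      also have "\<dots> = (\<Sum>j\<le>r n. f (real j / real (r n)) * w (r n) j)"
      proof (intro sum.cong refl)
        fix j assume "j \<in> {..r n}"
        then have "real j / real (r n) \<in> {0..1}" by (auto simp: divide_le_eq_1)
        then show "f (clamp (real j / real (r n))) * w (r n) j = f (real j / real (r n)) * w (r n) j"
          by (simp only: clamp_id)
      qed
      finally show "(\<integral>s. f (clamp s) \<partial>(\<mu> \<circ> id \<circ> r) n) = (\<Sum>j\<le>r n. f (real j / real (r n)) * w (r n) j)"
        by simp
    qed
    finally show ?thesis .
  qed
  have poly_clamp: "(\<integral>s. poly q (clamp s) \<partial>M) = peval q T v \<bullet> v" for q
  proof (rule LIMSEQ_unique)
    show "(\<lambda>n. \<Sum>j\<le>r n. poly q (real j / real (r n)) * w (r n) j) \<longlonglongrightarrow> (\<integral>s. poly q (clamp s) \<partial>M)"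
      by (intro lim continuous_intros)
    show "(\<lambda>n. \<Sum>j\<le>r n. poly q (real j / real (r n)) * w (r n) j) \<longlonglongrightarrow> peval q T v \<bullet> v"
      using LIMSEQ_subseq_LIMSEQ[OF bernstein_moment_tendsto[OF v] r] by (simp add: o_def w_def)
  qed
  have ae: "AE s in M. s \<in> {0..1}"
  proof -
    \<comment> \<open>Bounded, continuous, and zero exactly on [0, 1]: its integral vanishes along
      the sequence, hence in the limit.\<close>
    define h where "h s = min 1 \<bar>s - clamp s\<bar>" for s
    have hc: "continuous_on UNIV h"
      unfolding h_def clamp_def by (intro continuous_intros)
    have hm[measurable]: "h \<in> borel_measurable borel"
      by (intro borel_measurable_continuous_onI hc)
    have hint: "integrable M h"
      by (rule M.integrable_const_bound[of _ 1]) (auto simp: h_def)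
    have "(\<lambda>n. \<integral>s. h s \<partial>(\<mu> \<circ> id \<circ> r) n) \<longlonglongrightarrow> (\<integral>s. h s \<partial>M)"
    proof (rule weak_conv_imp_integral_bdd_continuous_conv[OF dist' M conv])
      show "isCont h x" for x
        using hc by (simp add: continuous_on_eq_continuous_at)
      show "norm (h x) \<le> 1" for x
        by (auto simp: h_def)
    qed
    moreover have "(\<integral>s. h s \<partial>(\<mu> \<circ> id \<circ> r) n) = 0" for n
    proof -
      have "(\<integral>s. h s \<partial>\<mu> (r n)) = (\<Sum>j\<le>r n. h (real j / real (r n)) * w (r n) j)"
        by (rule int) simp
      also have "\<dots> = 0"
      proof (intro sum.neutral ballI)
        fix j assume "j \<in> {..r n}"
        then have "real j / real (r n) \<in> {0..1}" by (auto simp: divide_le_eq_1)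
        then have "clamp (real j / real (r n)) = real j / real (r n)"
          by (rule clamp_id)
        then have "h (real j / real (r n)) = 0"
          by (simp add: h_def)
        then show "h (real j / real (r n)) * w (r n) j = 0" by simp
      qed
      finally show ?thesis by simp
    qed
    ultimately have "(\<lambda>n. 0) \<longlonglongrightarrow> (\<integral>s. h s \<partial>M)"
      by (simp only:)
    then have "(\<integral>s. h s \<partial>M) = 0"
      by (simp add: LIMSEQ_const_iff)
    then have "AE s in M. h s = 0"
      by (subst (asm) integral_nonneg_eq_0_iff_AE[OF hint]) (auto simp: h_def)
    then show ?thesis
    proof eventually_elim
      case (elim s)
      then have "clamp s = s" by (auto simp: h_def min_def split: if_splits)
      then show ?case using clamp[of s] by simp
    qed
  qed
  have "(\<integral>s. poly q s \<partial>M) = peval q T v \<bullet> v" for q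
  proof -
    have "(\<integral>s. poly q s \<partial>M) = (\<integral>s. poly q (clamp s) \<partial>M)"
    proof (rule integral_cong_AE)
      show "AE s in M. poly q s = poly q (clamp s)"
        using ae by eventually_elim (simp add: clamp_id)
      show "poly q \<in> borel_measurable M"
        using borel_measurable_continuous_onI[of "poly q"] by (simp add: continuous_intros)
      have "continuous_on UNIV (\<lambda>s. poly q (clamp s))"
        by (intro continuous_intros contc)
      from borel_measurable_continuous_onI[OF this] show "(\<lambda>s. poly q (clamp s)) \<in> borel_measurable M"
        by simp
    qed
    then show ?thesis by (simp add: poly_clamp)
  qed
  then show ?thesis
    using M ae by (auto simp: spectral_measure_def)
qed

section \<open>Weierstrass approximation and uniqueness in the moment problem\<close>

lemma poly_approx_01:
  fixes f :: "real \<Rightarrow> real"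
  assumes "continuous_on {0..1} f" "0 < e"
  shows "\<exists>q. \<forall>s\<in>{0..1}. \<bar>f s - poly q s\<bar> < e"
proof -
  obtain N where N: "\<And>n x. N \<le> n \<and> x \<in> {0..1} \<longrightarrow> \<bar>f x - (\<Sum>k\<le>n. f (k / n) * Bernstein n k x)\<bar> < e"
    using Bernstein_Weierstrass[OF assms] by blast
  have "\<forall>s\<in>{0..1}. \<bar>f s - poly (\<Sum>k\<le>N. smult (f (k / N)) (bernstein_poly N k)) s\<bar> < e"
    using N by (simp add: poly_sum)
  then show ?thesis by blast
qed

lemma poly_approx_interval:
  fixes f :: "real \<Rightarrow> real"
  assumes f: "continuous_on UNIV f" and K: "0 < K" and e: "0 < e"
  shows "\<exists>q. \<forall>s\<in>{-K..K}. \<bar>f s - poly q s\<bar> < e"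
proof -
  have "continuous_on {0..1} (\<lambda>t. f (2 * K * t - K))"
    by (intro continuous_on_compose2[OF f] continuous_intros) auto
  from poly_approx_01[OF this e] obtain q where q: "\<And>t. t \<in> {0..1} \<Longrightarrow> \<bar>f (2 * K * t - K) - poly q t\<bar> < e"
    by blast
  have "\<bar>f s - poly (pcompose q [:1/2, 1 / (2 * K):]) s\<bar> < e" if "s \<in> {-K..K}" for s
  proof -
    have "(s + K) / (2 * K) \<in> {0..1}"
      using that K by (auto simp: field_simps)
    from q[OF this] show ?thesis
      using K by (simp add: poly_pcompose field_simps)
  qed
  then show ?thesis by blast
qed

text \<open>On a compact interval both integrals are close to the common integral of an
  approximating polynomial.\<close>

lemma integral_eq_of_moments_eq:
  fixes \<mu> \<nu> :: "real measure" and f :: "real \<Rightarrow> real"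
  assumes "real_distribution \<mu>" "real_distribution \<nu>"
    and ae: "AE s in \<mu>. s \<in> {-K..K}" "AE s in \<nu>. s \<in> {-K..K}"
    and mom: "\<And>k. (\<integral>s. s ^ k \<partial>\<mu>) = (\<integral>s. s ^ k \<partial>\<nu>)"
    and f: "continuous_on UNIV f"
  shows "(\<integral>s. f s \<partial>\<mu>) = (\<integral>s. f s \<partial>\<nu>)"
proof -
  interpret \<mu>: real_distribution \<mu> by fact
  interpret \<nu>: real_distribution \<nu> by fact
  define K' where "K' = max K 1"
  have K': "0 < K'" and sub: "{-K..K} \<subseteq> {-K'..K'}" by (auto simp: K'_def)
  have ae': "AE s in \<mu>. s \<in> {-K'..K'}" "AE s in \<nu>. s \<in> {-K'..K'}"
    using sub by (auto intro: eventually_mono[OF ae(1)] eventually_mono[OF ae(2)])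
  have poly: "(\<integral>s. poly q s \<partial>\<mu>) = (\<integral>s. poly q s \<partial>\<nu>)" for q
  proof -
    have "(\<integral>s. poly q s \<partial>M) = (\<Sum>i\<le>degree q. coeff q i * (\<integral>s. s ^ i \<partial>M))"
      if "real_distribution M" "AE s in M. s \<in> {-K'..K'}" for M
      unfolding poly_altdef using real_distribution.integrable_cont_ae_bounded[OF that(1) _ that(2)]
      by (subst Bochner_Integration.integral_sum) (auto simp: continuous_intros)
    from this[OF assms(1) ae'(1)] this[OF assms(2) ae'(2)] show ?thesis by (simp add: mom)
  qed
  have close: "\<bar>(\<integral>s. f s \<partial>M) - (\<integral>s. poly q s \<partial>M)\<bar> \<le> e"
    if "real_distribution M" "AE s in M. s \<in> {-K'..K'}" and q: "\<forall>s\<in>{-K'..K'}. \<bar>f s - poly q s\<bar> < e" for M q e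
  proof -
    interpret M: real_distribution M by fact
    have i: "integrable M f" "integrable M (poly q)" "integrable M (\<lambda>s. f s - poly q s)"
      by (intro M.integrable_cont_ae_bounded[OF _ that(2)] continuous_intros f)+
    have "\<bar>\<integral>s. f s - poly q s \<partial>M\<bar> \<le> (\<integral>s. \<bar>f s - poly q s\<bar> \<partial>M)"
      by (rule integral_abs_bound)
    also have "\<dots> \<le> (\<integral>s. e \<partial>M)"
    proof (intro integral_mono_AE)
      show "AE s in M. \<bar>f s - poly q s\<bar> \<le> e"
        using that(2) by eventually_elim (use q in \<open>auto intro: less_imp_le\<close>)
    qed (use i in auto)
    finally show ?thesis
      using i by (simp add: M.prob_space[simplified])
  qed
  show ?thesis
  proof (rule ccontr)
    assume ne: "(\<integral>s. f s \<partial>\<mu>) \<noteq> (\<integral>s. f s \<partial>\<nu>)"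
    \<comment> \<open>A third of the gap: two errors of size e cannot bridge a distance of 3
      e.\<close>
    define e where "e = \<bar>(\<integral>s. f s \<partial>\<mu>) - (\<integral>s. f s \<partial>\<nu>)\<bar> / 3"
    have e: "0 < e" using ne by (simp add: e_def)
    obtain q where q: "\<forall>s\<in>{-K'..K'}. \<bar>f s - poly q s\<bar> < e"
      using poly_approx_interval[OF f K' e] by blast
    have "3 * e \<le> e + e"
      unfolding e_def[THEN arg_cong[where f = "\<lambda>x. 3 * x"], simplified]
      using close[OF assms(1) ae'(1) q] close[OF assms(2) ae'(2) q] poly[of q] by linarith
    then show False using e by linarith
  qed
qed

text \<open>Cosine and sine are continuous, so the characteristic functions agree.\<close>

lemma measure_eq_of_moments_eq:
  fixes \<mu> \<nu> :: "real measure"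
  assumes "real_distribution \<mu>" "real_distribution \<nu>"
    and ae: "AE s in \<mu>. s \<in> {-K..K}" "AE s in \<nu>. s \<in> {-K..K}"
    and mom: "\<And>k. (\<integral>s. s ^ k \<partial>\<mu>) = (\<integral>s. s ^ k \<partial>\<nu>)"
  shows "\<mu> = \<nu>"
proof (rule Levy_uniqueness[OF assms(1,2)])
  interpret \<mu>: real_distribution \<mu> by fact
  interpret \<nu>: real_distribution \<nu> by fact
  note eq = integral_eq_of_moments_eq[OF assms]
  show "char \<mu> = char \<nu>"
  proof
    fix t
    have "(\<integral>x. cos (t * x) \<partial>\<mu>) = (\<integral>x. cos (t * x) \<partial>\<nu>)"
      by (rule eq[of "\<lambda>x. cos (t * x)"]) (intro continuous_intros)
    moreover have "(\<integral>x. sin (t * x) \<partial>\<mu>) = (\<integral>x. sin (t * x) \<partial>\<nu>)"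
      by (rule eq[of "\<lambda>x. sin (t * x)"]) (intro continuous_intros)
    ultimately have "Re (char \<mu> t) = Re (char \<nu> t)" "Im (char \<mu> t) = Im (char \<nu> t)"
      unfolding char_def
      by (simp_all add: \<mu>.integrable_iexp \<nu>.integrable_iexp Re_exp Im_exp flip: integral_Re integral_Im)
    then show "char \<mu> t = char \<nu> t" by (simp add: complex_eq_iff)
  qed
qed

section \<open>Positivity and norm bounds of the functional calculus\<close>

context unit_op
begin

text \<open>Read off from the spectral measure at the normalised vector.\<close>

lemma peval_nonneg:
  assumes q: "\<And>s. s \<in> {0..1} \<Longrightarrow> 0 \<le> poly q s"
  shows "0 \<le> peval q T v \<bullet> v"
proof (cases "v = 0")
  case True
  then show ?thesis by simp
next
  case False
  define u where "u = (1 / norm v) *\<^sub>R v"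
  have u: "norm u = 1" and v: "v = norm v *\<^sub>R u"
    using False by (simp_all add: u_def)
  obtain \<mu> where \<mu>: "spectral_measure T u \<mu>"
    using ex_spectral_measure[OF u] by blast
  have "0 \<le> (\<integral>s. poly q s \<partial>\<mu>)"
    by (intro integral_nonneg_AE eventually_mono[OF spectral_measureD(2)[OF \<mu>]] q)
  then have "0 \<le> norm v * (norm v * (peval q T u \<bullet> u))"
    by (simp add: spectral_measureD(3)[OF \<mu>])
  also have "\<dots> = peval q T v \<bullet> v"
    by (subst (3 4) v) (simp add: linear_scale[OF linear_peval[OF lin]])
  finally show ?thesis .
qed

text \<open>Positivity of C^2 - q^2 on [0, 1], whose form at v is the difference of the two squared
  norms.\<close>

lemma norm_peval_le:
  assumes q: "\<And>s. s \<in> {0..1} \<Longrightarrow> \<bar>poly q s\<bar> \<le> C"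
  shows "norm (peval q T v) \<le> C * norm v"
proof -
  have C: "0 \<le> C" using q[of 0] by auto
  have "0 \<le> peval ([:C\<^sup>2:] - q * q) T v \<bullet> v"
  proof (rule peval_nonneg)
    fix s :: real assume "s \<in> {0..1}"
    from q[OF this] have "\<bar>poly q s\<bar>\<^sup>2 \<le> C\<^sup>2" by (intro power_mono) auto
    then show "0 \<le> poly ([:C\<^sup>2:] - q * q) s" by (simp add: power2_eq_square)
  qed
  also have "peval ([:C\<^sup>2:] - q * q) T v \<bullet> v = C\<^sup>2 * (v \<bullet> v) - peval q T v \<bullet> peval q T v"
    by (simp add: peval_diff peval_mult[OF lin] inner_diff_left peval_symmetric[OF lin sym]
        peval_pCons[OF lin] linear_0[OF lin])
  finally have "(norm (peval q T v))\<^sup>2 \<le> (C * norm v)\<^sup>2"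
    by (simp add: power2_norm_eq_inner power_mult_distrib)
  then show ?thesis
    by (rule power2_le_imp_le) (simp add: C)
qed

end

text \<open>Positivity of the joint functional calculus for product functions: replace \<open>h\<close> by the square
  of a polynomial close to its root.\<close>

lemma peval_joint_nonneg:
  assumes R: "unit_op R" and L: "unit_op L" and comm: "\<And>v. R (L v) = L (R v)"
    and e: "\<And>s. s \<in> {0..1} \<Longrightarrow> 0 \<le> poly e s"
    and h: "\<And>s. s \<in> {0..1} \<Longrightarrow> 0 \<le> poly h s"
  shows "0 \<le> peval e R (peval h L w) \<bullet> w"
proof -
  interpret R: unit_op R by fact
  interpret L: unit_op L by fact
  have "bounded ((\<lambda>s. sqrt (poly h s)) ` {0..1})"
    by (intro compact_imp_bounded compact_continuous_image continuous_intros) auto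
  then obtain B where B: "\<And>s. s \<in> {0..1} \<Longrightarrow> norm (sqrt (poly h s)) \<le> B"
    by (meson bounded_iff imageI)
  have B0: "0 \<le> B" using B[of 0] by (auto intro: order_trans[OF norm_ge_zero])
  define C where "C = norm (peval e R w) * norm w"
  have C0: "0 \<le> C" by (simp add: C_def)
  have bound: "- (d * (2 * B + d) * C) \<le> peval e R (peval h L w) \<bullet> w" if d: "0 < d" for d
  proof -
    have "continuous_on {0..1} (\<lambda>s. sqrt (poly h s))"
      by (intro continuous_intros)
    from poly_approx_01[OF this d] obtain u where
      u: "\<And>s. s \<in> {0..1} \<Longrightarrow> \<bar>sqrt (poly h s) - poly u s\<bar> < d" by blast
    \<comment> \<open>With r the root of \<open>h\<close>, the error factors as |r - u| |r + u|, and
      the second factor is at most 2 B + d.\<close>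
    have diff: "\<bar>poly (h - u * u) s\<bar> \<le> d * (2 * B + d)" if s: "s \<in> {0..1}" for s
    proof -
      define r where "r = sqrt (poly h s)"
      have hr: "poly h s = r * r" using h[OF s] by (simp add: r_def)
      have r: "\<bar>r\<bar> \<le> B" "\<bar>r - poly u s\<bar> \<le> d" using B[OF s] u[OF s] by (simp_all add: r_def)
      have "\<bar>poly (h - u * u) s\<bar> = \<bar>r - poly u s\<bar> * \<bar>r + poly u s\<bar>"
        unfolding abs_mult[symmetric] by (simp add: hr algebra_simps)
      also have "\<dots> \<le> d * (2 * B + d)"
        using r by (intro mult_mono) auto
      finally show ?thesis .
    qed
    have "\<bar>peval e R (peval (h - u * u) L w) \<bullet> w\<bar> = \<bar>peval (h - u * u) L w \<bullet> peval e R w\<bar>"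
      by (simp add: peval_symmetric[OF R.lin R.sym])
    also have "\<dots> \<le> norm (peval (h - u * u) L w) * norm (peval e R w)"
      by (rule Cauchy_Schwarz_ineq2)
    also have "\<dots> \<le> (d * (2 * B + d) * norm w) * norm (peval e R w)"
      by (intro mult_right_mono L.norm_peval_le diff) auto
    also have "\<dots> = d * (2 * B + d) * C" by (simp add: C_def)
    finally have 1: "\<bar>peval e R (peval (h - u * u) L w) \<bullet> w\<bar> \<le> d * (2 * B + d) * C" .
    \<comment> \<open>One copy of \<open>u\<close> in L passes e in R by commutation and moves
      across the inner product; positivity for R alone remains.\<close>
    have "peval e R (peval (u * u) L w) \<bullet> w = peval e R (peval u L w) \<bullet> peval u L w"
      using peval_peval_commute[OF R.lin L.lin, of u e "peval u L w"] comm
      by (simp add: peval_mult[OF L.lin] peval_symmetric[OF L.lin L.sym]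
          peval_peval_commute[OF L.lin R.lin, of e u] comm)
    also have "\<dots> \<ge> 0" by (intro R.peval_nonneg e)
    finally have 2: "0 \<le> peval e R (peval (u * u) L w) \<bullet> w" .
    have "h = (h - u * u) + u * u" by simp
    then have "peval e R (peval h L w) \<bullet> w
       = peval e R (peval (h - u * u) L w) \<bullet> w + peval e R (peval (u * u) L w) \<bullet> w"
      by (metis peval_add linear_add linear_peval R.lin inner_add_left)
    with 1 2 show ?thesis by linarith
  qed
  \<comment> \<open>The error of the approximate root disappears as d tends to 0.\<close>
  have "((\<lambda>d. - (d * (2 * B + d) * C)) \<longlongrightarrow> - (0 * (2 * B + 0) * C)) (at_right 0)"
    by (intro tendsto_intros)
  then show ?thesis
    by (rule tendsto_upperbound[THEN order_trans[rotated]])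
       (auto simp: eventually_at_right_less intro!: eventually_mono[OF eventually_at_right_less[of 0]] bound)
qed

section \<open>Jensen's trace inequality\<close>

text \<open>The commuting operators \<open>R\<close> and \<open>L i\<close> will be
  right and left multiplications and \<open>v\<close> the trace vector. Integrating the tangent line inequality
  \<open>f b \<ge> f a + f' a (b - a)\<close> against the joint spectral measure of \<open>(R, L i)\<close> would give the claim at once;
  instead of constructing that measure, the variable \<open>a\<close> is localised by Bernstein polynomials.\<close>

theorem jensen_spectral:
  fixes R :: "'v::real_inner \<Rightarrow> 'v" and L :: "'i \<Rightarrow> 'v \<Rightarrow> 'v"
  assumes "finite I" and w: "\<And>i. i \<in> I \<Longrightarrow> 0 \<le> w i" "(\<Sum>i\<in>I. w i) = 1"
    and R: "unit_op R" and L: "\<And>i. i \<in> I \<Longrightarrow> unit_op (L i)"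
    and comm: "\<And>i u. i \<in> I \<Longrightarrow> R (L i u) = L i (R u)"
    and v: "norm v = 1" and avg: "(\<Sum>i\<in>I. w i *\<^sub>R L i v) = R v"
    and \<nu>: "spectral_measure R v \<nu>" and \<mu>: "\<And>i. i \<in> I \<Longrightarrow> spectral_measure (L i) v (\<mu> i)"
    and f: "continuous_on UNIV f" and f': "continuous_on UNIV f'"
    and conv: "\<And>a b. a \<in> {0..1} \<Longrightarrow> b \<in> {0..1} \<Longrightarrow> f a + f' a * (b - a) \<le> f b"
  shows "(\<integral>s. f s \<partial>\<nu>) \<le> (\<Sum>i\<in>I. w i * (\<integral>s. f s \<partial>\<mu> i))"
proof (rule field_le_epsilon)
  fix e' :: real assume "0 < e'"
  \<comment> \<open>Four errors of size e accumulate: the shift in \<open>H\<close>, and the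
    polynomial approximations of \<open>f\<close>, \<open>g\<close> and \<open>f'\<close>.\<close>
  define e where "e = e' / 5"
  have e: "0 < e" using \<open>0 < e'\<close> by (simp add: e_def)
  interpret R: unit_op R by fact
  interpret \<nu>: real_distribution \<nu> by (rule spectral_measureD[OF \<nu>])
  \<comment> \<open>Minus the intercept of the tangent at s. The tangent inequality becomes
    \<open>0 \<le> f b + g a - f' a * b\<close>, a sum of products of a function of a and a function
    of b.\<close>
  define g where "g s = f' s * s - f s" for s
  have g: "continuous_on UNIV g"
    unfolding g_def by (intro continuous_intros f f')
  have sub: "continuous_on {0..1} h" if "continuous_on UNIV h" for h :: "real \<Rightarrow> real"
    using that by (rule continuous_on_subset) simp
  obtain F where F: "\<And>s. s \<in> {0..1} \<Longrightarrow> \<bar>f s - poly F s\<bar> < e"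
    using poly_approx_01[OF sub[OF f] e] by blast
  obtain N1 where N1: "\<And>n x. N1 \<le> n \<and> x \<in> {0..1} \<longrightarrow> \<bar>g x - (\<Sum>k\<le>n. g (k / n) * Bernstein n k x)\<bar> < e"
    using Bernstein_Weierstrass[OF sub[OF g] e] by blast
  obtain N2 where N2: "\<And>n x. N2 \<le> n \<and> x \<in> {0..1} \<longrightarrow> \<bar>f' x - (\<Sum>k\<le>n. f' (k / n) * Bernstein n k x)\<bar> < e"
    using Bernstein_Weierstrass[OF sub[OF f'] e] by blast
  \<comment> \<open>A common degree, so that \<open>G\<close> and \<open>F'\<close> expand in the
    same Bernstein partition of unity.\<close>
  define n where "n = max N1 N2"
  define G where "G = (\<Sum>k\<le>n. smult (g (k / n)) (bernstein_poly n k))"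
  define F' where "F' = (\<Sum>k\<le>n. smult (f' (k / n)) (bernstein_poly n k))"
  have G: "\<bar>g s - poly G s\<bar> < e" and F': "\<bar>f' s - poly F' s\<bar> < e" if "s \<in> {0..1}" for s
    using N1[of n s] N2[of n s] that by (auto simp: n_def G_def F'_def poly_sum)
  have B1: "(\<Sum>k\<le>n. bernstein_poly n k) = 1"
    by (intro poly_eq_poly_eq_iff[THEN iffD1] ext) (simp add: poly_sum)

  \<comment> \<open>The tangent inequality at the node a = k / n, as a polynomial in b; the constant
    e pays for \<open>F\<close> in place of \<open>f\<close>.\<close>
  define H where "H k = F + [:g (k / n) + e:] + [:0, - f' (k / n):]" for k :: nat
  have H: "0 \<le> poly (H k) s" if s: "s \<in> {0..1}" and k: "k \<le> n" for k s
  proof -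
    have "real k / real n \<in> {0..1}" using k by (auto simp: divide_le_eq_1)
    from conv[OF this s] F[OF s] show ?thesis
      by (simp add: H_def g_def algebra_simps)
  qed
  have key: "0 \<le> peval F (L i) v \<bullet> v + peval G R v \<bullet> v + e - peval F' R (L i v) \<bullet> v" if i: "i \<in> I" for i
  proof -
    interpret Li: unit_op "L i" by (rule L[OF i])
    \<comment> \<open>Weighting the inequality at k / n by the k-th Bernstein polynomial of R and
      summing reassembles \<open>G\<close> and \<open>F'\<close> as functions of R.\<close>
    have "0 \<le> (\<Sum>k\<le>n. peval (bernstein_poly n k) R (peval (H k) (L i) v) \<bullet> v)"
      by (intro sum_nonneg peval_joint_nonneg R Li.unit_op_axioms comm i H) (auto simp: Bernstein_nonneg)
    also have "\<dots> = (\<Sum>k\<le>n. peval (bernstein_poly n k) R (peval F (L i) v) \<bullet> v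
         + g (k / n) * (peval (bernstein_poly n k) R v \<bullet> v) + e * (peval (bernstein_poly n k) R v \<bullet> v)
         - f' (k / n) * (peval (bernstein_poly n k) R (L i v) \<bullet> v))"
      by (intro sum.cong refl)
        (simp add: H_def peval_add peval_pCons[OF Li.lin] linear_0[OF Li.lin] linear_scale[OF Li.lin] linear_neg[OF Li.lin]
          linear_add[OF linear_peval[OF R.lin]] linear_scale[OF linear_peval[OF R.lin]] linear_diff[OF linear_peval[OF R.lin]]
          inner_add_left algebra_simps)
    also have "\<dots> = peval (\<Sum>k\<le>n. bernstein_poly n k) R (peval F (L i) v) \<bullet> v + peval G R v \<bullet> v
        + e * (peval (\<Sum>k\<le>n. bernstein_poly n k) R v \<bullet> v) - peval F' R (L i v) \<bullet> v"
      unfolding G_def F'_def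
      by (simp add: peval_sum peval_smult inner_sum_left sum.distrib sum_subtractf sum_distrib_left)
    also have "\<dots> = peval F (L i) v \<bullet> v + peval G R v \<bullet> v + e - peval F' R (L i v) \<bullet> v"
      using v by (simp add: B1 peval_1[OF R.lin] dot_square_norm)
    finally show ?thesis .
  qed
  have "0 \<le> (\<Sum>i\<in>I. w i * (peval F (L i) v \<bullet> v + peval G R v \<bullet> v + e - peval F' R (L i v) \<bullet> v))"
    by (intro sum_nonneg mult_nonneg_nonneg w key)
  also have "\<dots> = (\<Sum>i\<in>I. w i * (peval F (L i) v \<bullet> v)) + (\<Sum>i\<in>I. w i * (peval G R v \<bullet> v + e))
      - (\<Sum>i\<in>I. w i *\<^sub>R peval F' R (L i v)) \<bullet> v"
    by (simp add: sum.distrib sum_subtractf inner_sum_left distrib_left right_diff_distrib)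
  also have "(\<Sum>i\<in>I. w i * (peval G R v \<bullet> v + e)) = peval G R v \<bullet> v + e"
    by (simp add: w(2) flip: sum_distrib_right)
  \<comment> \<open>This term is linear in \<open>L i v\<close>, so the average moves inside and
    becomes \<open>R v\<close>: only R is left in it.\<close>
  also have "(\<Sum>i\<in>I. w i *\<^sub>R peval F' R (L i v)) = peval F' R (R v)"
    unfolding avg[symmetric]
    by (simp add: linear_sum[OF linear_peval[OF R.lin]] linear_scale[OF linear_peval[OF R.lin]])
  also have "\<dots> = peval (F' * [:0, 1:]) R v"
    by (simp only: peval_mult[OF R.lin]) (simp add: peval_pCons[OF R.lin] linear_0[OF R.lin])
  finally have main: "0 \<le> (\<Sum>i\<in>I. w i * (\<integral>s. poly F s \<partial>\<mu> i)) + (\<integral>s. poly G s - poly F' s * s \<partial>\<nu>) + e"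
    using spectral_measureD(3)[OF \<mu>, of _ F] spectral_measureD(3)[OF \<nu>, of "G - F' * [:0, 1:]"] w(2)
    by (simp add: peval_diff inner_diff_left mult.commute)

  have 1: "(\<integral>s. poly F s \<partial>\<mu> i) \<le> (\<integral>s. f s \<partial>\<mu> i) + e" if i: "i \<in> I" for i
  proof -
    interpret \<mu>: real_distribution "\<mu> i" by (rule spectral_measureD[OF \<mu>[OF i]])
    note ae = spectral_measureD(2)[OF \<mu>[OF i]]
    have "(\<integral>s. poly F s \<partial>\<mu> i) \<le> (\<integral>s. f s + e \<partial>\<mu> i)"
    proof (rule integral_mono_AE)
      show "AE s in \<mu> i. poly F s \<le> f s + e"
        using ae by eventually_elim (use F in fastforce)
    qed (intro \<mu>.integrable_cont_ae_bounded[OF _ ae] continuous_intros f)+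
    also have "\<dots> = (\<integral>s. f s \<partial>\<mu> i) + e"
      using \<mu>.integrable_cont_ae_bounded[OF f ae] by (simp add: \<mu>.prob_space[simplified])
    finally show ?thesis .
  qed
  have 2: "(\<integral>s. poly G s - poly F' s * s \<partial>\<nu>) \<le> 2 * e - (\<integral>s. f s \<partial>\<nu>)"
  proof -
    note ae = spectral_measureD(2)[OF \<nu>]
    have "(\<integral>s. poly G s - poly F' s * s \<partial>\<nu>) \<le> (\<integral>s. 2 * e - f s \<partial>\<nu>)"
    proof (rule integral_mono_AE)
      show "AE s in \<nu>. poly G s - poly F' s * s \<le> 2 * e - f s"
        using ae
      proof eventually_elim
        case (elim s)
        have "(f' s - poly F' s) * s \<le> e * 1"
          using F'[OF elim] elim by (intro mult_mono) auto
        then show ?case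
          using G[OF elim] by (simp add: g_def algebra_simps)
      qed
    qed (intro \<nu>.integrable_cont_ae_bounded[OF _ ae] continuous_intros f)+
    also have "\<dots> = 2 * e - (\<integral>s. f s \<partial>\<nu>)"
      using \<nu>.integrable_cont_ae_bounded[OF f ae] by (simp add: \<nu>.prob_space[simplified])
    finally show ?thesis .
  qed
  have "(\<Sum>i\<in>I. w i * (\<integral>s. poly F s \<partial>\<mu> i)) \<le> (\<Sum>i\<in>I. w i * ((\<integral>s. f s \<partial>\<mu> i) + e))"
    by (intro sum_mono mult_left_mono 1 w)
  also have "\<dots> = (\<Sum>i\<in>I. w i * (\<integral>s. f s \<partial>\<mu> i)) + e"
    using w(2) by (simp add: distrib_left sum.distrib flip: sum_distrib_right)
  finally show "(\<integral>s. f s \<partial>\<nu>) \<le> (\<Sum>i\<in>I. w i * (\<integral>s. f s \<partial>\<mu> i)) + e'"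
    using main 2 e unfolding e_def by linarith
qed

text \<open>The smoothing \<open>\<delta>\<close> makes \<open>\<bar>s\<bar> powr p\<close> continuously differentiable even for \<open>p = 1\<close>.\<close>

lemma smoothed_powr_tangent:
  fixes a b \<delta> p :: real
  assumes "0 < \<delta>" "1 \<le> p"
  shows "(a\<^sup>2 + \<delta>) powr (p / 2) + p * (a\<^sup>2 + \<delta>) powr (p / 2 - 1) * a * (b - a) \<le> (b\<^sup>2 + \<delta>) powr (p / 2)"
proof -
  define A where "A = sqrt (a\<^sup>2 + \<delta>)"
  define B where "B = sqrt (b\<^sup>2 + \<delta>)"
  have A: "0 < A" "A\<^sup>2 = a\<^sup>2 + \<delta>" and B: "0 < B" "B\<^sup>2 = b\<^sup>2 + \<delta>"
    using assms by (auto simp: A_def B_def add_nonneg_pos intro: add_nonneg_nonneg)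
  have pw: "(x\<^sup>2) powr r = x powr (2 * r)" if "0 < x" for x r :: real
    using that by (simp add: powr_powr flip: powr_numeral)
  \<comment> \<open>Cauchy-Schwarz for the plane vectors (a, sqrt \<delta>) and (b, sqrt \<delta>),
    whose lengths are A and B.\<close>
  have AB: "a * b + \<delta> \<le> A * B"
  proof (rule power2_le_imp_le)
    have "(A * B)\<^sup>2 - (a * b + \<delta>)\<^sup>2 = \<delta> * (a - b)\<^sup>2"
      by (simp add: power_mult_distrib A B) (simp add: power2_eq_square algebra_simps)
    also have "\<dots> \<ge> 0" using assms by simp
    finally show "(a * b + \<delta>)\<^sup>2 \<le> (A * B)\<^sup>2" by simp
  qed (use A B in simp)
  \<comment> \<open>Subtracting A^2 = a^2 + \<delta> in \<open>AB\<close> gives a (b - a) \<le> A (B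
    - A), which reduces the claim to the tangent of the p-th power at A.\<close>
  have "p * A powr (p - 2) * (a * (b - a)) \<le> p * A powr (p - 2) * (A * (B - A))"
    using assms AB A(2) by (intro mult_left_mono) (auto simp: power2_eq_square algebra_simps)
  also have "\<dots> = p * A powr (p - 1) * (B - A)"
    using A powr_mult_base[of A "p - 2"] by (simp add: mult_ac)
  also have "\<dots> \<le> B powr p - A powr p"
  proof -
    have "B powr p - A powr p \<ge> (p * A powr (p - 1)) * (B - A)"
    proof (rule convex_on_imp_above_tangent[where A = "{0<..}"])
      show "convex_on {0<..} (\<lambda>x. x powr p)"
        using assms by (intro convex_on_subset[OF powr_convex]) auto
      show "((\<lambda>x. x powr p) has_field_derivative p * A powr (p - 1)) (at A within {0<..})"
        using A by (auto intro!: derivative_eq_intros)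
      show "A \<in> interior {0<..}" using A by (simp add: interior_open)
    qed (use B in auto)
    then show ?thesis .
  qed
  finally have "A powr p + p * A powr (p - 2) * (a * (b - a)) \<le> B powr p" by linarith
  moreover have "(a\<^sup>2 + \<delta>) powr r = A powr (2 * r)" "(b\<^sup>2 + \<delta>) powr r = B powr (2 * r)" for r
    using pw A B by (metis)+
  ultimately show ?thesis
    by (simp add: algebra_simps)
qed

section \<open>The algebra of polynomials as a pre-Hilbert space\<close>

typedef 'a finsupp = "{f :: 'a \<Rightarrow> complex. finite {x. f x \<noteq> 0}}"
  morphisms cf Abs_finsupp
  by (intro exI[of _ "\<lambda>_. 0"]) simp

setup_lifting type_definition_finsupp

lemma finite_cf [simp]: "finite {x. cf f x \<noteq> 0}"
  using cf[of f] by simp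

lemma finsupp_eqI: "(\<And>x. cf f x = cf g x) \<Longrightarrow> f = g"
  by (simp add: cf_inject[symmetric] fun_eq_iff)

instantiation finsupp :: (type) real_vector
begin

lift_definition zero_finsupp :: "'a finsupp" is "\<lambda>_. 0"
  by simp
lift_definition plus_finsupp :: "'a finsupp \<Rightarrow> 'a finsupp \<Rightarrow> 'a finsupp" is "\<lambda>f g x. f x + g x"
  subgoal for f g by (rule finite_subset[of _ "{x. f x \<noteq> 0} \<union> {x. g x \<noteq> 0}"]) auto
  done
lift_definition minus_finsupp :: "'a finsupp \<Rightarrow> 'a finsupp \<Rightarrow> 'a finsupp" is "\<lambda>f g x. f x - g x"
  subgoal for f g by (rule finite_subset[of _ "{x. f x \<noteq> 0} \<union> {x. g x \<noteq> 0}"]) auto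
  done
lift_definition uminus_finsupp :: "'a finsupp \<Rightarrow> 'a finsupp" is "\<lambda>f x. - f x"
  by simp
lift_definition scaleR_finsupp :: "real \<Rightarrow> 'a finsupp \<Rightarrow> 'a finsupp" is "\<lambda>c f x. c *\<^sub>R f x"
  by (auto elim!: rev_finite_subset)

instance
  by standard (transfer; simp add: algebra_simps)+

end

lemmas cf_simps [simp] =
  zero_finsupp.rep_eq[THEN fun_cong] plus_finsupp.rep_eq[THEN fun_cong] minus_finsupp.rep_eq[THEN fun_cong]
  uminus_finsupp.rep_eq[THEN fun_cong] scaleR_finsupp.rep_eq[THEN fun_cong]

instantiation finsupp :: (type) real_inner
begin

text \<open>The real part of the Hermitian product. It induces the same norm, and forms of
  self-adjoint operators are real anyway.\<close>

definition inner_finsupp :: "'a finsupp \<Rightarrow> 'a finsupp \<Rightarrow> real" where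
  "inner_finsupp f g = (\<Sum>x | cf f x \<noteq> 0. cf f x \<bullet> cf g x)"
definition norm_finsupp :: "'a finsupp \<Rightarrow> real" where
  "norm_finsupp f = sqrt (f \<bullet> f)"
definition sgn_finsupp :: "'a finsupp \<Rightarrow> 'a finsupp" where
  "sgn_finsupp f = f /\<^sub>R norm f"
definition dist_finsupp :: "'a finsupp \<Rightarrow> 'a finsupp \<Rightarrow> real" where
  "dist_finsupp f g = norm (f - g)"
definition uniformity_finsupp :: "('a finsupp \<times> 'a finsupp) filter" where
  "uniformity_finsupp = (INF e\<in>{0<..}. principal {(x, y). dist x y < e})"
definition open_finsupp :: "'a finsupp set \<Rightarrow> bool" where
  "open_finsupp U = (\<forall>x\<in>U. \<forall>\<^sub>F (x', y) in uniformity. x' = x \<longrightarrow> y \<in> U)"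

lemma inner_finsupp_superset:
  assumes "finite A" "{x. cf f x \<noteq> 0} \<subseteq> A"
  shows "f \<bullet> g = (\<Sum>x\<in>A. cf f x \<bullet> cf g x)"
  unfolding inner_finsupp_def using assms by (intro sum.mono_neutral_left) auto

instance
proof
  fix f g h :: "'a finsupp" and r :: real
  define A where "A = {x. cf f x \<noteq> 0} \<union> {x. cf g x \<noteq> 0}"
  have A: "finite A" "{x. cf f x \<noteq> 0} \<subseteq> A" "{x. cf g x \<noteq> 0} \<subseteq> A" "{x. cf (f + g) x \<noteq> 0} \<subseteq> A"
     "{x. cf (r *\<^sub>R f) x \<noteq> 0} \<subseteq> A"
    by (auto simp: A_def)
  note inner = inner_finsupp_superset[OF A(1)]
  show "f \<bullet> g = g \<bullet> f"
    by (simp add: inner A inner_commute)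
  show "(f + g) \<bullet> h = f \<bullet> h + g \<bullet> h"
    using A by (simp add: inner inner_add_left sum.distrib)
  show "r *\<^sub>R f \<bullet> g = r * (f \<bullet> g)"
    using A by (simp add: inner sum_distrib_left)
  show "0 \<le> f \<bullet> f"
    by (simp add: inner_finsupp_def sum_nonneg)
  show "(f \<bullet> f = 0) = (f = 0)"
    by (auto simp: inner_finsupp_def sum_nonneg_eq_0_iff intro: finsupp_eqI)
qed (simp_all add: norm_finsupp_def sgn_finsupp_def dist_finsupp_def uniformity_finsupp_def open_finsupp_def)

end

lift_definition fsingle :: "'a \<Rightarrow> complex \<Rightarrow> 'a finsupp" is "\<lambda>a c x. if x = a then c else 0"
  by simp

lemma cf_fsingle: "cf (fsingle a c) x = (if x = a then c else 0)"
  by (rule fsingle.rep_eq[THEN fun_cong])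

lemma inner_fsingle: "fsingle a c \<bullet> fsingle b d = (if a = b then Re (cnj c * d) else 0)"
  by (subst inner_finsupp_superset[of "{a}"]) (auto simp: cf_fsingle inner_complex_def)

lemma cf_sum: "cf (\<Sum>i\<in>I. f i) x = (\<Sum>i\<in>I. cf (f i) x)"
  by (induction I rule: infinite_finite_induct) simp_all

text \<open>The monomials carry their coefficients, so additivity alone reduces an identity to
  monomials.\<close>

lemma finsupp_induct [case_names single add]:
  assumes single: "\<And>a c. P (fsingle a c)" and add: "\<And>f g. P f \<Longrightarrow> P g \<Longrightarrow> P (f + g)"
  shows "P f"
proof -
  have "P 0"
    using single[of undefined 0] by (simp add: finsupp_eqI[of "fsingle undefined 0" 0] cf_fsingle)
  have "f = (\<Sum>a | cf f a \<noteq> 0. fsingle a (cf f a))"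
    by (rule finsupp_eqI) (simp add: cf_sum cf_fsingle)
  moreover have "P (\<Sum>a\<in>A. fsingle a (cf f a))" for A
    by (induction A rule: infinite_finite_induct) (simp_all add: \<open>P 0\<close> single add)
  ultimately show ?thesis by metis
qed

text \<open>A Fourier multiplier. With constant \<open>g\<close> it also serves as multiplication by
  a complex scalar, which the real vector space structure does not provide.\<close>

lift_definition modulate :: "('a \<Rightarrow> complex) \<Rightarrow> 'a finsupp \<Rightarrow> 'a finsupp" is "\<lambda>g f x. g x * f x"
  by (auto elim!: rev_finite_subset)

lemmas cf_modulate [simp] = modulate.rep_eq[THEN fun_cong]

lemma modulate_fsingle: "modulate g (fsingle a c) = fsingle a (g a * c)"
  by (rule finsupp_eqI) (simp add: cf_fsingle)

lemma linear_modulate: "linear (modulate g)"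
  by (auto simp: linear_iff intro!: finsupp_eqI simp: algebra_simps)

lemma inner_modulate: "modulate g a \<bullet> b = a \<bullet> modulate (\<lambda>x. cnj (g x)) b"
proof -
  have "finite {x. cf a x \<noteq> 0}" "{x. cf (modulate g a) x \<noteq> 0} \<subseteq> {x. cf a x \<noteq> 0}" by auto
  then show ?thesis
    by (subst (1 2) inner_finsupp_superset[of "{x. cf a x \<noteq> 0}"]) (auto simp: inner_complex_def algebra_simps intro!: sum.cong)
qed

section \<open>Twisted convolution, adjoint and trace\<close>

definition qt_form :: "(nat \<Rightarrow> nat \<Rightarrow> real) \<Rightarrow> nat \<Rightarrow> mindex \<Rightarrow> mindex \<Rightarrow> real" where
  "qt_form \<theta> n \<alpha> \<beta> = 2 * pi * (\<Sum>k<n. \<Sum>j<k. \<theta> k j * of_int (\<alpha> k) * of_int (\<beta> j))"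

lemma qt_tw_eq_cis: "qt_tw \<theta> n \<alpha> \<beta> = cis (qt_form \<theta> n \<alpha> \<beta>)"
  by (simp add: qt_tw_def qt_form_def)

lemma qt_form_simps:
  "qt_form \<theta> n (\<lambda>i. \<alpha> i + \<alpha>' i) \<beta> = qt_form \<theta> n \<alpha> \<beta> + qt_form \<theta> n \<alpha>' \<beta>"
  "qt_form \<theta> n \<alpha> (\<lambda>i. \<beta> i + \<beta>' i) = qt_form \<theta> n \<alpha> \<beta> + qt_form \<theta> n \<alpha> \<beta>'"
  "qt_form \<theta> n (\<lambda>i. - \<alpha> i) \<beta> = - qt_form \<theta> n \<alpha> \<beta>"
  "qt_form \<theta> n \<alpha> (\<lambda>i. - \<beta> i) = - qt_form \<theta> n \<alpha> \<beta>"
  "qt_form \<theta> n \<alpha> (\<lambda>_. 0) = 0"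
  "qt_form \<theta> n (\<lambda>_. 0) \<beta> = 0"
  by (simp_all add: qt_form_def sum.distrib sum_negf algebra_simps)

context
  fixes \<theta> :: "nat \<Rightarrow> nat \<Rightarrow> real" and n :: nat
begin

lift_definition qmul :: "mindex finsupp \<Rightarrow> mindex finsupp \<Rightarrow> mindex finsupp" is "qt_mult \<theta> n"
proof -
  fix f g :: qpoly
  assume f: "finite {x. f x \<noteq> 0}" and g: "finite {x. g x \<noteq> 0}"
  have "{\<gamma>. qt_mult \<theta> n f g \<gamma> \<noteq> 0} \<subseteq> (\<lambda>(\<alpha>, \<beta>) i. \<alpha> i + \<beta> i) ` ({x. f x \<noteq> 0} \<times> {x. g x \<noteq> 0})"
  proof
    fix \<gamma> assume "\<gamma> \<in> {\<gamma>. qt_mult \<theta> n f g \<gamma> \<noteq> 0}"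
    then obtain \<alpha> where "f \<alpha> \<noteq> 0" "g (\<lambda>i. \<gamma> i - \<alpha> i) \<noteq> 0"
      by (auto simp: qt_mult_def elim!: sum.not_neutral_contains_not_neutral)
    then show "\<gamma> \<in> (\<lambda>(\<alpha>, \<beta>) i. \<alpha> i + \<beta> i) ` ({x. f x \<noteq> 0} \<times> {x. g x \<noteq> 0})"
      by (intro rev_image_eqI[of "(\<alpha>, \<lambda>i. \<gamma> i - \<alpha> i)"]) auto
  qed
  then show "finite {x. qt_mult \<theta> n f g x \<noteq> 0}"
    by (rule finite_subset) (intro finite_imageI finite_cartesian_product f g)
qed

lift_definition qstar :: "mindex finsupp \<Rightarrow> mindex finsupp" is "qt_star \<theta> n"
proof -
  fix f :: qpoly
  assume f: "finite {x. f x \<noteq> 0}"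
  have "{\<beta>. qt_star \<theta> n f \<beta> \<noteq> 0} \<subseteq> (\<lambda>\<alpha> i. - \<alpha> i) ` {x. f x \<noteq> 0}"
  proof
    fix \<beta> assume "\<beta> \<in> {\<beta>. qt_star \<theta> n f \<beta> \<noteq> 0}"
    then show "\<beta> \<in> (\<lambda>\<alpha> i. - \<alpha> i) ` {x. f x \<noteq> 0}"
      by (intro rev_image_eqI[of "\<lambda>i. - \<beta> i"]) (auto simp: qt_star_def)
  qed
  then show "finite {x. qt_star \<theta> n f x \<noteq> 0}"
    by (rule finite_subset) (intro finite_imageI f)
qed

text \<open>The sum in \<open>qt_mult\<close> runs over the support of the left factor; a common
  index set is needed to vary that factor.\<close>

lemma cf_qmul_superset:
  assumes "finite A" "{x. cf a x \<noteq> 0} \<subseteq> A"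
  shows "cf (qmul a b) \<gamma> = (\<Sum>\<alpha>\<in>A. cf a \<alpha> * cf b (\<lambda>i. \<gamma> i - \<alpha> i) * qt_tw \<theta> n \<alpha> (\<lambda>i. \<gamma> i - \<alpha> i))"
  unfolding qmul.rep_eq qt_mult_def qt_supp_def using assms by (intro sum.mono_neutral_left) auto

lemma qmul_add_left: "qmul (a + a') b = qmul a b + qmul a' b"
proof (rule finsupp_eqI)
  fix \<gamma>
  define A where "A = {x. cf a x \<noteq> 0} \<union> {x. cf a' x \<noteq> 0}"
  have "finite A" "{x. cf a x \<noteq> 0} \<subseteq> A" "{x. cf a' x \<noteq> 0} \<subseteq> A" "{x. cf (a + a') x \<noteq> 0} \<subseteq> A"
    by (auto simp: A_def)
  then show "cf (qmul (a + a') b) \<gamma> = cf (qmul a b + qmul a' b) \<gamma>"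
    by (simp add: cf_qmul_superset sum.distrib distrib_right)
qed

lemma qmul_add_right: "qmul a (b + b') = qmul a b + qmul a b'"
  by (rule finsupp_eqI) (simp add: qmul.rep_eq qt_mult_def sum.distrib algebra_simps)

lemma qmul_modulate_const: "qmul (modulate (\<lambda>_. c) a) b = modulate (\<lambda>_. c) (qmul a b)"
     "qmul a (modulate (\<lambda>_. c) b) = modulate (\<lambda>_. c) (qmul a b)"
proof -
  have "finite {x. cf a x \<noteq> 0}" "{x. cf (modulate (\<lambda>_. c) a) x \<noteq> 0} \<subseteq> {x. cf a x \<noteq> 0}" by auto
  then show "qmul (modulate (\<lambda>_. c) a) b = modulate (\<lambda>_. c) (qmul a b)"
    by (intro finsupp_eqI) (simp add: cf_qmul_superset[of "{x. cf a x \<noteq> 0}"] sum_distrib_left mult_ac)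
  show "qmul a (modulate (\<lambda>_. c) b) = modulate (\<lambda>_. c) (qmul a b)"
    by (intro finsupp_eqI) (simp add: qmul.rep_eq qt_mult_def sum_distrib_left mult_ac)
qed

lemma modulate_of_real: "modulate (\<lambda>_. complex_of_real r) a = r *\<^sub>R a"
  by (rule finsupp_eqI) (simp add: scaleR_conv_of_real)

lemma linear_qmul: "linear (qmul a)"
  using qmul_modulate_const(2)[of a "complex_of_real _"] 
  by (auto simp: linear_iff qmul_add_right modulate_of_real)

lemma linear_qmul_left: "linear (\<lambda>a. qmul a b)"
  using qmul_modulate_const(1)[of "complex_of_real _" _ b] 
  by (auto simp: linear_iff qmul_add_left modulate_of_real)

lemma qmul_fsingle:
  "qmul (fsingle \<alpha> a) (fsingle \<beta> b) = fsingle (\<lambda>i. \<alpha> i + \<beta> i) (a * b * qt_tw \<theta> n \<alpha> \<beta>)"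
proof (rule finsupp_eqI)
  fix \<gamma> :: mindex
  have *: "(\<lambda>i. \<gamma> i - \<alpha> i) = \<beta> \<longleftrightarrow> \<gamma> = (\<lambda>i. \<alpha> i + \<beta> i)"
    by (auto simp: fun_eq_iff algebra_simps)
  have "cf (qmul (fsingle \<alpha> a) (fsingle \<beta> b)) \<gamma>
     = a * (if (\<lambda>i. \<gamma> i - \<alpha> i) = \<beta> then b else 0) * qt_tw \<theta> n \<alpha> (\<lambda>i. \<gamma> i - \<alpha> i)"
    by (subst cf_qmul_superset[of "{\<alpha>}"]) (auto simp: cf_fsingle)
  then show "cf (qmul (fsingle \<alpha> a) (fsingle \<beta> b)) \<gamma>
     = cf (fsingle (\<lambda>i. \<alpha> i + \<beta> i) (a * b * qt_tw \<theta> n \<alpha> \<beta>)) \<gamma>"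
    by (auto simp: * cf_fsingle)
qed

text \<open>On monomials both sides carry the phase \<open>qt_form\<close> of (\<alpha>, \<beta>),
  (\<alpha>, \<gamma>) and (\<beta>, \<gamma>) added up, by bilinearity.\<close>

lemma qmul_assoc: "qmul (qmul a b) c = qmul a (qmul b c)"
proof (induction a rule: finsupp_induct)
  case (single \<alpha> a)
  show ?case
  proof (induction b rule: finsupp_induct)
    case (single \<beta> b)
    show ?case
      by (induction c rule: finsupp_induct)
        (simp_all add: qmul_fsingle qt_tw_eq_cis qt_form_simps cis_mult mult_ac add_ac qmul_add_right flip: cis_mult)
  qed (simp add: qmul_add_left qmul_add_right)
qed (simp add: qmul_add_left)

lemma qstar_fsingle: "qstar (fsingle \<alpha> a) = fsingle (\<lambda>i. - \<alpha> i) (cnj a * qt_tw \<theta> n \<alpha> \<alpha>)"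
proof (rule finsupp_eqI)
  fix \<beta> :: mindex
  have *: "(\<lambda>i. - \<beta> i) = \<alpha> \<longleftrightarrow> \<beta> = (\<lambda>i. - \<alpha> i)"
    by (simp add: fun_eq_iff) (metis minus_minus)
  show "cf (qstar (fsingle \<alpha> a)) \<beta> = cf (fsingle (\<lambda>i. - \<alpha> i) (cnj a * qt_tw \<theta> n \<alpha> \<alpha>)) \<beta>"
    by (auto simp: qstar.rep_eq qt_star_def cf_fsingle * qt_tw_eq_cis qt_form_simps cis_cnj)
qed

lemma qstar_add: "qstar (a + b) = qstar a + qstar b"
  by (rule finsupp_eqI) (simp add: qstar.rep_eq qt_star_def algebra_simps)

lemma qstar_modulate_const: "qstar (modulate (\<lambda>_. c) a) = modulate (\<lambda>_. cnj c) (qstar a)"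
  by (rule finsupp_eqI) (simp add: qstar.rep_eq qt_star_def mult_ac)

lemma linear_qstar: "linear qstar"
  using qstar_modulate_const[of "complex_of_real _"]
  by (auto simp: linear_iff qstar_add modulate_of_real)

lemma qstar_qstar [simp]: "qstar (qstar a) = a"
  by (induction a rule: finsupp_induct)
     (simp_all add: qstar_fsingle qstar_add qt_tw_eq_cis qt_form_simps cis_cnj cis_mult mult.assoc)

lemma qstar_qmul: "qstar (qmul a b) = qmul (qstar b) (qstar a)"
proof (induction a rule: finsupp_induct)
  case (single \<alpha> a)
  show ?case
  proof (induction b rule: finsupp_induct)
    case (single \<beta> b)
    have "- qt_form \<theta> n \<alpha> \<beta> + qt_form \<theta> n (\<lambda>i. \<alpha> i + \<beta> i) (\<lambda>i. \<alpha> i + \<beta> i)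
       = qt_form \<theta> n \<beta> \<beta> + qt_form \<theta> n \<alpha> \<alpha> + qt_form \<theta> n \<beta> \<alpha>"
      by (simp add: qt_form_simps)
    then have "cnj (qt_tw \<theta> n \<alpha> \<beta>) * qt_tw \<theta> n (\<lambda>i. \<alpha> i + \<beta> i) (\<lambda>i. \<alpha> i + \<beta> i)
        = qt_tw \<theta> n \<beta> \<beta> * qt_tw \<theta> n \<alpha> \<alpha> * qt_tw \<theta> n \<beta> \<alpha>"
      by (simp only: qt_tw_eq_cis cis_cnj cis_mult)
    moreover have "qt_tw \<theta> n (\<lambda>i. - \<beta> i) (\<lambda>i. - \<alpha> i) = qt_tw \<theta> n \<beta> \<alpha>"
      by (simp add: qt_tw_eq_cis qt_form_simps)
    moreover have "(\<lambda>i. - \<alpha> i - \<beta> i) = (\<lambda>i. - \<beta> i - \<alpha> i)"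
      by (simp add: fun_eq_iff)
    ultimately show ?case
      by (simp add: qmul_fsingle qstar_fsingle mult.assoc mult.left_commute[of _ "cnj b"]
          mult.left_commute[of "qt_tw \<theta> n \<beta> \<beta>" "cnj a"])
  qed (simp add: qmul_add_left qmul_add_right qstar_add)
qed (simp add: qmul_add_left qmul_add_right qstar_add)

lemma inner_qmul_left: "qmul a b \<bullet> c = b \<bullet> qmul (qstar a) c"
proof (induction a rule: finsupp_induct)
  case (single \<alpha> a)
  show ?case
  proof (induction b rule: finsupp_induct)
    case (single \<beta> b)
    show ?case
    proof (induction c rule: finsupp_induct)
      case (single \<gamma> c)
      have iff: "(\<lambda>i. \<alpha> i + \<beta> i) = \<gamma> \<longleftrightarrow> \<beta> = (\<lambda>i. - \<alpha> i + \<gamma> i)"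
        by (auto simp: fun_eq_iff algebra_simps)
      have tw: "cnj (qt_tw \<theta> n \<alpha> \<beta>) = qt_tw \<theta> n \<alpha> \<alpha> * qt_tw \<theta> n (\<lambda>i. - \<alpha> i) (\<lambda>i. \<alpha> i + \<beta> i)"
        by (simp add: qt_tw_eq_cis qt_form_simps cis_cnj cis_mult)
      show ?case
      proof (cases "(\<lambda>i. \<alpha> i + \<beta> i) = \<gamma>")
        case True
        then have "\<beta> = (\<lambda>i. - \<alpha> i + \<gamma> i)" using iff by simp
        then show ?thesis
          using True tw unfolding qmul_fsingle qstar_fsingle inner_fsingle
          by (simp only: if_True complex_cnj_mult) (simp add: mult_ac)
      next
        case False
        then show ?thesis
          using iff unfolding qmul_fsingle qstar_fsingle inner_fsingle by simp
      qed
    qed (simp add: qmul_add_right inner_add_right)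
  qed (simp add: qmul_add_right inner_add_left)
qed (simp add: qmul_add_left inner_add_left inner_add_right qstar_add)

text \<open>The trace property of tau in disguise: the two sides are the real parts of tau (a b')
  and tau (b' a), with b' the adjoint of b.\<close>

lemma inner_qstar: "qstar a \<bullet> qstar b = a \<bullet> b"
proof (induction a rule: finsupp_induct)
  case (single \<alpha> a)
  show ?case
  proof (induction b rule: finsupp_induct)
    case (single \<beta> b)
    have "(\<lambda>i. - \<alpha> i) = (\<lambda>i. - \<beta> i) \<longleftrightarrow> \<alpha> = \<beta>"
      by (auto simp: fun_eq_iff)
    moreover have "cnj (qt_tw \<theta> n \<alpha> \<alpha>) * qt_tw \<theta> n \<alpha> \<alpha> = 1"
      by (simp add: qt_tw_eq_cis cis_cnj cis_mult)
    then have "a * cnj (qt_tw \<theta> n \<alpha> \<alpha>) * (cnj b * qt_tw \<theta> n \<alpha> \<alpha>) = a * cnj b"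
      by (metis (no_types, opaque_lifting) mult.assoc mult.commute mult.right_neutral)
    moreover have "Re (a * cnj b) = Re (cnj a * b)" by simp
    ultimately show ?case
      by (simp only: qstar_fsingle inner_fsingle complex_cnj_mult complex_cnj_cnj)
         (auto simp only: if_True if_False)
  qed (simp add: inner_add_right qstar_add)
qed (simp add: inner_add_left qstar_add)

text \<open>Taking adjoints is isometric and exchanges left and right multiplication.\<close>

lemma inner_qmul_right: "qmul b a \<bullet> c = b \<bullet> qmul c (qstar a)"
proof -
  have "qmul b a \<bullet> c = qmul (qstar a) (qstar b) \<bullet> qstar c"
    using inner_qstar[of "qmul b a" c] by (simp add: qstar_qmul)
  also have "\<dots> = qstar b \<bullet> qstar (qmul c (qstar a))"
    by (simp add: inner_qmul_left qstar_qmul)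
  finally show ?thesis by (simp add: inner_qstar)
qed

lemma norm_qstar: "norm (qstar a) = norm a"
  by (simp add: norm_eq_sqrt_inner inner_qstar)

abbreviation "qone \<equiv> fsingle (\<lambda>_. 0) 1"

lemma qmul_scalar: "qmul (fsingle (\<lambda>_. 0) c) b = modulate (\<lambda>_. c) b"
  by (induction b rule: finsupp_induct)
    (simp_all add: qmul_fsingle modulate_fsingle qt_tw_eq_cis qt_form_simps qmul_add_right linear_add[OF linear_modulate])

lemma qmul_qone_left [simp]: "qmul qone b = b"
  by (simp add: qmul_scalar) (simp add: finsupp_eqI)

lemma qmul_qone_right [simp]: "qmul b qone = b"
  by (induction b rule: finsupp_induct)
    (simp_all add: qmul_fsingle qt_tw_eq_cis qt_form_simps qmul_add_left)

lemma qstar_qone [simp]: "qstar qone = qone"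
  by (simp add: qstar_fsingle qt_tw_eq_cis qt_form_simps)

text \<open>The adjoint of a monomial times the monomial is a scalar, so a monomial scales norms
  exactly; sums follow by the triangle inequality.\<close>

lemma norm_qmul_bounded: "\<exists>K>0. \<forall>b. norm (qmul a b) \<le> K * norm b"
proof (induction a rule: finsupp_induct)
  case (single \<alpha> a)
  \<comment> \<open>Adding 1 keeps the constant positive when a = 0.\<close>
  have "norm (qmul (fsingle \<alpha> a) b) \<le> (cmod a + 1) * norm b" for b
  proof -
    have "qmul (qstar (fsingle \<alpha> a)) (fsingle \<alpha> a) = fsingle (\<lambda>_. 0) (complex_of_real ((cmod a)\<^sup>2))"
    proof -
      have "cnj a * qt_tw \<theta> n \<alpha> \<alpha> * a * qt_tw \<theta> n (\<lambda>i. - \<alpha> i) \<alpha> = cnj a * a * (qt_tw \<theta> n \<alpha> \<alpha> * qt_tw \<theta> n (\<lambda>i. - \<alpha> i) \<alpha>)"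
        by (simp only: mult_ac)
      also have "\<dots> = complex_of_real ((cmod a)\<^sup>2)"
        by (simp only: qt_tw_eq_cis qt_form_simps cis_mult) (simp add: complex_norm_square mult.commute flip: of_real_power)
      finally show ?thesis
        by (simp add: qstar_fsingle qmul_fsingle)
    qed
    then have "qmul (fsingle \<alpha> a) b \<bullet> qmul (fsingle \<alpha> a) b = (cmod a)\<^sup>2 * (b \<bullet> b)"
      by (simp add: inner_qmul_left qmul_scalar modulate_of_real del: of_real_power flip: qmul_assoc)
    then have "(norm (qmul (fsingle \<alpha> a) b))\<^sup>2 = (cmod a * norm b)\<^sup>2"
      by (simp add: power2_norm_eq_inner power_mult_distrib)
    then have "norm (qmul (fsingle \<alpha> a) b) = cmod a * norm b"
      by (simp add: power2_eq_iff_nonneg)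
    then show ?thesis by (simp add: algebra_simps)
  qed
  then show ?case
    by (intro exI[of _ "cmod a + 1"]) (simp add: add_nonneg_pos)
next
  case (add f g)
  then obtain K K' where K: "0 < K" "0 < K'" "\<And>b. norm (qmul f b) \<le> K * norm b" "\<And>b. norm (qmul g b) \<le> K' * norm b"
    by blast
  have "norm (qmul (f + g) b) \<le> (K + K') * norm b" for b
    using norm_triangle_ineq[of "qmul f b" "qmul g b"] K(3,4)[of b] by (simp add: qmul_add_left algebra_simps)
  then show ?case
    using K by (intro exI[of _ "K + K'"]) auto
qed

end

section \<open>Convexity of the trace of a power\<close>

text \<open>The map t to 1/2 + t / (2 M) carries [-M, M], where the spectrum of X lies, to the
  interval [0, 1] of \<open>unit_op\<close>.\<close>

lemma unit_op_affine:
  fixes X :: "'v::real_inner \<Rightarrow> 'v"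
  assumes lin: "linear X" and sym: "\<And>v w. X v \<bullet> w = v \<bullet> X w"
    and M: "0 < M" and bd: "\<And>v. norm (X v) \<le> M * norm v"
  shows "unit_op (peval [:1 / 2, 1 / (2 * M):] X)"
proof (rule unit_op.intro)
  show "linear (peval [:1 / 2, 1 / (2 * M):] X)"
    by (rule linear_peval[OF lin])
  fix v w
  show "peval [:1 / 2, 1 / (2 * M):] X v \<bullet> w = v \<bullet> peval [:1 / 2, 1 / (2 * M):] X w"
    by (rule peval_symmetric[OF lin sym])
  have "\<bar>X v \<bullet> v\<bar> \<le> norm (X v) * norm v"
    by (rule Cauchy_Schwarz_ineq2)
  also have "\<dots> \<le> M * norm v * norm v"
    by (intro mult_right_mono bd) simp
  finally have "\<bar>X v \<bullet> v\<bar> \<le> M * (v \<bullet> v)"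
    by (simp add: dot_square_norm power2_eq_square mult.assoc)
  then have "\<bar>X v \<bullet> v / (2 * M)\<bar> \<le> (v \<bullet> v) / 2"
    using M by (simp add: abs_mult field_simps)
  then have "0 \<le> (v \<bullet> v) / 2 + X v \<bullet> v / (2 * M)" "(v \<bullet> v) / 2 + X v \<bullet> v / (2 * M) \<le> v \<bullet> v"
    by linarith+
  then show "0 \<le> peval [:1 / 2, 1 / (2 * M):] X v \<bullet> v" "peval [:1 / 2, 1 / (2 * M):] X v \<bullet> v \<le> v \<bullet> v"
    by (simp_all add: peval_linear[OF lin] inner_add_left)
qed

context
  fixes \<theta> :: "nat \<Rightarrow> nat \<Rightarrow> real" and n :: nat
begin

interpretation qm: linear "qmul \<theta> n a" for a by (rule linear_qmul)
interpretation qml: linear "\<lambda>a. qmul \<theta> n a b" for b by (rule linear_qmul_left)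

text \<open>On 2 by 2 matrices \<open>((a, b), (c, d))\<close> over the algebra, \<open>left_dil x\<close> and \<open>right_dil y\<close> are left and right
  multiplication by the self-adjoint matrices with zero diagonal and lower left entry \<open>x\<close> resp. \<open>y\<close>. This linearises
  \<open>x \<mapsto> x\<^sup>* x\<close>.\<close>

type_synonym qmat = "(mindex finsupp \<times> mindex finsupp) \<times> (mindex finsupp \<times> mindex finsupp)"

definition left_dil :: "mindex finsupp \<Rightarrow> qmat \<Rightarrow> qmat" where
  "left_dil x = (\<lambda>((a, b), (c, d)). ((qmul \<theta> n (qstar \<theta> n x) c, qmul \<theta> n (qstar \<theta> n x) d), (qmul \<theta> n x a, qmul \<theta> n x b)))"

definition right_dil :: "mindex finsupp \<Rightarrow> qmat \<Rightarrow> qmat" where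
  "right_dil y = (\<lambda>((a, b), (c, d)). ((qmul \<theta> n b y, qmul \<theta> n a (qstar \<theta> n y)), (qmul \<theta> n d y, qmul \<theta> n c (qstar \<theta> n y))))"

text \<open>The trace vector of the matrix algebra, scaled to norm 1 so that its spectral measures
  are probabilities.\<close>

definition mat_one :: qmat where
  "mat_one = (1 / sqrt 2) *\<^sub>R ((qone, 0), (0, qone))"

lemma norm_qone: "norm (qone :: mindex finsupp) = 1"
  by (simp add: norm_eq_sqrt_inner inner_fsingle)

lemma norm_mat_one: "norm mat_one = 1"
  by (simp add: mat_one_def norm_prod_def norm_qone power_divide)

lemma linear_left_dil: "linear (left_dil x)"
  by (auto simp: linear_iff left_dil_def qm.add qm.scale)

lemma linear_right_dil: "linear (right_dil x)"
  by (auto simp: linear_iff right_dil_def qml.add qml.scale)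

lemma dil_commute: "right_dil y (left_dil x v) = left_dil x (right_dil y v)"
  by (auto simp: left_dil_def right_dil_def qmul_assoc split: prod.splits)

lemma left_dil_symmetric: "left_dil x v \<bullet> w = v \<bullet> left_dil x w"
  by (auto simp: left_dil_def inner_qmul_left split: prod.splits)

lemma right_dil_symmetric: "right_dil x v \<bullet> w = v \<bullet> right_dil x w"
  by (auto simp: right_dil_def inner_qmul_right split: prod.splits)

text \<open>A matrix multiplies the identity equally from both sides; this lets
  \<open>right_dil\<close> replace \<open>left_dil\<close> at the trace vector.\<close>

lemma dil_mat_one: "right_dil x mat_one = left_dil x mat_one"
  by (simp add: left_dil_def right_dil_def mat_one_def qm.scale qml.scale qm.zero qml.zero)

lemma dil_bounded: "\<exists>M>0. \<forall>v. norm (left_dil x v) \<le> M * norm v \<and> norm (right_dil x v) \<le> M * norm v"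
proof -
  obtain K where K: "0 < K" "\<And>b. norm (qmul \<theta> n x b) \<le> K * norm b"
    using norm_qmul_bounded by blast
  obtain K' where K': "0 < K'" "\<And>b. norm (qmul \<theta> n (qstar \<theta> n x) b) \<le> K' * norm b"
    using norm_qmul_bounded by blast
  define M where "M = max K K'"
  have M: "0 < M" using K by (simp add: M_def)
  have 1: "norm (qmul \<theta> n x b) \<le> M * norm b" "norm (qmul \<theta> n (qstar \<theta> n x) b) \<le> M * norm b" for b
    using K(2)[of b] K'(2)[of b] by (auto simp: M_def max_mult_distrib_right)
  \<comment> \<open>Adjoints convert right into left multiplication without changing norms.\<close>
  have 2: "norm (qmul \<theta> n b x) \<le> M * norm b" "norm (qmul \<theta> n b (qstar \<theta> n x)) \<le> M * norm b" for b
    using 1[of "qstar \<theta> n b"] norm_qstar[of \<theta> n "qmul \<theta> n b x"] norm_qstar[of \<theta> n "qmul \<theta> n b (qstar \<theta> n x)"]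
    by (simp_all add: qstar_qmul norm_qstar)
  have sq: "(norm u)\<^sup>2 \<le> M\<^sup>2 * (norm v)\<^sup>2" if "norm u \<le> M * norm v" for u v :: "mindex finsupp"
    using power_mono[OF that, of 2] by (simp add: power_mult_distrib)
  have "norm (left_dil x v) \<le> M * norm v \<and> norm (right_dil x v) \<le> M * norm v" for v
  proof -
    obtain a b c d where v: "v = ((a, b), (c, d))" by (metis prod.collapse)
    have nv: "(norm v)\<^sup>2 = (norm a)\<^sup>2 + (norm b)\<^sup>2 + (norm c)\<^sup>2 + (norm d)\<^sup>2"
      by (simp add: v norm_prod_def)
    have "(norm (left_dil x v))\<^sup>2 \<le> (M * norm v)\<^sup>2"
      unfolding power_mult_distrib nv
      using sq[OF 1(2)[of c]] sq[OF 1(2)[of d]] sq[OF 1(1)[of a]] sq[OF 1(1)[of b]]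
      by (simp add: v left_dil_def norm_prod_def algebra_simps)
    moreover have "(norm (right_dil x v))\<^sup>2 \<le> (M * norm v)\<^sup>2"
      unfolding power_mult_distrib nv
      using sq[OF 2(1)[of b]] sq[OF 2(2)[of a]] sq[OF 2(1)[of d]] sq[OF 2(2)[of c]]
      by (simp add: v right_dil_def norm_prod_def algebra_simps)
    ultimately show ?thesis
      using M by (auto intro: power2_le_imp_le)
  qed
  with M show ?thesis by blast
qed

text \<open>The moment tau ((x^* x)^k), written as a GNS inner product and thereby real.\<close>

definition qmoment :: "mindex finsupp \<Rightarrow> nat \<Rightarrow> real" where
  "qmoment x k = (qmul \<theta> n (qmul \<theta> n (qstar \<theta> n x) x) ^^ k) qone \<bullet> qone"

text \<open>The bound \<open>C\<close> is arbitrary, unlike the operator norm in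
  \<open>qt_spec\<close>, so elements can be compared by their moments alone.\<close>

definition moment_measure :: "mindex finsupp \<Rightarrow> real measure \<Rightarrow> bool" where
  "moment_measure x \<mu> \<longleftrightarrow> real_distribution \<mu> \<and> (\<exists>C. AE s in \<mu>. s \<in> {0..C}) \<and> (\<forall>k. (\<integral>s. s ^ k \<partial>\<mu>) = qmoment x k)"

text \<open>Even powers of the dilation are block diagonal, with powers of x^* x and of x x^* as
  blocks. By the trace property both have the same trace, and the two factors 1 / sqrt 2 average
  them.\<close>

lemma left_dil_moment: "(left_dil x ^^ (2 * k)) mat_one \<bullet> mat_one = qmoment x k"
proof -
  define u where "u = qmul \<theta> n (qstar \<theta> n x) x"
  define v where "v = qmul \<theta> n x (qstar \<theta> n x)"
  have pow: "(left_dil x ^^ (2 * k)) mat_one = (1 / sqrt 2) *\<^sub>R (((qmul \<theta> n u ^^ k) qone, 0), (0, (qmul \<theta> n v ^^ k) qone))"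
    by (induction k) (simp_all add: mat_one_def left_dil_def u_def v_def qmul_assoc qm.scale qm.zero)
  \<comment> \<open>Intertwining: sliding \<open>x\<close> through a power exchanges
    \<open>v\<close> and \<open>u\<close>.\<close>
  have shift: "(qmul \<theta> n v ^^ k) (qmul \<theta> n x b) = qmul \<theta> n x ((qmul \<theta> n u ^^ k) b)" for k b
    by (induction k arbitrary: b) (simp_all add: u_def v_def qmul_assoc)
  have right: "(qmul \<theta> n v ^^ k) (qmul \<theta> n a b) = qmul \<theta> n ((qmul \<theta> n v ^^ k) a) b" for k a b
    by (induction k) (simp_all add: qmul_assoc)
  have "(qmul \<theta> n v ^^ k) qone \<bullet> qone = (qmul \<theta> n u ^^ k) qone \<bullet> qone"
  proof (cases k)
    case (Suc m)
    have "(qmul \<theta> n v ^^ k) qone = (qmul \<theta> n v ^^ m) (qmul \<theta> n (qmul \<theta> n x (qstar \<theta> n x)) qone)"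
      unfolding Suc funpow_Suc_right by (simp add: v_def)
    also have "\<dots> = qmul \<theta> n x ((qmul \<theta> n u ^^ m) (qstar \<theta> n x))"
      by (simp add: shift)
    finally have "(qmul \<theta> n v ^^ k) qone \<bullet> qone = (qmul \<theta> n u ^^ m) (qstar \<theta> n x) \<bullet> qstar \<theta> n x"
      by (simp add: inner_qmul_left)
    also have "(qmul \<theta> n u ^^ m) (qstar \<theta> n x) = qmul \<theta> n ((qmul \<theta> n u ^^ m) qone) (qstar \<theta> n x)"
      by (induction m) (simp_all add: qmul_assoc)
    also have "\<dots> \<bullet> qstar \<theta> n x = (qmul \<theta> n u ^^ m) qone \<bullet> u"
      by (simp add: inner_qmul_right u_def)
    also have "\<dots> = (qmul \<theta> n u ^^ k) qone \<bullet> qone"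
      by (simp add: Suc inner_qmul_left u_def qstar_qmul)
    finally show ?thesis .
  qed simp
  then show ?thesis
    by (simp add: pow qmoment_def u_def[symmetric]) (simp add: mat_one_def)
qed

text \<open>The map t to 2 M t - M undoes the rescaling of \<open>unit_op_affine\<close>, and
  squaring then yields a measure with the moments of x; compact support makes those
  decisive.\<close>

lemma integral_dilation:
  assumes M: "0 < M" and bd: "\<And>v. norm (left_dil x v) \<le> M * norm v"
    and \<rho>: "spectral_measure (peval [:1 / 2, 1 / (2 * M):] (left_dil x)) mat_one \<rho>"
    and \<mu>: "moment_measure x \<mu>" and \<phi>: "continuous_on UNIV \<phi>"
  shows "(\<integral>t. \<phi> ((2 * M * t - M)\<^sup>2) \<partial>\<rho>) = (\<integral>s. \<phi> s \<partial>\<mu> :: real)"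
proof -
  note lin = linear_left_dil
  interpret \<rho>: real_distribution \<rho> by (rule spectral_measureD[OF \<rho>])
  obtain C where \<mu>': "real_distribution \<mu>" "AE s in \<mu>. s \<in> {0..C}" "\<And>k. (\<integral>s. s ^ k \<partial>\<mu>) = qmoment x k"
    using \<mu> by (auto simp: moment_measure_def)
  define h where "h t = (2 * M * t - M)\<^sup>2" for t
  have h: "h \<in> borel_measurable \<rho>"
    using borel_measurable_continuous_onI[of h] by (simp add: h_def continuous_intros)
  define \<nu> where "\<nu> = distr \<rho> borel h"
  have \<nu>: "real_distribution \<nu>"
    using \<rho>.prob_space_distr[OF h] by (simp add: \<nu>_def real_distribution_def real_distribution_axioms_def)
  define K where "K = max \<bar>C\<bar> (M\<^sup>2)"
  have ae\<mu>: "AE s in \<mu>. s \<in> {-K..K}"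
    using \<mu>'(2) by eventually_elim (auto simp: K_def)
  have ae\<nu>: "AE s in \<nu>. s \<in> {-K..K}"
  proof -
    have "AE t in \<rho>. h t \<in> {-K..K}"
      using spectral_measureD(2)[OF \<rho>]
    proof eventually_elim
      case (elim t)
      have "\<bar>2 * M * t - M\<bar> \<le> M"
        using elim M mult_left_mono[of t 1 M] by (auto simp: abs_le_iff)
      then have "h t \<le> M\<^sup>2"
        unfolding h_def using power_mono[of "\<bar>2 * M * t - M\<bar>" M 2] by simp
      moreover have "0 \<le> h t" by (simp add: h_def)
      ultimately show ?case by (auto simp: K_def)
    qed
    then show ?thesis
      unfolding \<nu>_def by (subst AE_distr_iff[OF h]) auto
  qed
  have "(\<integral>s. s ^ k \<partial>\<nu>) = (\<integral>s. s ^ k \<partial>\<mu>)" for k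
  proof -
    have "(\<integral>s. s ^ k \<partial>\<nu>) = (\<integral>t. h t ^ k \<partial>\<rho>)"
      unfolding \<nu>_def by (intro integral_distr h) simp
    also have "\<dots> = (\<integral>t. poly (pcompose (monom 1 (2 * k)) [:-M, 2 * M:]) t \<partial>\<rho>)"
      by (simp add: h_def poly_pcompose poly_monom algebra_simps flip: power_mult)
    also have "\<dots> = peval (pcompose (monom 1 (2 * k)) [:-M, 2 * M:]) (peval [:1 / 2, 1 / (2 * M):] (left_dil x)) mat_one \<bullet> mat_one"
      by (rule spectral_measureD[OF \<rho>])
    also have "\<dots> = peval (pcompose (monom 1 (2 * k)) (pcompose [:-M, 2 * M:] [:1 / 2, 1 / (2 * M):])) (left_dil x) mat_one \<bullet> mat_one"
      by (simp only: peval_pcompose[OF lin] peval_pcompose[OF linear_peval[OF lin]] pcompose_assoc)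
    \<comment> \<open>The two affine maps are mutually inverse.\<close>
    also have "pcompose [:-M, 2 * M:] [:1 / 2, 1 / (2 * M):] = [:0, 1:]"
      using M by (simp add: pcompose_pCons)
    also have "pcompose (monom 1 (2 * k)) [:0, 1:] = monom (1::real) (2 * k)"
      by (simp add: pcompose_idR)
    also have "peval (monom 1 (2 * k)) (left_dil x) mat_one \<bullet> mat_one = qmoment x k"
      by (simp only: peval_monom scaleR_one left_dil_moment)
    finally show ?thesis by (simp add: \<mu>')
  qed
  then have "(\<integral>s. \<phi> s \<partial>\<nu>) = (\<integral>s. \<phi> s \<partial>\<mu>)"
    by (rule integral_eq_of_moments_eq[OF \<nu> \<mu>'(1) ae\<nu> ae\<mu> _ \<phi>])
  moreover have "(\<integral>s. \<phi> s \<partial>\<nu>) = (\<integral>t. \<phi> (h t) \<partial>\<rho>)"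
    unfolding \<nu>_def by (intro integral_distr h borel_measurable_continuous_onI \<phi>)
  ultimately show ?thesis by (simp add: h_def)
qed

text \<open>The average y acts from the right and the x i from the left: this makes the operators
  commute although y and x i need not.\<close>

lemma jensen_smoothed:
  assumes "finite I" and w: "\<And>i. i \<in> I \<Longrightarrow> 0 \<le> w i" "(\<Sum>i\<in>I. w i) = 1"
    and y: "y = (\<Sum>i\<in>I. w i *\<^sub>R x i)" and p: "1 \<le> p" and \<delta>: "0 < \<delta>"
    and \<nu>: "moment_measure y \<nu>" and \<mu>: "\<And>i. i \<in> I \<Longrightarrow> moment_measure (x i) (\<mu> i)"
  shows "(\<integral>s. (\<bar>s\<bar> + \<delta>) powr (p / 2) \<partial>\<nu>) \<le> (\<Sum>i\<in>I. w i * (\<integral>s. (\<bar>s\<bar> + \<delta>) powr (p / 2) \<partial>\<mu> i))"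
proof -
  have "\<forall>z. \<exists>M>0. \<forall>v. norm (left_dil z v) \<le> M * norm v \<and> norm (right_dil z v) \<le> M * norm v"
    using dil_bounded by blast
  then obtain B where B: "\<And>z. 0 < B z" "\<And>z v. norm (left_dil z v) \<le> B z * norm v" "\<And>z v. norm (right_dil z v) \<le> B z * norm v"
    by metis
  \<comment> \<open>One bound for all dilations, so that they undergo the same affine rescaling and
    the average is preserved.\<close>
  define M where "M = B y + (\<Sum>i\<in>I. B (x i))"
  have By: "B y \<le> M"
    unfolding M_def using B(1) by (simp add: sum_nonneg less_imp_le)
  have Bx: "B (x i) \<le> M" if "i \<in> I" for i
    unfolding M_def using member_le_sum[OF that, of "\<lambda>i. B (x i)"] B(1)[of y] B(1) \<open>finite I\<close>
    by (smt (verit, best))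
  have M: "0 < M" using By B(1)[of y] by simp
  have bdy: "norm (left_dil y v) \<le> M * norm v" "norm (right_dil y v) \<le> M * norm v" for v
    using B(2,3)[of y v] mult_right_mono[OF By norm_ge_zero[of v]] by linarith+
  have bdx: "norm (left_dil (x i) v) \<le> M * norm v" if "i \<in> I" for i v
    using B(2)[of "x i" v] mult_right_mono[OF Bx[OF that] norm_ge_zero[of v]] by linarith
  define T :: "(qmat \<Rightarrow> qmat) \<Rightarrow> qmat \<Rightarrow> qmat" where "T = peval [:1 / 2, 1 / (2 * M):]"
  define R where "R = T (right_dil y)"
  define L where "L i = T (left_dil (x i))" for i
  have R: "unit_op R"
    unfolding R_def T_def by (intro unit_op_affine linear_right_dil right_dil_symmetric M bdy)
  have Ly: "unit_op (T (left_dil y))"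
    unfolding T_def by (intro unit_op_affine linear_left_dil left_dil_symmetric M bdy)
  have L: "unit_op (L i)" if "i \<in> I" for i
    unfolding L_def T_def by (intro unit_op_affine linear_left_dil left_dil_symmetric M bdx that)
  have T: "T X v = (1 / 2) *\<^sub>R v + (1 / (2 * M)) *\<^sub>R X v" if "linear X" for X :: "qmat \<Rightarrow> qmat" and v
    unfolding T_def by (rule peval_linear[OF that])
  note TL = T[OF linear_left_dil] and TR = T[OF linear_right_dil]
  have comm: "T (right_dil z) (T (left_dil z') u) = T (left_dil z') (T (right_dil z) u)" for z z' u
    unfolding T_def by (intro peval_peval_commute linear_left_dil linear_right_dil dil_commute)
  have left_sum: "left_dil y mat_one = (\<Sum>i\<in>I. w i *\<^sub>R left_dil (x i) mat_one)"
  proof -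
    interpret st: linear "qstar \<theta> n" by (rule linear_qstar)
    have eq1: "left_dil z mat_one = (1 / sqrt 2) *\<^sub>R ((0, qstar \<theta> n z), (z, 0))" for z
      by (simp add: left_dil_def mat_one_def qm.scale qm.zero)
    have eq2: "(\<Sum>i\<in>I. w i *\<^sub>R ((0, qstar \<theta> n (x i)), (x i, 0))) = ((0, qstar \<theta> n y), (y, 0))"
      by (simp add: prod_eq_iff fst_sum snd_sum y st.sum st.scale)
    show ?thesis
      unfolding eq1 eq2[symmetric] scaleR_sum_right by (intro sum.cong refl scaleR_left_commute)
  qed
  have avg: "(\<Sum>i\<in>I. w i *\<^sub>R L i mat_one) = R mat_one"
  proof -
    have "(\<Sum>i\<in>I. w i *\<^sub>R L i mat_one) = (\<Sum>i\<in>I. w i *\<^sub>R (1 / 2) *\<^sub>R mat_one)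
        + (1 / (2 * M)) *\<^sub>R (\<Sum>i\<in>I. w i *\<^sub>R left_dil (x i) mat_one)"
      unfolding L_def TL scaleR_add_right sum.distrib scaleR_sum_right
      by (intro arg_cong2[where f = "(+)"] refl sum.cong scaleR_left_commute)
    also have "\<dots> = R mat_one"
      by (simp only: scaleR_sum_left[symmetric] w(2) left_sum[symmetric]) (simp add: R_def TR dil_mat_one)
    finally show ?thesis .
  qed
  obtain \<rho> where \<rho>: "spectral_measure (T (left_dil y)) mat_one \<rho>"
    using unit_op.ex_spectral_measure[OF Ly norm_mat_one] by blast
  have "\<forall>i\<in>I. \<exists>\<sigma>. spectral_measure (L i) mat_one \<sigma>"
    using unit_op.ex_spectral_measure[OF L norm_mat_one] by blast
  then obtain \<sigma> where \<sigma>: "\<And>i. i \<in> I \<Longrightarrow> spectral_measure (L i) mat_one (\<sigma> i)"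
    by metis
  \<comment> \<open>Left and right versions commute and agree at the trace vector, hence so do their
    powers there; this transfers the spectral measure to R.\<close>
  have \<rho>': "spectral_measure R mat_one \<rho>"
  proof -
    have R1: "R mat_one = T (left_dil y) mat_one"
      by (simp add: R_def TL TR dil_mat_one)
    have Rpow: "R ((T (left_dil y) ^^ k) u) = (T (left_dil y) ^^ k) (R u)" for u k
      by (induction k) (simp_all add: R_def comm)
    have "(R ^^ k) mat_one = (T (left_dil y) ^^ k) mat_one" for k
    proof (induction k)
      case (Suc k)
      then show ?case
        by (simp add: Rpow R1 funpow_swap1)
    qed simp
    then have "peval q R mat_one = peval q (T (left_dil y)) mat_one" for q
      by (simp add: peval_def)
    with \<rho> show ?thesis by (simp add: spectral_measure_def)
  qed
  define f where "f t = ((2 * M * t - M)\<^sup>2 + \<delta>) powr (p / 2)" for t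
  \<comment> \<open>The derivative of \<open>f\<close>; the last factor comes from the chain
    rule.\<close>
  define f' where "f' t = p * ((2 * M * t - M)\<^sup>2 + \<delta>) powr (p / 2 - 1) * (2 * M * t - M) * (2 * M)" for t
  have pos: "(2 * M * t - M)\<^sup>2 + \<delta> \<noteq> 0" for t
    using \<delta> by (metis add_nonneg_pos less_irrefl zero_le_power2)
  have "(\<integral>t. f t \<partial>\<rho>) \<le> (\<Sum>i\<in>I. w i * (\<integral>t. f t \<partial>\<sigma> i))"
  proof (rule jensen_spectral[OF \<open>finite I\<close> w R L _ norm_mat_one avg \<rho>' \<sigma>])
    show "R (L i u) = L i (R u)" for i u
      unfolding R_def L_def by (rule comm)
    show "continuous_on UNIV f" "continuous_on UNIV f'"
      unfolding f_def f'_def using pos by (auto intro!: continuous_intros)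
    show "f a + f' a * (b - a) \<le> f b" for a b
      using smoothed_powr_tangent[OF \<delta> p, of "2 * M * a - M" "2 * M * b - M"]
      by (simp add: f_def f'_def algebra_simps)
  qed auto
  moreover
  \<comment> \<open>The absolute value makes \<phi> continuous on the whole line and changes nothing
    at squares.\<close>
  define \<phi> where "\<phi> s = (\<bar>s\<bar> + \<delta>) powr (p / 2)" for s
  have \<phi>: "continuous_on UNIV \<phi>"
    unfolding \<phi>_def using \<delta> by (intro continuous_intros) (smt (verit))
  have f\<phi>: "f = (\<lambda>t. \<phi> ((2 * M * t - M)\<^sup>2))"
    by (simp add: fun_eq_iff f_def \<phi>_def)
  have "(\<integral>t. f t \<partial>\<rho>) = (\<integral>s. \<phi> s \<partial>\<nu>)"
    unfolding f\<phi> by (rule integral_dilation[OF M bdy(1) \<rho>[unfolded T_def] \<nu> \<phi>])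
  moreover have "(\<integral>t. f t \<partial>\<sigma> i) = (\<integral>s. \<phi> s \<partial>\<mu> i)" if "i \<in> I" for i
    unfolding f\<phi> by (rule integral_dilation[OF M bdx[OF that] \<sigma>[OF that, unfolded L_def T_def] \<mu>[OF that] \<phi>])
  ultimately show ?thesis
    unfolding \<phi>_def by simp
qed

text \<open>Removes the smoothing along \<delta> = 1 / (m + 1); bounded support supplies a constant
  dominating function.\<close>

lemma jensen_trace_powr:
  assumes I: "finite I" and w: "\<And>i. i \<in> I \<Longrightarrow> 0 \<le> w i" "(\<Sum>i\<in>I. w i) = 1"
    and y: "y = (\<Sum>i\<in>I. w i *\<^sub>R x i)" and p: "1 \<le> p"
    and \<nu>: "moment_measure y \<nu>" and \<mu>: "\<And>i. i \<in> I \<Longrightarrow> moment_measure (x i) (\<mu> i)"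
  shows "(\<integral>s. s powr (p / 2) \<partial>\<nu>) \<le> (\<Sum>i\<in>I. w i * (\<integral>s. s powr (p / 2) \<partial>\<mu> i))"
proof -
  have lim: "(\<lambda>m. \<integral>s. (\<bar>s\<bar> + 1 / real (Suc m)) powr (p / 2) \<partial>M) \<longlonglongrightarrow> (\<integral>s. s powr (p / 2) \<partial>M)"
    if "moment_measure z M" for z M
  proof -
    obtain C where M: "real_distribution M" and ae: "AE s in M. s \<in> {0..C}"
      using \<open>moment_measure z M\<close> unfolding moment_measure_def by blast
    interpret real_distribution M by fact
    show ?thesis
    proof (rule integral_dominated_convergence)
      show "integrable M (\<lambda>_. (\<bar>C\<bar> + 1) powr (p / 2))" by simp
      show "AE s in M. norm ((\<bar>s\<bar> + 1 / real (Suc m)) powr (p / 2)) \<le> (\<bar>C\<bar> + 1) powr (p / 2)" for m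
        using ae
      proof eventually_elim
        case (elim s)
        have "1 / real (Suc m) \<le> 1" by simp
        then have "s + 1 / real (Suc m) \<le> C + 1"
          using elim by (intro add_mono) auto
        with elim p show ?case by (auto intro!: powr_mono2 simp del: of_nat_Suc)
      qed
      show "AE s in M. (\<lambda>m. (\<bar>s\<bar> + 1 / real (Suc m)) powr (p / 2)) \<longlonglongrightarrow> s powr (p / 2)"
        using ae
      proof eventually_elim
        case (elim s)
        have "(\<lambda>m. (\<bar>s\<bar> + 1 / real (Suc m)) powr (p / 2)) \<longlonglongrightarrow> (\<bar>s\<bar> + 0) powr (p / 2)"
        proof (rule tendsto_powr2)
          have "(\<lambda>m. 1 / real (Suc m)) \<longlonglongrightarrow> 0"
            by real_asymp
          then show "(\<lambda>m. \<bar>s\<bar> + 1 / real (Suc m)) \<longlonglongrightarrow> \<bar>s\<bar> + 0"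
            by (intro tendsto_add tendsto_const)
        qed (use p in auto)
        then show ?case using elim by simp
      qed
    qed measurable
  qed
  show ?thesis
  proof (rule LIMSEQ_le)
    show "(\<lambda>m. \<integral>s. (\<bar>s\<bar> + 1 / real (Suc m)) powr (p / 2) \<partial>\<nu>) \<longlonglongrightarrow> (\<integral>s. s powr (p / 2) \<partial>\<nu>)"
      by (rule lim[OF \<nu>])
    show "(\<lambda>m. \<Sum>i\<in>I. w i * (\<integral>s. (\<bar>s\<bar> + 1 / real (Suc m)) powr (p / 2) \<partial>\<mu> i))
        \<longlonglongrightarrow> (\<Sum>i\<in>I. w i * (\<integral>s. s powr (p / 2) \<partial>\<mu> i))"
      by (intro tendsto_intros lim[OF \<mu>])
    show "\<exists>N. \<forall>m\<ge>N. (\<integral>s. (\<bar>s\<bar> + 1 / real (Suc m)) powr (p / 2) \<partial>\<nu>)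
        \<le> (\<Sum>i\<in>I. w i * (\<integral>s. (\<bar>s\<bar> + 1 / real (Suc m)) powr (p / 2) \<partial>\<mu> i))"
      by (intro exI[of _ 0] allI impI jensen_smoothed[OF I w y p _ \<nu> \<mu>]) auto
  qed
qed

end

section \<open>Spectral distributions and norms\<close>

context
  fixes \<theta> :: "nat \<Rightarrow> nat \<Rightarrow> real" and n :: nat
begin

interpretation qm: linear "qmul \<theta> n a" for a by (rule linear_qmul)
interpretation qml: linear "\<lambda>a. qmul \<theta> n a b" for b by (rule linear_qmul_left)

abbreviation qpolynomial :: "mindex finsupp \<Rightarrow> bool" where
  "qpolynomial x \<equiv> qt_poly n (cf x)"

definition vanishes_above :: "mindex \<Rightarrow> bool" where
  "vanishes_above \<alpha> \<longleftrightarrow> (\<forall>i\<ge>n. \<alpha> i = 0)"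

lemma qpolynomial_iff: "qpolynomial x \<longleftrightarrow> (\<forall>\<alpha>. \<not> vanishes_above \<alpha> \<longrightarrow> cf x \<alpha> = 0)"
  unfolding qt_poly_def qt_supp_def vanishes_above_def[symmetric] by auto

lemma qt_polyE:
  assumes "qt_poly n f"
  obtains x where "f = cf x" "qpolynomial x"
proof -
  have "finite {\<alpha>. f \<alpha> \<noteq> 0}" using assms by (simp add: qt_poly_def qt_supp_def)
  then have "cf (Abs_finsupp f) = f" by (simp add: Abs_finsupp_inverse)
  with assms that[of "Abs_finsupp f"] show ?thesis by simp
qed

lemma qt_l2_cf: "qt_l2 (cf x) = norm x"
  by (simp only: qt_l2_def norm_eq_sqrt_inner[of x] inner_finsupp_def qt_supp_def power2_norm_eq_inner)

lemma qpolynomial_qone: "qpolynomial qone"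
  by (simp add: qpolynomial_iff cf_fsingle vanishes_above_def)

lemma qpolynomial_scaleR: "qpolynomial x \<Longrightarrow> qpolynomial (c *\<^sub>R x)"
  by (simp add: qpolynomial_iff)

lemma qpolynomial_modulate: "qpolynomial x \<Longrightarrow> qpolynomial (modulate g x)"
  by (simp add: qpolynomial_iff)

lemma qpolynomial_qstar:
  assumes "qpolynomial x"
  shows "qpolynomial (qstar \<theta> n x)"
  unfolding qpolynomial_iff
proof (intro allI impI)
  fix \<alpha> assume "\<not> vanishes_above \<alpha>"
  then have "\<not> vanishes_above (\<lambda>i. - \<alpha> i)" by (simp add: vanishes_above_def)
  with assms have "cf x (\<lambda>i. - \<alpha> i) = 0" by (simp add: qpolynomial_iff)
  then show "cf (qstar \<theta> n x) \<alpha> = 0" by (simp add: qstar.rep_eq qt_star_def)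
qed

lemma qpolynomial_qmul:
  assumes "qpolynomial x" "qpolynomial y"
  shows "qpolynomial (qmul \<theta> n x y)"
  unfolding qpolynomial_iff
proof (intro allI impI)
  fix \<gamma> assume \<gamma>: "\<not> vanishes_above \<gamma>"
  have "cf x \<alpha> * cf y (\<lambda>i. \<gamma> i - \<alpha> i) = 0" for \<alpha>
  proof (cases "vanishes_above \<alpha>")
    case True
    then have "\<not> vanishes_above (\<lambda>i. \<gamma> i - \<alpha> i)" using \<gamma> by (simp add: vanishes_above_def)
    then show ?thesis using assms(2) by (simp add: qpolynomial_iff)
  qed (use assms(1) in \<open>simp add: qpolynomial_iff\<close>)
  then show "cf (qmul \<theta> n x y) \<gamma> = 0" 
    unfolding qmul.rep_eq qt_mult_def by (intro sum.neutral) auto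
qed

section \<open>The operator norm on polynomials\<close>

abbreviation opnorm :: "mindex finsupp \<Rightarrow> real" where
  "opnorm x \<equiv> qt_norm_inf \<theta> n (cf x)"

lemma opnorm_altdef: "opnorm x = Sup {norm (qmul \<theta> n x \<xi>) | \<xi>. qpolynomial \<xi> \<and> norm \<xi> \<le> 1}"
proof -
  have "{qt_l2 (qt_mult \<theta> n (cf x) \<xi>) | \<xi>. qt_poly n \<xi> \<and> qt_l2 \<xi> \<le> 1}
     = {norm (qmul \<theta> n x \<xi>) | \<xi>. qpolynomial \<xi> \<and> norm \<xi> \<le> 1}" (is "?A = ?B")
  proof (rule set_eqI)
    fix r
    have "r \<in> ?A \<longleftrightarrow> (\<exists>\<xi>. r = qt_l2 (qt_mult \<theta> n (cf x) (cf \<xi>)) \<and> qpolynomial \<xi> \<and> qt_l2 (cf \<xi>) \<le> 1)"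
      by (blast elim: qt_polyE)
    then show "r \<in> ?A \<longleftrightarrow> r \<in> ?B"
      by (simp add: qt_l2_cf flip: qmul.rep_eq)
  qed
  then show ?thesis by (simp add: qt_norm_inf_def)
qed

lemma opnorm_bound1:
  assumes "qpolynomial \<xi>" "norm \<xi> \<le> 1"
  shows "norm (qmul \<theta> n x \<xi>) \<le> opnorm x"
proof -
  obtain K where K: "0 < K" "\<And>b. norm (qmul \<theta> n x b) \<le> K * norm b"
    using norm_qmul_bounded by blast
  have "norm (qmul \<theta> n x b) \<le> K" if "norm b \<le> 1" for b
    using order_trans[OF K(2) mult_left_mono[OF that less_imp_le[OF K(1)]]] by simp
  then have "bdd_above {norm (qmul \<theta> n x \<xi>) | \<xi>. qpolynomial \<xi> \<and> norm \<xi> \<le> 1}"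
    by (intro bdd_aboveI[of _ K]) auto
  then show ?thesis
    unfolding opnorm_altdef using assms by (intro cSup_upper) auto
qed

lemma opnorm_nonneg: "0 \<le> opnorm x"
  using opnorm_bound1[of 0 x] by (simp add: qpolynomial_iff qm.zero)

lemma opnorm_bound:
  assumes "qpolynomial \<xi>"
  shows "norm (qmul \<theta> n x \<xi>) \<le> opnorm x * norm \<xi>"
proof (cases "\<xi> = 0")
  case False
  have "norm (qmul \<theta> n x ((1 / norm \<xi>) *\<^sub>R \<xi>)) \<le> opnorm x"
    using False by (intro opnorm_bound1 qpolynomial_scaleR assms) auto
  then show ?thesis
    using False by (simp add: qm.scale field_simps)
qed (simp add: qm.zero)

lemma opnorm_least:
  assumes "\<And>\<xi>. qpolynomial \<xi> \<Longrightarrow> norm (qmul \<theta> n x \<xi>) \<le> K * norm \<xi>" "0 \<le> K"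
  shows "opnorm x \<le> K"
  unfolding opnorm_altdef
proof (rule cSup_least)
  show "{norm (qmul \<theta> n x \<xi>) |\<xi>. qpolynomial \<xi> \<and> norm \<xi> \<le> 1} \<noteq> {}"
    by (auto simp: qpolynomial_iff intro!: exI[of _ 0])
  fix r assume "r \<in> {norm (qmul \<theta> n x \<xi>) |\<xi>. qpolynomial \<xi> \<and> norm \<xi> \<le> 1}"
  then obtain \<xi> where \<xi>: "qpolynomial \<xi>" "norm \<xi> \<le> 1" "r = norm (qmul \<theta> n x \<xi>)" by blast
  have "r \<le> K * norm \<xi>" using assms(1)[OF \<xi>(1)] \<xi>(3) by simp
  also have "\<dots> \<le> K * 1" using \<xi>(2) assms(2) by (intro mult_left_mono)
  finally show "r \<le> K" by simp
qed

section \<open>Existence and uniqueness of the spectral distribution\<close>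

lemma inner_qone: "x \<bullet> qone = Re (cf x (\<lambda>_. 0))"
  by (subst inner_commute, subst inner_finsupp_superset[of "{\<lambda>_. 0}"])
    (auto simp: cf_fsingle inner_complex_def)

text \<open>Powers of x^* x are self-adjoint, so their coefficient at 0 is real and the real inner
  product loses nothing.\<close>

lemma qt_tau_eq_qmoment:
  "qt_tau (qt_pow \<theta> n (qt_mult \<theta> n (qt_star \<theta> n (cf x)) (cf x)) k) = complex_of_real (qmoment \<theta> n x k)"
proof -
  define u where "u = qmul \<theta> n (qstar \<theta> n x) x"
  define z where "z = (qmul \<theta> n u ^^ k) qone"
  have u: "qstar \<theta> n u = u" by (simp add: u_def qstar_qmul)
  have one: "qt_one = cf qone" by (simp add: fun_eq_iff cf_fsingle qt_one_def)
  have "qt_pow \<theta> n (cf u) k = cf z"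
    unfolding qt_pow_def z_def one by (induction k) (simp_all flip: qmul.rep_eq)
  moreover have "qstar \<theta> n z = z"
    unfolding z_def
  proof (induction k)
    case (Suc k)
    \<comment> \<open>The recursion multiplies by \<open>u\<close> on the left, its adjoint on the
      right; associativity lets \<open>u\<close> change sides.\<close>
    have "qmul \<theta> n ((qmul \<theta> n u ^^ k) qone) b = (qmul \<theta> n u ^^ k) b" for b
      by (induction k) (simp_all add: qmul_assoc)
    then show ?case using Suc by (simp add: qstar_qmul u) (simp add: funpow_swap1)
  qed simp
  then have "cnj (cf z (\<lambda>_. 0)) = cf z (\<lambda>_. 0)"
    using fun_cong[OF qstar.rep_eq, of \<theta> n z "\<lambda>_. 0"] by (simp add: qt_star_def qt_tw_eq_cis qt_form_simps)
  then have "complex_of_real (Re (cf z (\<lambda>_. 0))) = cf z (\<lambda>_. 0)"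
    by (simp add: complex_eq_iff)
  ultimately show ?thesis
    by (simp add: qt_tau_def qmoment_def inner_qone flip: z_def u_def qstar.rep_eq qmul.rep_eq)
qed

text \<open>\<open>opnorm\<close> controls x only on polynomials in the first n generators, whereas
  \<open>unit_op\<close> wants an operator on the whole type. Compression by the projection
  \<open>P\<close> onto these polynomials settles this and does not affect powers applied to
  \<open>qone\<close>.\<close>

lemma ex_moment_measure:
  assumes x: "qpolynomial x"
  shows "\<exists>\<mu>. moment_measure \<theta> n x \<mu> \<and> (AE s in \<mu>. s \<in> {0..(opnorm x)\<^sup>2})"
proof -
  define N where "N = opnorm x"
  have N: "0 \<le> N" by (simp add: N_def opnorm_nonneg)
  define P :: "mindex finsupp \<Rightarrow> mindex finsupp"
    where "P = modulate (\<lambda>\<alpha>. if vanishes_above \<alpha> then 1 else 0)"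
  have P: "qpolynomial (P \<xi>)" for \<xi>
    by (simp add: P_def qpolynomial_iff)
  have P_id: "P \<xi> = \<xi>" if "qpolynomial \<xi>" for \<xi>
    using that by (intro finsupp_eqI) (auto simp: P_def qpolynomial_iff)
  have P_sym: "P v \<bullet> w = v \<bullet> P w" for v w
    unfolding P_def inner_modulate by (rule arg_cong[where f = "\<lambda>g. v \<bullet> modulate g w"]) auto
  interpret P: linear P unfolding P_def by (rule linear_modulate)
  have P_le: "norm (P v) \<le> norm v" for v
  proof (cases "norm (P v) = 0")
    case False
    have "norm (P v) * norm (P v) = P v \<bullet> v"
      using P_sym[of "P v" v] P_id[OF P, of v] by (simp add: norm_eq_sqrt_inner)
    also have "\<dots> \<le> norm (P v) * norm v" by (rule norm_cauchy_schwarz)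
    finally show ?thesis using False by simp
  qed simp
  define u where "u = qmul \<theta> n (qstar \<theta> n x) x"
  define S where "S v = P (qmul \<theta> n u (P v))" for v
  have Sv: "S v \<bullet> w = qmul \<theta> n x (P v) \<bullet> qmul \<theta> n x (P w)" for v w
    by (simp add: S_def P_sym u_def qmul_assoc inner_qmul_left)
  have Sle: "norm (qmul \<theta> n x (P v)) \<le> N * norm v" for v
    using opnorm_bound[OF P[of v], of x] mult_left_mono[OF P_le[of v] N] by (simp add: N_def)
  have S0: "S v = 0" if "N = 0" for v
    using Sle[of v] that by (simp add: S_def u_def qmul_assoc qm.zero P.zero)
  \<comment> \<open>If N = 0, division by zero makes \<open>T\<close> zero, which is consistent
    because \<open>S\<close> vanishes too.\<close>
  define T where "T v = (1 / N\<^sup>2) *\<^sub>R S v" for v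
  have ST: "S v = N\<^sup>2 *\<^sub>R T v" for v
    using S0 by (cases "N = 0") (simp_all add: T_def)
  have "unit_op T"
  proof (rule unit_op.intro)
    show "linear T"
      by (auto simp: linear_iff T_def S_def P.add P.scale qm.add qm.scale scaleR_add_right)
    show "T v \<bullet> w = v \<bullet> T w" for v w
      using Sv[of v w] Sv[of w v] by (simp add: T_def inner_commute)
    show "0 \<le> T v \<bullet> v" for v
      by (simp add: T_def Sv)
    show "T v \<bullet> v \<le> v \<bullet> v" for v
    proof (cases "N = 0")
      case False
      have "S v \<bullet> v \<le> N\<^sup>2 * (v \<bullet> v)"
        using power_mono[OF Sle[of v], of 2] by (simp add: Sv power2_norm_eq_inner power_mult_distrib)
      then show ?thesis
        using False by (simp add: T_def field_simps)
    qed (simp add: T_def)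
  qed
  then obtain \<rho> where \<rho>: "spectral_measure T qone \<rho>"
    using unit_op.ex_spectral_measure norm_qone by blast
  interpret \<rho>: real_distribution \<rho> by (rule spectral_measureD[OF \<rho>])
  define \<mu> where "\<mu> = distr \<rho> borel (\<lambda>t. N\<^sup>2 * t)"
  have h: "(\<lambda>t. N\<^sup>2 * t) \<in> borel_measurable \<rho>" by simp
  have \<mu>: "real_distribution \<mu>"
    using \<rho>.prob_space_distr[OF h] by (simp add: \<mu>_def real_distribution_def real_distribution_axioms_def)
  have ae: "AE s in \<mu>. s \<in> {0..N\<^sup>2}"
  proof -
    have "AE t in \<rho>. N\<^sup>2 * t \<in> {0..N\<^sup>2}"
      using spectral_measureD(2)[OF \<rho>] by eventually_elim (auto intro: mult_left_le)
    then show ?thesis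
      unfolding \<mu>_def by (subst AE_distr_iff[OF h]) auto
  qed
  have "(\<integral>s. s ^ k \<partial>\<mu>) = qmoment \<theta> n x k" for k
  proof -
    have S_u: "S v = qmul \<theta> n u v" if "qpolynomial v" for v
      using that x by (simp add: S_def P_id u_def qpolynomial_qmul qpolynomial_qstar)
    have poly: "qpolynomial ((qmul \<theta> n u ^^ k) qone)" for k
      by (induction k) (simp_all add: qpolynomial_qone qpolynomial_qmul u_def qpolynomial_qstar x)
    interpret T: unit_op T by fact
    have pow: "(qmul \<theta> n u ^^ k) qone = (N\<^sup>2) ^ k *\<^sub>R (T ^^ k) qone" for k
    proof (induction k)
      case (Suc k)
      have "(qmul \<theta> n u ^^ Suc k) qone = N\<^sup>2 *\<^sub>R T ((qmul \<theta> n u ^^ k) qone)"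
        using S_u[OF poly] by (simp add: ST)
      then show ?case
        unfolding Suc by (simp add: linear_scale[OF T.lin])
    qed simp
    have "(\<integral>s. s ^ k \<partial>\<mu>) = (\<integral>t. (N\<^sup>2 * t) ^ k \<partial>\<rho>)"
      unfolding \<mu>_def by (intro integral_distr h) simp
    also have "\<dots> = (\<integral>t. poly (monom ((N\<^sup>2) ^ k) k) t \<partial>\<rho>)"
      by (simp add: poly_monom power_mult_distrib)
    also have "\<dots> = (N\<^sup>2) ^ k * ((T ^^ k) qone \<bullet> qone)"
      unfolding spectral_measureD(3)[OF \<rho>] by (simp add: peval_monom)
    also have "\<dots> = qmoment \<theta> n x k"
      by (simp add: qmoment_def pow flip: u_def)
    finally show ?thesis .
  qed
  with \<mu> ae show ?thesis
    unfolding moment_measure_def N_def[symmetric] by blast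
qed

text \<open>Certifies the definite description: existence from \<open>ex_moment_measure\<close>,
  uniqueness from compact support.\<close>

lemma moment_measure_qt_spec:
  assumes x: "qpolynomial x"
  shows "moment_measure \<theta> n x (qt_spec \<theta> n (cf x))"
proof -
  obtain \<mu> where \<mu>: "moment_measure \<theta> n x \<mu>" and ae: "AE s in \<mu>. s \<in> {0..(opnorm x)\<^sup>2}"
    using ex_moment_measure[OF x] by blast
  have dist: "real_distribution \<mu>" and mom: "\<And>k. (\<integral>s. s ^ k \<partial>\<mu>) = qmoment \<theta> n x k"
    using \<mu> unfolding moment_measure_def by blast+
  interpret \<mu>: real_distribution \<mu> by (rule dist)
  have "qt_spec \<theta> n (cf x) = \<mu>"
    unfolding qt_spec_def
  proof (rule the_equality)
    have "integrable \<mu> (\<lambda>s. s ^ k)" for k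
      by (rule \<mu>.integrable_cont_ae_bounded[OF _ ae]) (intro continuous_intros)
    then show "sets \<mu> = sets borel \<and> emeasure \<mu> (space \<mu>) = 1 \<and>
      (AE s in \<mu>. 0 \<le> s \<and> s \<le> (opnorm x)\<^sup>2) \<and> (\<forall>k::nat. integrable \<mu> (\<lambda>s. s ^ k) \<and>
         complex_of_real (\<integral>s. s ^ k \<partial>\<mu>) =
           qt_tau (qt_pow \<theta> n (qt_mult \<theta> n (qt_star \<theta> n (cf x)) (cf x)) k))"
      using ae by (simp only: qt_tau_eq_qmoment mom \<mu>.emeasure_space_1 atLeastAtMost_iff) simp
  next
    fix \<nu> :: "real measure"
    assume \<nu>: "sets \<nu> = sets borel \<and> emeasure \<nu> (space \<nu>) = 1 \<and>
      (AE s in \<nu>. 0 \<le> s \<and> s \<le> (opnorm x)\<^sup>2) \<and> (\<forall>k::nat. integrable \<nu> (\<lambda>s. s ^ k) \<and>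
         complex_of_real (\<integral>s. s ^ k \<partial>\<nu>) =
           qt_tau (qt_pow \<theta> n (qt_mult \<theta> n (qt_star \<theta> n (cf x)) (cf x)) k))"
    have dist\<nu>: "real_distribution \<nu>"
      using \<nu> by (auto simp: real_distribution_def real_distribution_axioms_def intro: prob_spaceI)
    have mom\<nu>: "(\<integral>s. s ^ k \<partial>\<nu>) = qmoment \<theta> n x k" for k
      using \<nu> by (simp only: qt_tau_eq_qmoment of_real_eq_iff)
    have ae\<nu>: "AE s in \<nu>. 0 \<le> s \<and> s \<le> (opnorm x)\<^sup>2"
      using \<nu> by blast
    show "\<nu> = \<mu>"
    proof (rule measure_eq_of_moments_eq[OF dist\<nu> dist])
      show "AE s in \<nu>. s \<in> {- (opnorm x)\<^sup>2..(opnorm x)\<^sup>2}"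
        using ae\<nu> by eventually_elim (auto intro: order_trans[of _ 0])
      show "AE s in \<mu>. s \<in> {- (opnorm x)\<^sup>2..(opnorm x)\<^sup>2}"
        using ae by eventually_elim (auto intro: order_trans[of _ 0])
      show "(\<integral>s. s ^ k \<partial>\<nu>) = (\<integral>s. s ^ k \<partial>\<mu>)" for k
        by (simp only: mom\<nu> mom)
    qed
  qed
  with \<mu> show ?thesis by simp
qed

lemma moment_measure_unique:
  assumes "moment_measure \<theta> n x \<mu>" "moment_measure \<theta> n y \<nu>" "\<And>k. qmoment \<theta> n x k = qmoment \<theta> n y k"
  shows "\<mu> = \<nu>"
proof -
  obtain C C' where C: "AE s in \<mu>. s \<in> {0..C}" "AE s in \<nu>. s \<in> {0..C'}"
    using assms(1,2) unfolding moment_measure_def by blast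
  define K where "K = max \<bar>C\<bar> \<bar>C'\<bar>"
  show ?thesis
  proof (rule measure_eq_of_moments_eq)
    show "AE s in \<mu>. s \<in> {-K..K}" using C(1) by eventually_elim (auto simp: K_def)
    show "AE s in \<nu>. s \<in> {-K..K}" using C(2) by eventually_elim (auto simp: K_def)
    show "real_distribution \<mu>" "real_distribution \<nu>" and "(\<integral>s. s ^ k \<partial>\<mu>) = (\<integral>s. s ^ k \<partial>\<nu>)" for k
      using assms unfolding moment_measure_def by auto
  qed
qed

lemma qmoment_scaleR: "qmoment \<theta> n (c *\<^sub>R x) k = (c\<^sup>2) ^ k * qmoment \<theta> n x k"
proof -
  define u where "u = qmul \<theta> n (qstar \<theta> n x) x"
  have "qmul \<theta> n (qstar \<theta> n (c *\<^sub>R x)) (c *\<^sub>R x) = c\<^sup>2 *\<^sub>R u"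
    by (simp add: linear_scale[OF linear_qstar] qml.scale qm.scale u_def power2_eq_square)
  moreover have "(qmul \<theta> n (r *\<^sub>R u) ^^ k) qone = r ^ k *\<^sub>R (qmul \<theta> n u ^^ k) qone" for r
    by (induction k) (simp_all add: qml.scale qm.scale)
  ultimately show ?thesis
    by (simp add: qmoment_def flip: u_def)
qed

text \<open>For finite p the spectral distribution of c x is the image of that of x under s to c^2
  s, by comparison of moments.\<close>

lemma qt_norm_scaleR_le:
  assumes x: "qpolynomial x" and c: "0 \<le> c" and p: "1 \<le> p"
  shows "qt_norm \<theta> n p (cf (c *\<^sub>R x)) \<le> c * qt_norm \<theta> n p (cf x)"
proof (cases "p = \<infinity>")
  case True
  have "norm (qmul \<theta> n (c *\<^sub>R x) \<xi>) \<le> (c * opnorm x) * norm \<xi>" if "qpolynomial \<xi>" for \<xi>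
    using mult_left_mono[OF opnorm_bound[OF that, of x] c] c by (simp add: qml.scale mult.assoc)
  then have "opnorm (c *\<^sub>R x) \<le> c * opnorm x"
    by (rule opnorm_least[OF _ mult_nonneg_nonneg[OF c opnorm_nonneg]])
  then show ?thesis using True by (simp add: qt_norm_def)
next
  case False
  define q where "q = real_of_ereal p"
  have q: "1 \<le> q" using p False by (cases p) (auto simp: q_def one_ereal_def)
  define \<mu> where "\<mu> = qt_spec \<theta> n (cf x)"
  have mm: "moment_measure \<theta> n x \<mu>"
    unfolding \<mu>_def by (rule moment_measure_qt_spec[OF x])
  obtain C where dist: "real_distribution \<mu>" and ae: "AE s in \<mu>. s \<in> {0..C}"
    and mom: "\<And>k. (\<integral>s. s ^ k \<partial>\<mu>) = qmoment \<theta> n x k"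
    using mm unfolding moment_measure_def by blast
  interpret \<mu>: real_distribution \<mu> by (rule dist)
  define \<nu> where "\<nu> = distr \<mu> borel (\<lambda>s. c\<^sup>2 * s)"
  have h: "(\<lambda>s. c\<^sup>2 * s) \<in> borel_measurable \<mu>" by simp
  have "moment_measure \<theta> n (c *\<^sub>R x) \<nu>"
    unfolding moment_measure_def
  proof (intro conjI allI exI)
    show "real_distribution \<nu>"
      using \<mu>.prob_space_distr[OF h] by (simp add: \<nu>_def real_distribution_def real_distribution_axioms_def)
    have "AE s in \<mu>. c\<^sup>2 * s \<in> {0..c\<^sup>2 * C}"
      using ae by eventually_elim (auto intro: mult_left_mono)
    then show "AE s in \<nu>. s \<in> {0..c\<^sup>2 * C}"
      unfolding \<nu>_def by (subst AE_distr_iff[OF h]) auto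
    fix k
    have "(\<integral>s. s ^ k \<partial>\<nu>) = (\<integral>s. (c\<^sup>2 * s) ^ k \<partial>\<mu>)"
      unfolding \<nu>_def by (intro integral_distr h) simp
    then show "(\<integral>s. s ^ k \<partial>\<nu>) = qmoment \<theta> n (c *\<^sub>R x) k"
      by (simp only: qmoment_scaleR power_mult_distrib integral_mult_right_zero mom)
  qed
  then have "qt_spec \<theta> n (cf (c *\<^sub>R x)) = \<nu>"
    by (rule moment_measure_unique[OF moment_measure_qt_spec[OF qpolynomial_scaleR[OF x]] _ refl])
  moreover have "(\<integral>s. s powr (q / 2) \<partial>\<nu>) = (\<integral>s. (c\<^sup>2 * s) powr (q / 2) \<partial>\<mu>)"
    unfolding \<nu>_def by (intro integral_distr h) simp
  moreover have "\<dots> = (\<integral>s. c powr q * s powr (q / 2) \<partial>\<mu>)"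
  proof (rule integral_cong_AE)
    have "(c\<^sup>2) powr (q / 2) = c powr q"
      using c by (cases "c = 0") (simp_all add: powr_powr flip: powr_numeral)
    then show "AE s in \<mu>. (c\<^sup>2 * s) powr (q / 2) = c powr q * s powr (q / 2)"
      using ae by (auto elim!: eventually_mono simp: powr_mult)
  qed simp_all
  moreover have "\<dots> = c powr q * (\<integral>s. s powr (q / 2) \<partial>\<mu>)"
    by simp
  moreover have "0 \<le> (\<integral>s. s powr (q / 2) \<partial>\<mu>)"
    by simp
  then have "(c powr q * (\<integral>s. s powr (q / 2) \<partial>\<mu>)) powr (1 / q) = c * (\<integral>s. s powr (q / 2) \<partial>\<mu>) powr (1 / q)"
    using c q by (simp add: powr_mult powr_powr)
  ultimately show ?thesis
    using False by (simp only: qt_norm_def if_False flip: q_def \<mu>_def)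
qed

text \<open>Unitary characters of the index group. Modulation by one of them is an automorphism from
  the dual action of the torus.\<close>

definition qcharacter :: "(mindex \<Rightarrow> complex) \<Rightarrow> bool" where
  "qcharacter \<kappa> \<longleftrightarrow> (\<forall>\<alpha> \<beta>. \<kappa> (\<lambda>i. \<alpha> i + \<beta> i) = \<kappa> \<alpha> * \<kappa> \<beta>) \<and> (\<forall>\<alpha>. cmod (\<kappa> \<alpha>) = 1)"

context
  fixes \<kappa> assumes \<kappa>: "qcharacter \<kappa>"
begin

lemma qcharacter_add: "\<kappa> (\<lambda>i. \<alpha> i + \<beta> i) = \<kappa> \<alpha> * \<kappa> \<beta>"
  using \<kappa> unfolding qcharacter_def by blast

lemma cmod_qcharacter: "cmod (\<kappa> \<alpha>) = 1"
  using \<kappa> unfolding qcharacter_def by blast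

lemma qcharacter_zero: "\<kappa> (\<lambda>_. 0) = 1"
proof -
  have "\<kappa> (\<lambda>_. 0) = \<kappa> (\<lambda>_. 0) * \<kappa> (\<lambda>_. 0)"
    using qcharacter_add[of "\<lambda>_. 0" "\<lambda>_. 0"] by simp
  moreover have "\<kappa> (\<lambda>_. 0) \<noteq> 0"
    using cmod_qcharacter[of "\<lambda>_. 0"] by auto
  ultimately show ?thesis by simp
qed

lemma qcharacter_cnj_mult: "cnj (\<kappa> \<alpha>) * \<kappa> \<alpha> = 1"
  using complex_norm_square[of "\<kappa> \<alpha>"] by (simp add: cmod_qcharacter mult.commute)

lemma qcharacter_minus: "\<kappa> (\<lambda>i. - \<alpha> i) = cnj (\<kappa> \<alpha>)"
proof -
  have "\<kappa> (\<lambda>i. - \<alpha> i) * \<kappa> \<alpha> = cnj (\<kappa> \<alpha>) * \<kappa> \<alpha>"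
    using qcharacter_add[of "\<lambda>i. - \<alpha> i" \<alpha>] by (simp add: qcharacter_zero qcharacter_cnj_mult)
  moreover have "\<kappa> \<alpha> \<noteq> 0"
    using cmod_qcharacter[of \<alpha>] by auto
  ultimately show ?thesis by simp
qed

lemma modulate_qmul: "modulate \<kappa> (qmul \<theta> n a b) = qmul \<theta> n (modulate \<kappa> a) (modulate \<kappa> b)"
proof (induction a rule: finsupp_induct)
  case (single \<alpha> a)
  show ?case
  proof (induction b rule: finsupp_induct)
    case (single \<beta> b)
    show ?case
      by (simp add: qmul_fsingle modulate_fsingle qcharacter_add mult_ac)
  qed (simp add: qmul_add_right linear_add[OF linear_modulate])
qed (simp add: qmul_add_left linear_add[OF linear_modulate])

lemma modulate_qstar: "modulate \<kappa> (qstar \<theta> n a) = qstar \<theta> n (modulate \<kappa> a)"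
  by (rule finsupp_eqI) (simp add: qstar.rep_eq qt_star_def qcharacter_minus)

lemma modulate_qone: "modulate \<kappa> qone = qone"
  by (simp add: modulate_fsingle qcharacter_zero)

lemma norm_modulate: "norm (modulate \<kappa> a) = norm a"
proof -
  have "modulate (\<lambda>\<alpha>. cnj (\<kappa> \<alpha>)) (modulate \<kappa> a) = a"
    by (rule finsupp_eqI) (simp add: qcharacter_cnj_mult flip: mult.assoc)
  then show ?thesis
    by (simp add: norm_eq_sqrt_inner inner_modulate)
qed

context
  fixes z assumes z: "cmod z = 1"
begin

text \<open>The scalar z cancels in x^* x, and the automorphism fixes the coefficient at 0.\<close>

lemma qmoment_rotate: "qmoment \<theta> n (modulate (\<lambda>_. z) (modulate \<kappa> x)) k = qmoment \<theta> n x k"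
proof -
  define u where "u = qmul \<theta> n (qstar \<theta> n x) x"
  define x' where "x' = modulate \<kappa> x"
  have "modulate (\<lambda>_. z) (modulate (\<lambda>_. cnj z) a) = a" for a :: "mindex finsupp"
    using z by (intro finsupp_eqI) (simp add: complex_norm_square[symmetric] flip: mult.assoc)
  then have "qmul \<theta> n (qstar \<theta> n (modulate (\<lambda>_. z) x')) (modulate (\<lambda>_. z) x') = qmul \<theta> n (qstar \<theta> n x') x'"
    by (simp add: qstar_modulate_const qmul_modulate_const)
  also have "\<dots> = modulate \<kappa> u"
    by (simp add: x'_def u_def modulate_qmul modulate_qstar)
  finally have eq: "qmul \<theta> n (qstar \<theta> n (modulate (\<lambda>_. z) x')) (modulate (\<lambda>_. z) x') = modulate \<kappa> u" .
  have "(qmul \<theta> n (modulate \<kappa> u) ^^ k) qone = modulate \<kappa> ((qmul \<theta> n u ^^ k) qone)"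
    by (induction k) (simp_all add: modulate_qone modulate_qmul)
  then show ?thesis
    unfolding qmoment_def x'_def[symmetric] eq by (simp add: inner_qone qcharacter_zero flip: u_def)
qed

text \<open>Writing \<xi> as the rotation of its inverse rotation moves the automorphism outside the
  product, where it is isometric.\<close>

lemma norm_qmul_rotate:
  assumes "qpolynomial \<xi>"
  shows "norm (qmul \<theta> n (modulate (\<lambda>_. z) (modulate \<kappa> x)) \<xi>) \<le> opnorm x * norm \<xi>"
proof -
  have inv: "modulate \<kappa> (modulate (\<lambda>\<alpha>. cnj (\<kappa> \<alpha>)) \<xi>) = \<xi>"
    using qcharacter_cnj_mult by (intro finsupp_eqI) (simp add: mult.commute[of "\<kappa> _" "cnj _"] flip: mult.assoc)
  have "norm (modulate (\<lambda>_. z) a) = norm a" for a :: "mindex finsupp"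
  proof -
    have "modulate (\<lambda>_. cnj z) (modulate (\<lambda>_. z) a) = a"
      using z by (intro finsupp_eqI) (simp add: complex_norm_square[symmetric] mult.commute[of "cnj z"] flip: mult.assoc)
    then show ?thesis
      by (simp add: norm_eq_sqrt_inner inner_modulate)
  qed
  then have "norm (qmul \<theta> n (modulate (\<lambda>_. z) (modulate \<kappa> x)) \<xi>) = norm (qmul \<theta> n (modulate \<kappa> x) (modulate \<kappa> (modulate (\<lambda>\<alpha>. cnj (\<kappa> \<alpha>)) \<xi>)))"
    by (simp add: qmul_modulate_const inv)
  also have "\<dots> = norm (qmul \<theta> n x (modulate (\<lambda>\<alpha>. cnj (\<kappa> \<alpha>)) \<xi>))"
    by (simp add: norm_modulate flip: modulate_qmul)
  also have "\<dots> \<le> opnorm x * norm (modulate (\<lambda>\<alpha>. cnj (\<kappa> \<alpha>)) \<xi>)"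
    by (intro opnorm_bound qpolynomial_modulate assms)
  also have "norm (modulate (\<lambda>\<alpha>. cnj (\<kappa> \<alpha>)) \<xi>) = norm \<xi>"
    using norm_modulate[of "modulate (\<lambda>\<alpha>. cnj (\<kappa> \<alpha>)) \<xi>"] by (simp add: inv)
  finally show ?thesis .
qed

end

end

text \<open>For infinite p this is the triangle inequality. For finite p every summand has the
  spectral distribution of x, so the right-hand side of Jensen's inequality collapses to one
  integral.\<close>

lemma qt_norm_average_le:
  assumes I: "finite I" and w: "\<And>i. i \<in> I \<Longrightarrow> 0 \<le> w i" "(\<Sum>i\<in>I. w i) = 1"
    and \<kappa>: "\<And>i. i \<in> I \<Longrightarrow> qcharacter (\<kappa> i)" and z: "\<And>i. i \<in> I \<Longrightarrow> cmod (z i) = 1"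
    and x: "qpolynomial x" and p: "1 \<le> p"
    and y: "y = (\<Sum>i\<in>I. w i *\<^sub>R modulate (\<lambda>_. z i) (modulate (\<kappa> i) x))"
  shows "qt_norm \<theta> n p (cf y) \<le> qt_norm \<theta> n p (cf x)"
proof (cases "p = \<infinity>")
  case True
  have "opnorm y \<le> opnorm x"
  proof (rule opnorm_least)
    fix \<xi> assume \<xi>: "qpolynomial \<xi>"
    have "norm (qmul \<theta> n y \<xi>) \<le> (\<Sum>i\<in>I. norm (w i *\<^sub>R qmul \<theta> n (modulate (\<lambda>_. z i) (modulate (\<kappa> i) x)) \<xi>))"
      unfolding y by (simp only: qml.sum qml.scale norm_sum)
    also have "\<dots> \<le> (\<Sum>i\<in>I. w i * (opnorm x * norm \<xi>))"
      using w \<kappa> z \<xi> by (intro sum_mono) (auto intro!: mult_left_mono norm_qmul_rotate)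
    also have "\<dots> = opnorm x * norm \<xi>"
      by (simp add: w flip: sum_distrib_right)
    finally show "norm (qmul \<theta> n y \<xi>) \<le> opnorm x * norm \<xi>" .
  qed (rule opnorm_nonneg)
  then show ?thesis using True by (simp add: qt_norm_def)
next
  case False
  define q where "q = real_of_ereal p"
  have q: "1 \<le> q" using p False by (cases p) (auto simp: q_def one_ereal_def)
  define \<mu> where "\<mu> = qt_spec \<theta> n (cf x)"
  have mm: "moment_measure \<theta> n x \<mu>"
    unfolding \<mu>_def by (rule moment_measure_qt_spec[OF x])
  have mmi: "moment_measure \<theta> n (modulate (\<lambda>_. z i) (modulate (\<kappa> i) x)) \<mu>" if "i \<in> I" for i
    using mm \<kappa>[OF that] z[OF that] by (simp add: moment_measure_def qmoment_rotate)
  have "qpolynomial y"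
    using x by (auto simp: qpolynomial_iff y cf_sum)
  then have mmy: "moment_measure \<theta> n y (qt_spec \<theta> n (cf y))"
    by (rule moment_measure_qt_spec)
  have "(\<integral>s. s powr (q / 2) \<partial>qt_spec \<theta> n (cf y)) \<le> (\<Sum>i\<in>I. w i * (\<integral>s. s powr (q / 2) \<partial>\<mu>))"
    by (rule jensen_trace_powr[OF I w y q mmy mmi])
  also have "\<dots> = (\<integral>s. s powr (q / 2) \<partial>\<mu>)"
    by (simp add: w flip: sum_distrib_right)
  finally have "(\<integral>s. s powr (q / 2) \<partial>qt_spec \<theta> n (cf y)) powr (1 / q) \<le> (\<integral>s. s powr (q / 2) \<partial>\<mu>) powr (1 / q)"
    using q by (intro powr_mono2) auto
  then show ?thesis
    using False by (simp only: qt_norm_def if_False q_def \<mu>_def)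
qed

end

section \<open>Positive definite multipliers\<close>

lemma sum_cis_roots_of_unity:
  fixes N :: nat and m :: int
  assumes N: "0 < N"
  shows "(\<Sum>s<N. cis (2 * pi * real s * of_int m / real N)) = (if int N dvd m then of_nat N else 0)"
proof -
  define \<omega> where "\<omega> = cis (2 * pi * of_int m / real N)"
  have pow: "cis (2 * pi * real s * of_int m / real N) = \<omega> ^ s" for s
  proof -
    have "\<omega> ^ s = cis (real s * (2 * pi * of_int m / real N))"
      by (simp only: \<omega>_def Complex.DeMoivre)
    also have "real s * (2 * pi * of_int m / real N) = 2 * pi * real s * of_int m / real N"
      by simp
    finally show ?thesis ..
  qed
  have "\<omega> ^ N = cis (2 * pi * of_int m)"
    unfolding \<omega>_def Complex.DeMoivre using N by simp
  then have \<omega>N: "\<omega> ^ N = 1" by (simp add: cis_multiple_2pi)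
  have "\<omega> = 1 \<longleftrightarrow> int N dvd m"
  proof
    assume "\<omega> = 1"
    then have "cos (2 * pi * of_int m / real N) = 1"
      by (metis \<omega>_def cis.sel(1) one_complex.sel(1))
    then obtain k :: int where "2 * pi * of_int m / real N = of_int k * (2 * pi)"
      by (auto simp: cos_one_2pi_int)
    then have "of_int m = (of_int k * real N :: real)"
      using N by (simp add: field_simps)
    then have "m = k * int N"
      by (metis of_int_eq_iff of_int_mult of_int_of_nat_eq)
    then show "int N dvd m" by simp
  next
    assume "int N dvd m"
    then obtain k where "m = int N * k" by blast
    then have "2 * pi * of_int m / real N = 2 * pi * of_int k"
      using N by simp
    then show "\<omega> = 1" by (simp add: \<omega>_def cis_multiple_2pi)
  qed
  then show ?thesis
    using sum_gp_strict[of \<omega> N] by (simp add: pow \<omega>N)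
qed

text \<open>A finite form of Herglotz's theorem: on the window |m| \<le> D the even extension of
  \<open>c\<close> is the Fourier transform of nonnegative weights on the roots of unity of order 2
  D + 1, the number of integers in the window.\<close>

definition pd_multiplier :: "nat \<Rightarrow> (nat \<Rightarrow> real) \<Rightarrow> bool" where
  "pd_multiplier D c \<longleftrightarrow> (\<exists>w. (\<forall>s<2 * D + 1. 0 \<le> w s) \<and>
     (\<forall>m::int. \<bar>m\<bar> \<le> int D \<longrightarrow>
       (\<Sum>s<2 * D + 1. complex_of_real (w s) * cis (2 * pi * real s * of_int m / real (2 * D + 1)))
         = complex_of_real (c (nat \<bar>m\<bar>))))"

lemma pd_multiplier_combination:
  assumes "pd_multiplier D c" "pd_multiplier D c'" "0 \<le> a"
  shows "pd_multiplier D (\<lambda>j. c j + a * c' j)"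
proof -
  obtain w where w: "\<forall>s<2 * D + 1. 0 \<le> w s" "\<And>m::int. \<bar>m\<bar> \<le> int D \<Longrightarrow>
       (\<Sum>s<2 * D + 1. complex_of_real (w s) * cis (2 * pi * real s * of_int m / real (2 * D + 1))) = complex_of_real (c (nat \<bar>m\<bar>))"
    using assms(1) unfolding pd_multiplier_def by blast
  obtain w' where w': "\<forall>s<2 * D + 1. 0 \<le> w' s" "\<And>m::int. \<bar>m\<bar> \<le> int D \<Longrightarrow>
       (\<Sum>s<2 * D + 1. complex_of_real (w' s) * cis (2 * pi * real s * of_int m / real (2 * D + 1))) = complex_of_real (c' (nat \<bar>m\<bar>))"
    using assms(2) unfolding pd_multiplier_def by blast
  have eq: "(\<Sum>s<2 * D + 1. complex_of_real (w s + a * w' s) * cis (2 * pi * real s * of_int m / real (2 * D + 1)))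
      = complex_of_real (c (nat \<bar>m\<bar>) + a * c' (nat \<bar>m\<bar>))" if "\<bar>m\<bar> \<le> int D" for m
    unfolding of_real_add of_real_mult w(2)[OF that, symmetric] w'(2)[OF that, symmetric]
    by (simp only: distrib_right sum.distrib sum_distrib_left mult.assoc)
  show ?thesis
    unfolding pd_multiplier_def
  proof (intro exI[of _ "\<lambda>s. w s + a * w' s"] conjI allI impI)
    show "0 \<le> w s + a * w' s" if "s < 2 * D + 1" for s
      using w(1) w'(1) assms(3) that by simp
  qed (rule eq)
qed

lemma pd_multiplier_const:
  assumes "0 \<le> a"
  shows "pd_multiplier D (\<lambda>_. a)"
  unfolding pd_multiplier_def
proof (intro exI[of _ "\<lambda>s. if s = 0 then a else 0"] conjI allI impI)
  fix m :: int
  have "(\<Sum>s<2 * D + 1. complex_of_real (if s = 0 then a else 0) * cis (2 * pi * real s * of_int m / real (2 * D + 1)))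
     = (\<Sum>s\<in>{0}. complex_of_real (if s = 0 then a else 0) * cis (2 * pi * real s * of_int m / real (2 * D + 1)))"
    by (intro sum.mono_neutral_right) auto
  then show "(\<Sum>s<2 * D + 1. complex_of_real (if s = 0 then a else 0) * cis (2 * pi * real s * of_int m / real (2 * D + 1)))
     = complex_of_real a"
    by simp
qed (use assms in auto)

text \<open>The overlap of an interval of K integers with its shift by m, the origin of the
  triangle.\<close>

lemma card_differences:
  fixes K :: nat and m :: int
  shows "card {(i, j). i < K \<and> j < K \<and> int i - int j = m} = nat (int K - \<bar>m\<bar>)"
proof (cases "0 \<le> m")
  case True
  have "{(i, j). i < K \<and> j < K \<and> int i - int j = m} = (\<lambda>j. (j + nat m, j)) ` {..<K - nat m}"
    using True by (auto simp: image_iff)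
  moreover have "inj_on (\<lambda>j. (j + nat m, j)) {..<K - nat m}"
    by (auto simp: inj_on_def)
  ultimately show ?thesis
    using True by (simp add: card_image)
next
  case False
  have "{(i, j). i < K \<and> j < K \<and> int i - int j = m} = (\<lambda>i. (i, i + nat (-m))) ` {..<K - nat (-m)}"
    using False by (auto simp: image_iff)
  moreover have "inj_on (\<lambda>i. (i, i + nat (-m))) {..<K - nat (-m)}"
    by (auto simp: inj_on_def)
  ultimately show ?thesis
    using False by (simp add: card_image)
qed

text \<open>The Fejer kernel, sampled at roots of unity.\<close>

lemma pd_multiplier_triangle:
  assumes K: "K \<le> D"
  shows "pd_multiplier D (\<lambda>j. real (K - j))"
proof -
  define N where "N = 2 * D + 1"
  have N: "0 < N" by (simp add: N_def)
  define e where "e s m = cis (2 * pi * real s * of_int m / real N)" for s and m :: int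
  have e_mult: "e s m * e s m' = e s (m + m')" and e_cnj: "cnj (e s m) = e s (- m)" for s m m'
    by (simp_all add: e_def cis_mult cis_cnj add_divide_distrib algebra_simps)
  \<comment> \<open>A Dirichlet sum; its squared modulus gives nonnegative weights.\<close>
  define F where "F s = (\<Sum>i<K. e s (- int i))" for s
  define w where "w s = (cmod (F s))\<^sup>2 / real N" for s
  have wF: "complex_of_real (w s) = (\<Sum>(i, j)\<in>{..<K} \<times> {..<K}. e s (int j - int i)) / of_nat N" for s
  proof -
    have "complex_of_real (w s) = F s * cnj (F s) / of_nat N"
      unfolding w_def of_real_divide complex_norm_square by simp
    also have "F s * cnj (F s) = (\<Sum>i<K. \<Sum>j<K. e s (int j - int i))"
      by (simp add: F_def cnj_sum e_cnj sum_product e_mult)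
    finally show ?thesis by (simp add: sum.cartesian_product)
  qed
  have "(\<Sum>s<N. complex_of_real (w s) * e s m) = complex_of_real (real (K - nat \<bar>m\<bar>))" if m: "\<bar>m\<bar> \<le> int D" for m
  proof -
    have "(\<Sum>s<N. complex_of_real (w s) * e s m) = (\<Sum>s<N. \<Sum>(i, j)\<in>{..<K} \<times> {..<K}. e s (m + int j - int i) / of_nat N)"
      unfolding wF case_prod_unfold sum_divide_distrib sum_distrib_right
      by (intro sum.cong refl) (simp add: e_mult algebra_simps)
    also have "\<dots> = (\<Sum>(i, j)\<in>{..<K} \<times> {..<K}. (\<Sum>s<N. e s (m + int j - int i)) / of_nat N)"
      by (subst sum.swap) (simp add: case_prod_unfold sum_divide_distrib)
    also have "\<dots> = (\<Sum>(i, j)\<in>{..<K} \<times> {..<K}. if int i - int j = m then 1 else 0)"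
    proof -
      have "(\<Sum>s<N. e s (m + int j - int i)) / of_nat N = (if int i - int j = m then 1 else 0)"
        if ij: "i < K" "j < K" for i j
      proof -
        \<comment> \<open>No aliasing: |m| \<le> D and |j - i| < K \<le> D keep the frequency below
          N, so only frequency 0 survives.\<close>
        have "\<bar>m + int j - int i\<bar> < int N"
          using ij m K by (auto simp: N_def)
        then have "int N dvd m + int j - int i \<longleftrightarrow> m + int j - int i = 0"
          using dvd_imp_le_int[of "m + int j - int i" "int N"] by force
        also have "\<dots> \<longleftrightarrow> int i - int j = m"
          by linarith
        finally show ?thesis
          unfolding e_def sum_cis_roots_of_unity[OF N] using N by simp
      qed
      then show ?thesis
        by (intro sum.cong refl) auto
    qed
    also have "\<dots> = of_nat (card {(i, j). i < K \<and> j < K \<and> int i - int j = m})"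
    proof -
      have "{p \<in> {..<K} \<times> {..<K}. int (fst p) - int (snd p) = m} = {(i, j). i < K \<and> j < K \<and> int i - int j = m}"
        by auto
      then show ?thesis
        by (simp add: case_prod_unfold flip: sum.inter_filter)
    qed
    finally show ?thesis
      unfolding card_differences by (simp add: nat_diff_distrib')
  qed
  then show ?thesis
    unfolding pd_multiplier_def N_def[symmetric] e_def by (intro exI[of _ w]) (auto simp: w_def)
qed

text \<open>Such a sequence is a constant plus a nonnegative combination of triangles; the induction
  peels off the widest one.\<close>

lemma pd_multiplier_eventually_const:
  assumes "K \<le> D" "\<And>j. 2 * c (Suc j) \<le> c j + c (Suc (Suc j))" "\<And>j. K \<le> j \<Longrightarrow> c j = c K" "0 \<le> c K"
  shows "pd_multiplier D c"
  using assms
proof (induction K arbitrary: c)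
  case 0
  have "c 0 = c j" for j
    by (rule 0(3)[symmetric]) simp
  then have "(\<lambda>_. c 0) = c"
    by (rule ext)
  with pd_multiplier_const[OF 0(4), of D] show ?case
    by (simp only:)
next
  case (Suc K)
  \<comment> \<open>The last drop before the constant part, nonnegative by convexity at K.\<close>
  define a where "a = c K - c (Suc K)"
  have c2: "c (Suc (Suc K)) = c (Suc K)" using Suc.prems(3)[of "Suc (Suc K)"] by simp
  have a: "0 \<le> a" using Suc.prems(2)[of K] c2 by (simp add: a_def)
  \<comment> \<open>The truncated difference has its only kink at \<open>Suc K\<close>. Subtracting
    it flattens the last segment and leaves the other second differences unchanged.\<close>
  define c' where "c' j = c j - a * real (Suc K - j)" for j
  have "pd_multiplier D c'"
  proof (rule Suc.IH)
    show "K \<le> D" using Suc.prems(1) by simp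
    show "2 * c' (Suc j) \<le> c' j + c' (Suc (Suc j))" for j
    proof (cases j K rule: linorder_cases)
      case less
      then have "real (Suc K - j) = real K + 1 - real j" "real (Suc K - Suc j) = real K - real j"
        "real (Suc K - Suc (Suc j)) = real K - 1 - real j"
        by (auto simp: of_nat_diff Suc_diff_le)
      then show ?thesis
        using Suc.prems(2)[of j] by (simp only: c'_def) (simp add: algebra_simps)
    next
      case equal
      then show ?thesis using c2 by (simp add: c'_def a_def)
    next
      case greater
      then show ?thesis using Suc.prems(2)[of j] by (simp add: c'_def)
    qed
    have c'K: "c' K = c (Suc K)" by (simp add: c'_def a_def)
    show "c' j = c' K" if "K \<le> j" for j
    proof (cases "j = K")
      case False
      then have "Suc K \<le> j" using that by simp
      then show ?thesis using Suc.prems(3)[of j] c'K by (simp add: c'_def)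
    qed simp
    show "0 \<le> c' K" using Suc.prems(4) c'K by simp
  qed
  from pd_multiplier_combination[OF this pd_multiplier_triangle[OF Suc.prems(1)] a]
  show ?case by (simp add: c'_def)
qed

text \<open>Polya's criterion for sequences.\<close>

lemma pd_multiplier_convex:
  assumes convex: "\<And>j. 2 * c (Suc j) \<le> c j + c (Suc (Suc j))" and dec: "\<And>j. c (Suc j) \<le> c j"
    and nonneg: "\<And>j. 0 \<le> c j"
  shows "pd_multiplier D c"
proof -
  \<comment> \<open>Values beyond D are not seen, so \<open>c\<close> may be frozen there; at the
    corner j + 1 = D convexity survives because \<open>c\<close> decreases.\<close>
  have "pd_multiplier D (\<lambda>j. c (min j D))"
  proof (rule pd_multiplier_eventually_const[of D])
    show "2 * c (min (Suc j) D) \<le> c (min j D) + c (min (Suc (Suc j)) D)" for j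
    proof -
      consider "Suc (Suc j) \<le> D" | "Suc j = D" | "D \<le> j" by linarith
      then show ?thesis
      proof cases
        case 1
        then have "min j D = j" "min (Suc j) D = Suc j" "min (Suc (Suc j)) D = Suc (Suc j)" by auto
        then show ?thesis using convex[of j] by simp
      next
        case 2
        then show ?thesis using dec[of j] by (auto simp: min_def)
      next
        case 3
        then have "min j D = D" "min (Suc j) D = D" "min (Suc (Suc j)) D = D" by auto
        then show ?thesis by simp
      qed
    qed
  qed (auto simp: nonneg)
  moreover have "min (nat \<bar>m\<bar>) D = nat \<bar>m\<bar>" if "\<bar>m\<bar> \<le> int D" for m :: int
    using that by auto
  ultimately show ?thesis
    unfolding pd_multiplier_def by (auto cong: imp_cong)
qed

text \<open>Since the degree is additive on holomorphic supports, the phases cis (2 pi s |\<alpha>|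
  / N) come from characters; the constant phases \<open>z s\<close> recentre them at degree
  d.\<close>

theorem qt_norm_multiplier_le:
  fixes c :: "nat \<Rightarrow> real"
  assumes x: "qt_poly n x" "qt_holomorphic x" and p: "1 \<le> p" and a: "0 \<le> a"
    and c: "\<And>j. 2 * c (Suc j) \<le> c j + c (Suc (Suc j))" "\<And>j. c (Suc j) \<le> c j" "\<And>j. 0 \<le> c j" "c 0 = 1"
    and y: "\<And>\<alpha>. y \<alpha> = complex_of_real (a * c (nat \<bar>int (mi_abs n \<alpha>) - int d\<bar>)) * x \<alpha>"
  shows "qt_norm \<theta> n p y \<le> a * qt_norm \<theta> n p x"
proof -
  obtain X where X: "x = cf X" "qt_poly n (cf X)"
    using x(1) by (rule qt_polyE)
  \<comment> \<open>A crude bound that puts every difference |\<alpha>| - d of the support into the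
    window.\<close>
  define D where "D = d + (\<Sum>\<alpha>\<in>qt_supp x. mi_abs n \<alpha>)"
  define N where "N = 2 * D + 1"
  obtain w where w: "\<And>s. s < N \<Longrightarrow> 0 \<le> w s"
    "\<And>m::int. \<bar>m\<bar> \<le> int D \<Longrightarrow> (\<Sum>s<N. complex_of_real (w s) * cis (2 * pi * real s * of_int m / real N)) = complex_of_real (c (nat \<bar>m\<bar>))"
    using pd_multiplier_convex[of c D, OF c(1) c(2) c(3)] unfolding pd_multiplier_def N_def[symmetric] by blast
  have w1: "(\<Sum>s<N. w s) = 1"
    using w(2)[of 0] c(4) by (simp flip: of_real_sum)
  define \<kappa> where "\<kappa> s \<alpha> = cis (2 * pi * real s * of_int (\<Sum>i<n. \<alpha> i) / real N)" for s and \<alpha> :: mindex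
  define z where "z s = cis (- (2 * pi * real s * real d / real N))" for s
  have \<kappa>: "qcharacter (\<kappa> s)" for s
    unfolding qcharacter_def \<kappa>_def by (simp add: cis_mult sum.distrib add_divide_distrib algebra_simps)
  define Y where "Y = (\<Sum>s<N. w s *\<^sub>R modulate (\<lambda>_. z s) (modulate (\<kappa> s) X))"
  have Y: "cf Y \<alpha> = complex_of_real (c (nat \<bar>int (mi_abs n \<alpha>) - int d\<bar>)) * x \<alpha>" for \<alpha>
  proof (cases "x \<alpha> = 0")
    case True
    then show ?thesis by (simp add: Y_def cf_sum X(1))
  next
    case False
    then have supp: "\<alpha> \<in> qt_supp x" by (simp add: qt_supp_def)
    then have "int (mi_abs n \<alpha>) = (\<Sum>i<n. \<alpha> i)"
      using x(2) by (simp add: qt_holomorphic_def mi_abs_def)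
    then have phase: "z s * \<kappa> s \<alpha> = cis (2 * pi * real s * of_int (int (mi_abs n \<alpha>) - int d) / real N)" for s
      by (simp add: z_def \<kappa>_def cis_mult diff_divide_distrib algebra_simps flip: of_int_sum)
    have "mi_abs n \<alpha> \<le> (\<Sum>\<alpha>\<in>qt_supp x. mi_abs n \<alpha>)"
      using x(1) supp by (intro member_le_sum) (auto simp: qt_poly_def)
    then have le: "\<bar>int (mi_abs n \<alpha>) - int d\<bar> \<le> int D"
      unfolding D_def by linarith
    have "cf Y \<alpha> = (\<Sum>s<N. complex_of_real (w s) * (z s * \<kappa> s \<alpha>)) * x \<alpha>"
      unfolding Y_def cf_sum sum_distrib_right by (intro sum.cong refl) (simp add: X(1) scaleR_conv_of_real)
    then show ?thesis
      by (simp only: phase w(2)[OF le])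
  qed
  have "qt_norm \<theta> n p (cf Y) \<le> qt_norm \<theta> n p (cf X)"
    by (rule qt_norm_average_le[OF _ _ w1 \<kappa> _ X(2) p Y_def]) (auto simp: w(1) z_def)
  moreover have "qt_poly n (cf Y)"
  proof -
    have "qt_supp (cf Y) \<subseteq> qt_supp x" by (auto simp: qt_supp_def Y)
    then show ?thesis using x(1) by (auto simp: qt_poly_def intro: finite_subset)
  qed
  then have "qt_norm \<theta> n p (cf (a *\<^sub>R Y)) \<le> a * qt_norm \<theta> n p (cf Y)"
    by (rule qt_norm_scaleR_le[OF _ a p])
  moreover have "cf (a *\<^sub>R Y) = y"
    by (rule ext) (simp add: y Y scaleR_conv_of_real)
  ultimately show ?thesis
    using mult_left_mono[OF _ a, of "qt_norm \<theta> n p (cf Y)" "qt_norm \<theta> n p (cf X)"] by (simp add: X(1))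
qed

section \<open>The three convex sequences and the four inequalities\<close>

lemma exp_sequence_convex:
  fixes t :: real
  assumes "0 \<le> t"
  shows "2 * exp (- t * real (Suc j)) \<le> exp (- t * real j) + exp (- t * real (Suc (Suc j)))"
    and "exp (- t * real (Suc j)) \<le> exp (- t * real j)"
proof -
  have eq: "exp (- t * real (Suc j)) = exp (- t * real j) * exp (- t)"
    "exp (- t * real (Suc (Suc j))) = exp (- t * real j) * (exp (- t) * exp (- t))"
    by (simp_all add: algebra_simps flip: exp_add)
  have "0 \<le> exp (- t * real j) * (1 - exp (- t))\<^sup>2" by simp
  then show "2 * exp (- t * real (Suc j)) \<le> exp (- t * real j) + exp (- t * real (Suc (Suc j)))"
    unfolding eq by (simp add: power2_eq_square algebra_simps)
  show "exp (- t * real (Suc j)) \<le> exp (- t * real j)"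
    using assms by (simp add: algebra_simps)
qed

lemma reciprocal_sequence_convex:
  fixes d :: real
  assumes "0 < d"
  shows "2 * (d / (d + real (Suc j))) \<le> d / (d + real j) + d / (d + real (Suc (Suc j)))"
    and "d / (d + real (Suc j)) \<le> d / (d + real j)"
proof -
  define b where "b = d + real j"
  have b: "0 < b" using assms by (simp add: b_def)
  have "b \<noteq> 0" "b + 1 \<noteq> 0" "b + 2 \<noteq> 0" using b by auto
  \<comment> \<open>The second difference of 1 / b in closed form, visibly positive.\<close>
  then have "1 / b + 1 / (b + 2) - 2 * (1 / (b + 1)) = 2 / (b * (b + 1) * (b + 2))"
    by (simp add: divide_simps) (simp add: algebra_simps)
  moreover have "0 \<le> 2 / (b * (b + 1) * (b + 2))" using b by simp
  ultimately have "2 * (1 / (b + 1)) \<le> 1 / b + 1 / (b + 2)"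
    by linarith
  then have "d * (2 * (1 / (b + 1))) \<le> d * (1 / b + 1 / (b + 2))"
    using assms by (intro mult_left_mono) auto
  then show "2 * (d / (d + real (Suc j))) \<le> d / (d + real j) + d / (d + real (Suc (Suc j)))"
    by (simp add: b_def algebra_simps)
  show "d / (d + real (Suc j)) \<le> d / (d + real j)"
    using assms by (intro divide_left_mono) auto
qed

lemma hat_sequence_convex:
  fixes d :: real
  assumes "0 < d"
  shows "2 * max 0 (1 - real (Suc j) / d) \<le> max 0 (1 - real j / d) + max 0 (1 - real (Suc (Suc j)) / d)"
    and "max 0 (1 - real (Suc j) / d) \<le> max 0 (1 - real j / d)"
proof -
  define h where "h = 1 / d"
  define a where "a = real j / d"
  have h: "0 < h" using assms by (simp add: h_def)
  have eq: "real j / d = a" "real (Suc j) / d = a + h" "real (Suc (Suc j)) / d = a + 2 * h"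
    by (simp_all add: h_def a_def add_divide_distrib)
  show "2 * max 0 (1 - real (Suc j) / d) \<le> max 0 (1 - real j / d) + max 0 (1 - real (Suc (Suc j)) / d)"
    "max 0 (1 - real (Suc j) / d) \<le> max 0 (1 - real j / d)"
    unfolding eq using h by (auto simp: max_def)
qed

lemma qt_supp_multiplier:
  assumes "qt_poly n x" "qt_holomorphic x"
  shows "qt_poly n (\<lambda>\<alpha>. g \<alpha> * x \<alpha>)" "qt_holomorphic (\<lambda>\<alpha>. g \<alpha> * x \<alpha>)"
proof -
  have "qt_supp (\<lambda>\<alpha>. g \<alpha> * x \<alpha>) \<subseteq> qt_supp x" by (auto simp: qt_supp_def)
  then show "qt_poly n (\<lambda>\<alpha>. g \<alpha> * x \<alpha>)" "qt_holomorphic (\<lambda>\<alpha>. g \<alpha> * x \<alpha>)"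
    using assms by (auto simp: qt_poly_def qt_holomorphic_def intro: finite_subset)
qed

theorem theorem1p8:
  fixes n d :: nat and \<theta> :: "nat \<Rightarrow> nat \<Rightarrow> real" and p :: ereal and x :: qpoly
  assumes "1 \<le> n"
    and "\<forall>j<n. \<forall>k<n. \<theta> j k = - \<theta> k j"
    and "1 \<le> p"
    and "1 \<le> d"
    and "qt_poly n x" and "qt_holomorphic x"
  shows "(qt_deg_ge n d x \<longrightarrow>
            (\<forall>t\<ge>0. qt_norm \<theta> n p (qt_P n t x) \<le> exp (- t * real d) * qt_norm \<theta> n p x) \<and>
            real d * qt_norm \<theta> n p x \<le> qt_norm \<theta> n p (qt_L n x)) \<and>
         (qt_deg_le n d x \<longrightarrow>
            qt_norm \<theta> n p (qt_L n x) \<le> real d * qt_norm \<theta> n p x \<and>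
            (\<forall>t\<ge>0. exp (- t * real d) * qt_norm \<theta> n p x \<le> qt_norm \<theta> n p (qt_P n t x)))"
proof (intro conjI impI allI)
  note p = \<open>1 \<le> p\<close> and x = \<open>qt_poly n x\<close> \<open>qt_holomorphic x\<close>
  have d: "0 < real d" using \<open>1 \<le> d\<close> by simp
  have L: "qt_poly n (qt_L n x)" "qt_holomorphic (qt_L n x)"
    unfolding qt_L_def by (rule qt_supp_multiplier[OF x])+
  have P: "qt_poly n (qt_P n t x)" "qt_holomorphic (qt_P n t x)" for t
    unfolding qt_P_def by (rule qt_supp_multiplier[OF x])+
  {
    assume "qt_deg_ge n d x"
    then have ge: "d \<le> mi_abs n \<alpha>" if "x \<alpha> \<noteq> 0" for \<alpha>
      using that by (auto simp: qt_deg_ge_def qt_supp_def)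
    fix t :: real assume t: "0 \<le> t"
    show "qt_norm \<theta> n p (qt_P n t x) \<le> exp (- t * real d) * qt_norm \<theta> n p x"
    \<comment> \<open>For |\<alpha>| \<ge> d, split exp (- t |\<alpha>|) as exp (- t d) exp (- t
      (|\<alpha>| - d)).\<close>
    proof (rule qt_norm_multiplier_le[OF x p, where d = d and c = "\<lambda>j. exp (- t * real j)"])
      fix \<alpha>
      show "qt_P n t x \<alpha> = complex_of_real (exp (- t * real d) * exp (- t * real (nat \<bar>int (mi_abs n \<alpha>) - int d\<bar>))) * x \<alpha>"
      proof (cases "x \<alpha> = 0")
        case False
        then have "real (nat \<bar>int (mi_abs n \<alpha>) - int d\<bar>) = real (mi_abs n \<alpha>) - real d"
          using ge[OF False] by simp
        then show ?thesis
          by (simp only: qt_P_def flip: exp_add) (simp add: algebra_simps)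
      qed (simp add: qt_P_def)
    qed (use exp_sequence_convex[OF t] in auto)
  next
    assume "qt_deg_ge n d x"
    then have ge: "d \<le> mi_abs n \<alpha>" if "x \<alpha> \<noteq> 0" for \<alpha>
      using that by (auto simp: qt_deg_ge_def qt_supp_def)
    \<comment> \<open>L is inverted on the support: 1 / |\<alpha>| is 1 / d times d / (d + j) with j
      = |\<alpha>| - d.\<close>
    have "qt_norm \<theta> n p x \<le> 1 / real d * qt_norm \<theta> n p (qt_L n x)"
    proof (rule qt_norm_multiplier_le[OF L p, where d = d and c = "\<lambda>j. real d / (real d + real j)"])
      fix \<alpha>
      show "x \<alpha> = complex_of_real (1 / real d * (real d / (real d + real (nat \<bar>int (mi_abs n \<alpha>) - int d\<bar>)))) * qt_L n x \<alpha>"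
      proof (cases "x \<alpha> = 0")
        case False
        then have "real d + real (nat \<bar>int (mi_abs n \<alpha>) - int d\<bar>) = real (mi_abs n \<alpha>)" "0 < real (mi_abs n \<alpha>)"
          using ge[OF False] d by auto
        then show ?thesis
          using d by (simp only: qt_L_def) simp
      qed (simp add: qt_L_def)
    qed (use d reciprocal_sequence_convex[OF d] in auto)
    then show "real d * qt_norm \<theta> n p x \<le> qt_norm \<theta> n p (qt_L n x)"
      using d by (simp add: field_simps)
  next
    assume "qt_deg_le n d x"
    then have le: "mi_abs n \<alpha> \<le> d" if "x \<alpha> \<noteq> 0" for \<alpha>
      using that by (auto simp: qt_deg_le_def qt_supp_def)
    \<comment> \<open>For |\<alpha>| \<le> d, write |\<alpha>| = d (1 - j / d) with j = d -
      |\<alpha>|; the positive part only continues this convexly beyond j = d.\<close>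
    show "qt_norm \<theta> n p (qt_L n x) \<le> real d * qt_norm \<theta> n p x"
    proof (rule qt_norm_multiplier_le[OF x p, where d = d and c = "\<lambda>j. max 0 (1 - real j / real d)"])
      fix \<alpha>
      show "qt_L n x \<alpha> = complex_of_real (real d * max 0 (1 - real (nat \<bar>int (mi_abs n \<alpha>) - int d\<bar>) / real d)) * x \<alpha>"
      proof (cases "x \<alpha> = 0")
        case False
        then have "real (nat \<bar>int (mi_abs n \<alpha>) - int d\<bar>) = real d - real (mi_abs n \<alpha>)"
          using le[OF False] by simp
        then have "real d * max 0 (1 - real (nat \<bar>int (mi_abs n \<alpha>) - int d\<bar>) / real d) = real (mi_abs n \<alpha>)"
          using d by (simp add: diff_divide_distrib max_def)
        then show ?thesis
          by (simp only: qt_L_def) simp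
      qed (simp add: qt_L_def)
    next
      fix j
      show "2 * max 0 (1 - real (Suc j) / real d) \<le> max 0 (1 - real j / real d) + max 0 (1 - real (Suc (Suc j)) / real d)"
        "max 0 (1 - real (Suc j) / real d) \<le> max 0 (1 - real j / real d)"
        using hat_sequence_convex[OF d] by auto
    qed (use d in auto)
  next
    assume "qt_deg_le n d x"
    then have le: "mi_abs n \<alpha> \<le> d" if "x \<alpha> \<noteq> 0" for \<alpha>
      using that by (auto simp: qt_deg_le_def qt_supp_def)
    fix t :: real assume t: "0 \<le> t"
    \<comment> \<open>The inverse factor exp (t |\<alpha>|) is exp (t d) exp (- t j) with j = d -
      |\<alpha>|, again a decaying multiplier centred at d.\<close>
    have "qt_norm \<theta> n p x \<le> exp (t * real d) * qt_norm \<theta> n p (qt_P n t x)"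
    proof (rule qt_norm_multiplier_le[OF P p, where d = d and c = "\<lambda>j. exp (- t * real j)"])
      fix \<alpha>
      show "x \<alpha> = complex_of_real (exp (t * real d) * exp (- t * real (nat \<bar>int (mi_abs n \<alpha>) - int d\<bar>))) * qt_P n t x \<alpha>"
      proof (cases "x \<alpha> = 0")
        case False
        then have "real (nat \<bar>int (mi_abs n \<alpha>) - int d\<bar>) = real d - real (mi_abs n \<alpha>)"
          using le[OF False] by simp
        then have "exp (t * real d) * exp (- t * real (nat \<bar>int (mi_abs n \<alpha>) - int d\<bar>)) * exp (- t * real (mi_abs n \<alpha>)) = 1"
          by (simp add: algebra_simps flip: exp_add)
        then show ?thesis
          by (simp only: qt_P_def mult.assoc[symmetric] of_real_mult[symmetric]) simp
      qed (simp add: qt_P_def)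
    qed (use exp_sequence_convex[OF t] in auto)
    then have "exp (- t * real d) * qt_norm \<theta> n p x \<le> exp (- t * real d) * (exp (t * real d) * qt_norm \<theta> n p (qt_P n t x))"
      by (intro mult_left_mono) auto
    then show "exp (- t * real d) * qt_norm \<theta> n p x \<le> qt_norm \<theta> n p (qt_P n t x)"
      by (simp add: exp_minus field_simps)
  }
qed

end
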